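(* Let $A$ be a 4-dimensional Sklyanin algebra over $\mathbb{C}$ whose associated automorphism of its elliptic curve $E$ is translation by a point $\tau\in E$, and suppose that $|\tau|=\infty$. Suppose that the Klein four-group $G=\langle g_1,g_2\rangle$ acts on $A$ by $\mathbb{N}$-graded algebra automorphisms, given on a set of degree-1 algebra generators $X_0,X_1,X_2,X_3$ of $A$ by $$X_i^{g_1}=X_{i+2},\qquad X_i^{g_2}=(-1)^iX_i\qquad(\text{indices modulo }4).$$ Let $G$ act on $M_2(\mathbb{C})$ by letting $g_1$ act as conjugation by $\begin{pmatrix}-1&0\\0&1\end{pmatrix}$ and $g_2$ act as conjugation by $\begin{pmatrix}0&1\\1&0\end{pmatrix}$, and let $G$ act diagonally on $A\otimes_{\mathbb{C}}M_2(\mathbb{C})$. Then the invariant ring $(A\otimes_{\mathbb{C}}M_2(\mathbb{C}))^G$ (Odesskii's example) is isomorphic to the algebra generated by $v_0,v_1,v_2,v_3$ subject to the relations $$[v_0,v_1]-\alpha'[v_2,v_3],\quad[v_0,v_1]_+-[v_2,v_3]_+,\quad[v_0,v_2]-\beta'[v_3,v_1],$$ $$[v_0,v_2]_+-[v_3,v_1]_+,\quad[v_0,v_3]+\gamma'[v_1,v_2],\quad[v_0,v_3]_++[v_1,v_2]_+$$ for some $\alpha',\beta',\gamma'\in\mathbb{C}$ with $\alpha'+\beta'+\gamma'+\alpha'\beta'\gamma'=0$ and $\{\alpha',\beta',\gamma'\}\cap\{0,\pm1\}=\emptyset$.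
   Context: Here $[x,y]=xy-yx$, $[x,y]_+=xy+yx$. A 4-dimensional Sklyanin algebra is an algebra $A(\alpha,\beta,\gamma)$, where $\alpha,\beta,\gamma$ satisfy $\alpha+\beta+\gamma+\alpha\beta\gamma=0$ and $\{\alpha,\beta,\gamma\}\cap\{0,\pm1\}=\emptyset$, with degree-1 generators $x_0,\dots,x_3$ and relations $[x_0,x_1]-\alpha[x_2,x_3]_+$, $[x_0,x_1]_+-[x_2,x_3]$, $[x_0,x_2]-\beta[x_3,x_1]_+$, $[x_0,x_2]_+-[x_3,x_1]$, $[x_0,x_3]-\gamma[x_1,x_2]_+$, $[x_0,x_3]_+-[x_1,x_2]$. The generators $X_i$ in the claim need not be the generators $x_i$. The point modules over $A$ (cyclic $\mathbb{N}$-graded right modules with Hilbert series $1/(1-t)$) are parameterised by the elliptic curve $E\subset\mathbb{P}^3$ given by $y_0^2+y_1^2+y_2^2+y_3^2=0$, $y_3^2+\frac{1-\gamma}{1+\alpha}y_1^2+\frac{1+\gamma}{1-\beta}y_2^2=0$, together with four further points; writing $M_p$ for the point module of $p\in E$, the associated automorphism of $E$ is defined by $M_p\mapsto M_p[1]_{\ge0}$ (with $M[1]_n=M_{n+1}$) and is translation by the point $\tau$. $|\tau|$ denotes the order of $\tau$. *)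

theory Defs
  imports
    "HOL-Analysis.Analysis"
    "HOL-Library.Poly_Mapping"
    "HOL-Computational_Algebra.Formal_Power_Series"
    "HOL-Algebra.Module"
    "HOL-Algebra.QuotRing"
    "HOL-Algebra.Subrings"
    "HOL-Algebra.Generated_Groups"
    "HOL-Algebra.Group_Action"
begin

section \<open>Associative algebras over the complex numbers\<close>

text \<open>
  A complex algebra is represented by a record of type \<open>(complex, 'a) module\<close>: the (noncommutative)
  ring structure together with scalar multiplication. The library locale \<open>algebra\<close> is for
  commutative algebras only and is not used.
\<close>

type_synonym 'a calgebra = "(complex, 'a) module"

definition calgebra_iso :: "'a calgebra \<Rightarrow> 'b calgebra \<Rightarrow> ('a \<Rightarrow> 'b) set" where
  "calgebra_iso R S =
     {h \<in> ring_iso R S. \<forall>c. \<forall>a\<in>carrier R. h (c \<odot>\<^bsub>R\<^esub> a) = c \<odot>\<^bsub>S\<^esub> h a}"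

definition calgebra_isomorphic :: "'a calgebra \<Rightarrow> 'b calgebra \<Rightarrow> bool" where
  "calgebra_isomorphic R S \<longleftrightarrow> calgebra_iso R S \<noteq> {}"

definition graded_automorphism :: "'a calgebra \<Rightarrow> (nat \<Rightarrow> 'a set) \<Rightarrow> ('a \<Rightarrow> 'a) \<Rightarrow> bool" where
  "graded_automorphism A Adeg h \<longleftrightarrow> h \<in> calgebra_iso A A \<and> (\<forall>n. h ` Adeg n = Adeg n)"

definition generates_calgebra :: "'a calgebra \<Rightarrow> 'a set \<Rightarrow> bool" where
  "generates_calgebra A X \<longleftrightarrow> X \<subseteq> carrier A \<and>
     (\<forall>S. subring S A \<and> (\<forall>c. \<forall>s\<in>S. c \<odot>\<^bsub>A\<^esub> s \<in> S) \<and> X \<subseteq> S \<longrightarrow> S = carrier A)"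

text \<open>The monoid algebra \<open>\<complex>[M]\<close>; \<open>single m c\<close> is the element \<open>c m\<close>.\<close>

definition monoid_algebra :: "'m monoid \<Rightarrow> ('m \<Rightarrow>\<^sub>0 complex) calgebra" where
  "monoid_algebra M =
     \<lparr> carrier = {f. Poly_Mapping.keys f \<subseteq> carrier M},
       mult = (\<lambda>f g. \<Sum>x\<in>Poly_Mapping.keys f. \<Sum>y\<in>Poly_Mapping.keys g.
                 Poly_Mapping.single (x \<otimes>\<^bsub>M\<^esub> y) (Poly_Mapping.lookup f x * Poly_Mapping.lookup g y)),
       one = Poly_Mapping.single \<one>\<^bsub>M\<^esub> 1,
       zero = 0,
       add = (+),
       smult = (\<lambda>c f. Poly_Mapping.map (\<lambda>x. c * x) f) \<rparr>"

text \<open>For a two-sided ideal \<open>I\<close>, scalars act on cosets by \<open>c \<odot> (I + x) = I + (c \<odot> x)\<close>.\<close>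

definition quotient_calgebra :: "'a calgebra \<Rightarrow> 'a set \<Rightarrow> 'a set calgebra" where
  "quotient_calgebra R I =
     ring.extend (R Quot I) (module.fields (\<lambda>c X. \<Union>x\<in>X. I +>\<^bsub>R\<^esub> (c \<odot>\<^bsub>R\<^esub> x)))"


section \<open>Algebras given by generators and relations\<close>

definition free_calgebra :: "('i list \<Rightarrow>\<^sub>0 complex) calgebra" where
  "free_calgebra = monoid_algebra \<lparr>carrier = UNIV, mult = (@), one = []\<rparr>"

definition free_gen :: "'i \<Rightarrow> ('i list \<Rightarrow>\<^sub>0 complex)" where
  "free_gen i = Poly_Mapping.single [i] 1"

type_synonym 'i presented = "('i list \<Rightarrow>\<^sub>0 complex) set"

definition relation_ideal :: "('i list \<Rightarrow>\<^sub>0 complex) set \<Rightarrow> ('i list \<Rightarrow>\<^sub>0 complex) set" where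
  "relation_ideal rels = genideal free_calgebra rels"

definition presented_calgebra :: "('i list \<Rightarrow>\<^sub>0 complex) set \<Rightarrow> 'i presented calgebra" where
  "presented_calgebra rels = quotient_calgebra free_calgebra (relation_ideal rels)"

definition presented_gen :: "('i list \<Rightarrow>\<^sub>0 complex) set \<Rightarrow> 'i \<Rightarrow> 'i presented" where
  "presented_gen rels i = relation_ideal rels +>\<^bsub>free_calgebra\<^esub> free_gen i"

text \<open>The degree-\<open>n\<close> piece, all generators having degree 1 (for homogeneous relations).\<close>

definition presented_degree :: "('i list \<Rightarrow>\<^sub>0 complex) set \<Rightarrow> nat \<Rightarrow> 'i presented set" where
  "presented_degree rels n =
     {relation_ideal rels +>\<^bsub>free_calgebra\<^esub> f | f. \<forall>w\<in>Poly_Mapping.keys f. length w = n}"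

definition comm :: "('a, 'b) ring_scheme \<Rightarrow> 'a \<Rightarrow> 'a \<Rightarrow> 'a" where
  "comm R x y = (x \<otimes>\<^bsub>R\<^esub> y) \<ominus>\<^bsub>R\<^esub> (y \<otimes>\<^bsub>R\<^esub> x)"

definition anticomm :: "('a, 'b) ring_scheme \<Rightarrow> 'a \<Rightarrow> 'a \<Rightarrow> 'a" where
  "anticomm R x y = (x \<otimes>\<^bsub>R\<^esub> y) \<oplus>\<^bsub>R\<^esub> (y \<otimes>\<^bsub>R\<^esub> x)"


section \<open>Four-dimensional Sklyanin algebras\<close>

definition sklyanin_parameters :: "complex \<Rightarrow> complex \<Rightarrow> complex \<Rightarrow> bool" where
  "sklyanin_parameters \<alpha> \<beta> \<gamma> \<longleftrightarrow>
     \<alpha> + \<beta> + \<gamma> + \<alpha> * \<beta> * \<gamma> = 0 \<and> {\<alpha>, \<beta>, \<gamma>} \<inter> {0, 1, -1} = {}"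

text \<open>
  The index type \<open>4\<close> is the type of integers modulo 4, with elements \<open>0, 1, 2, 3\<close>.
\<close>

definition sklyanin_relations :: "complex \<Rightarrow> complex \<Rightarrow> complex \<Rightarrow> (4 list \<Rightarrow>\<^sub>0 complex) set" where
  "sklyanin_relations \<alpha> \<beta> \<gamma> =
     (let F = free_calgebra; x = free_gen in
      { comm F (x 0) (x 1) \<ominus>\<^bsub>F\<^esub> (\<alpha> \<odot>\<^bsub>F\<^esub> anticomm F (x 2) (x 3)),
        anticomm F (x 0) (x 1) \<ominus>\<^bsub>F\<^esub> comm F (x 2) (x 3),
        comm F (x 0) (x 2) \<ominus>\<^bsub>F\<^esub> (\<beta> \<odot>\<^bsub>F\<^esub> anticomm F (x 3) (x 1)),
        anticomm F (x 0) (x 2) \<ominus>\<^bsub>F\<^esub> comm F (x 3) (x 1),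
        comm F (x 0) (x 3) \<ominus>\<^bsub>F\<^esub> (\<gamma> \<odot>\<^bsub>F\<^esub> anticomm F (x 1) (x 2)),
        anticomm F (x 0) (x 3) \<ominus>\<^bsub>F\<^esub> comm F (x 1) (x 2) })"

definition sklyanin :: "complex \<Rightarrow> complex \<Rightarrow> complex \<Rightarrow> 4 presented calgebra" where
  "sklyanin \<alpha> \<beta> \<gamma> = presented_calgebra (sklyanin_relations \<alpha> \<beta> \<gamma>)"

definition sklyanin_degree :: "complex \<Rightarrow> complex \<Rightarrow> complex \<Rightarrow> nat \<Rightarrow> 4 presented set" where
  "sklyanin_degree \<alpha> \<beta> \<gamma> = presented_degree (sklyanin_relations \<alpha> \<beta> \<gamma>)"

definition sklyanin_gen :: "complex \<Rightarrow> complex \<Rightarrow> complex \<Rightarrow> 4 \<Rightarrow> 4 presented" where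
  "sklyanin_gen \<alpha> \<beta> \<gamma> = presented_gen (sklyanin_relations \<alpha> \<beta> \<gamma>)"

definition odesskii_relations :: "complex \<Rightarrow> complex \<Rightarrow> complex \<Rightarrow> (4 list \<Rightarrow>\<^sub>0 complex) set" where
  "odesskii_relations \<alpha> \<beta> \<gamma> =
     (let F = free_calgebra; v = free_gen in
      { comm F (v 0) (v 1) \<ominus>\<^bsub>F\<^esub> (\<alpha> \<odot>\<^bsub>F\<^esub> comm F (v 2) (v 3)),
        anticomm F (v 0) (v 1) \<ominus>\<^bsub>F\<^esub> anticomm F (v 2) (v 3),
        comm F (v 0) (v 2) \<ominus>\<^bsub>F\<^esub> (\<beta> \<odot>\<^bsub>F\<^esub> comm F (v 3) (v 1)),
        anticomm F (v 0) (v 2) \<ominus>\<^bsub>F\<^esub> anticomm F (v 3) (v 1),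
        comm F (v 0) (v 3) \<oplus>\<^bsub>F\<^esub> (\<gamma> \<odot>\<^bsub>F\<^esub> comm F (v 1) (v 2)),
        anticomm F (v 0) (v 3) \<oplus>\<^bsub>F\<^esub> anticomm F (v 1) (v 2) })"


section \<open>Point modules\<close>

text \<open>
  Right modules reuse the record type \<open>module\<close>: \<open>a \<odot>\<^bsub>M\<^esub> m\<close> is to be read as the right action \<open>m a\<close>
  (the fields \<open>mult\<close> and \<open>one\<close> of \<open>M\<close> play no role). The complex vector space structure is
  the one induced by \<open>c \<mapsto> c \<odot> 1\<close> in \<open>A\<close>. The function \<open>Mdeg\<close> gives the homogeneous components.
\<close>

locale graded_right_module = abelian_group M
  for A :: "'a calgebra" and Adeg :: "nat \<Rightarrow> 'a set"
    and M :: "('a, 'm) module" and Mdeg :: "nat \<Rightarrow> 'm set" +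
  assumes act_closed: "\<lbrakk>a \<in> carrier A; m \<in> carrier M\<rbrakk> \<Longrightarrow> a \<odot>\<^bsub>M\<^esub> m \<in> carrier M"
    and act_add_left: "\<lbrakk>a \<in> carrier A; b \<in> carrier A; m \<in> carrier M\<rbrakk> \<Longrightarrow>
      (a \<oplus>\<^bsub>A\<^esub> b) \<odot>\<^bsub>M\<^esub> m = (a \<odot>\<^bsub>M\<^esub> m) \<oplus>\<^bsub>M\<^esub> (b \<odot>\<^bsub>M\<^esub> m)"
    and act_add_right: "\<lbrakk>a \<in> carrier A; m \<in> carrier M; m' \<in> carrier M\<rbrakk> \<Longrightarrow>
      a \<odot>\<^bsub>M\<^esub> (m \<oplus>\<^bsub>M\<^esub> m') = (a \<odot>\<^bsub>M\<^esub> m) \<oplus>\<^bsub>M\<^esub> (a \<odot>\<^bsub>M\<^esub> m')"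
    and act_mult: "\<lbrakk>a \<in> carrier A; b \<in> carrier A; m \<in> carrier M\<rbrakk> \<Longrightarrow>
      (a \<otimes>\<^bsub>A\<^esub> b) \<odot>\<^bsub>M\<^esub> m = b \<odot>\<^bsub>M\<^esub> (a \<odot>\<^bsub>M\<^esub> m)"
    and act_one: "m \<in> carrier M \<Longrightarrow> \<one>\<^bsub>A\<^esub> \<odot>\<^bsub>M\<^esub> m = m"
    and component: "additive_subgroup (Mdeg n) M"
    and act_degree: "\<lbrakk>a \<in> Adeg k; m \<in> Mdeg n\<rbrakk> \<Longrightarrow> a \<odot>\<^bsub>M\<^esub> m \<in> Mdeg (n + k)"
    and direct_sum: "m \<in> carrier M \<Longrightarrow>
      \<exists>!f. (\<forall>n. f n \<in> Mdeg n) \<and> finite {n. f n \<noteq> \<zero>\<^bsub>M\<^esub>} \<and>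
           m = finsum M f {n. f n \<noteq> \<zero>\<^bsub>M\<^esub>}"

definition cyclic_module :: "'a calgebra \<Rightarrow> ('a, 'm) module \<Rightarrow> bool" where
  "cyclic_module A M \<longleftrightarrow> (\<exists>m\<in>carrier M. carrier M = (\<lambda>a. a \<odot>\<^bsub>M\<^esub> m) ` carrier A)"

text \<open>\<open>V\<close> has a complex basis with \<open>d\<close> elements.\<close>

definition has_dimension :: "'a calgebra \<Rightarrow> ('a, 'm) module \<Rightarrow> 'm set \<Rightarrow> nat \<Rightarrow> bool" where
  "has_dimension A M V d \<longleftrightarrow>
     (\<exists>B. finite B \<and> card B = d \<and> B \<subseteq> V \<and>
        (\<forall>v\<in>V. \<exists>!c. c \<in> extensional B \<and>
           v = (\<Oplus>\<^bsub>M\<^esub>b\<in>B. ((c b \<odot>\<^bsub>A\<^esub> \<one>\<^bsub>A\<^esub>) \<odot>\<^bsub>M\<^esub> b))))"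

definition has_hilbert_series ::
    "'a calgebra \<Rightarrow> ('a, 'm) module \<Rightarrow> (nat \<Rightarrow> 'm set) \<Rightarrow> rat fps \<Rightarrow> bool" where
  "has_hilbert_series A M Mdeg H \<longleftrightarrow>
     (\<forall>n. \<exists>d. has_dimension A M (Mdeg n) d \<and> fps_nth H n = of_nat d)"

definition point_module ::
    "'a calgebra \<Rightarrow> (nat \<Rightarrow> 'a set) \<Rightarrow> ('a, 'm) module \<Rightarrow> (nat \<Rightarrow> 'm set) \<Rightarrow> bool" where
  "point_module A Adeg M Mdeg \<longleftrightarrow>
     graded_right_module A Adeg M Mdeg \<and> cyclic_module A M \<and>
     has_hilbert_series A M Mdeg (inverse (1 - fps_X))"

text \<open>The shifted and truncated module \<open>M[1]\<^bsub>\<ge>0\<^esub>\<close>: it has components \<open>M[1]\<^sub>n = M\<^bsub>n+1\<^esub>\<close>.\<close>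

definition shift_degree :: "(nat \<Rightarrow> 'm set) \<Rightarrow> nat \<Rightarrow> 'm set" where
  "shift_degree Mdeg n = Mdeg (n + 1)"

definition shift_module :: "('a, 'm) module \<Rightarrow> (nat \<Rightarrow> 'm set) \<Rightarrow> ('a, 'm) module" where
  "shift_module M Mdeg = M \<lparr>carrier :=
     {finsum M f {n. f n \<noteq> \<zero>\<^bsub>M\<^esub>} | f.
        (\<forall>n. f n \<in> shift_degree Mdeg n) \<and> finite {n. f n \<noteq> \<zero>\<^bsub>M\<^esub>}}\<rparr>"


section \<open>The elliptic curve and its automorphism\<close>

text \<open>A point of projective 3-space is the set of its homogeneous coordinate vectors.\<close>

definition proj :: "complex ^ 4 \<Rightarrow> (complex ^ 4) set" where
  "proj y = {c *s y | c. c \<noteq> 0}"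

definition sklyanin_curve :: "complex \<Rightarrow> complex \<Rightarrow> complex \<Rightarrow> (complex ^ 4) set set" where
  "sklyanin_curve \<alpha> \<beta> \<gamma> =
     {proj y | y. y \<noteq> 0 \<and>
        (y $ 0)\<^sup>2 + (y $ 1)\<^sup>2 + (y $ 2)\<^sup>2 + (y $ 3)\<^sup>2 = 0 \<and>
        (y $ 3)\<^sup>2 + (1 - \<gamma>) / (1 + \<alpha>) * (y $ 1)\<^sup>2 + (1 + \<gamma>) / (1 - \<beta>) * (y $ 2)\<^sup>2 = 0}"

text \<open>
  A point module \<open>M\<close> over \<open>A(\<alpha>,\<beta>,\<gamma>)\<close> is (up to isomorphism) the module \<open>M\<^sub>p\<close>, with \<open>p\<close> a point of the
  projective space of \<open>A\<^sub>1\<^sup>*\<close>, if the elements of \<open>A\<^sub>1\<close> annihilating \<open>M\<^sub>0\<close> are exactly the linear forms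
  vanishing at \<open>p\<close>; the coordinates \<open>y\<^sub>i\<close> are dual to the generators \<open>x\<^sub>i\<close>.
\<close>

definition point_module_of ::
    "complex \<Rightarrow> complex \<Rightarrow> complex \<Rightarrow> (complex ^ 4) set \<Rightarrow>
     (4 presented, 'm) module \<Rightarrow> (nat \<Rightarrow> 'm set) \<Rightarrow> bool" where
  "point_module_of \<alpha> \<beta> \<gamma> p M Mdeg \<longleftrightarrow>
     point_module (sklyanin \<alpha> \<beta> \<gamma>) (sklyanin_degree \<alpha> \<beta> \<gamma>) M Mdeg \<and>
     (\<exists>y. y \<noteq> 0 \<and> p = proj y \<and>
        (\<forall>c :: complex ^ 4.
           (\<forall>m\<in>Mdeg 0.
              (\<Oplus>\<^bsub>sklyanin \<alpha> \<beta> \<gamma>\<^esub>i\<in>UNIV. (c $ i \<odot>\<^bsub>sklyanin \<alpha> \<beta> \<gamma>\<^esub> sklyanin_gen \<alpha> \<beta> \<gamma> i)) \<odot>\<^bsub>M\<^esub> m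
                = \<zero>\<^bsub>M\<^esub>)
           \<longleftrightarrow> (\<Sum>i\<in>UNIV. c $ i * y $ i) = 0))"

text \<open>
  \<open>\<sigma>\<close> is the map \<open>M\<^sub>p \<mapsto> M\<^sub>p[1]\<^bsub>\<ge>0\<^esub>\<close> in terms of points of \<open>E\<close>. A point module has countable
  dimension, so up to isomorphism it lives on the type \<open>nat \<Rightarrow>\<^sub>0 complex\<close>.
\<close>

definition associated_automorphism ::
    "complex \<Rightarrow> complex \<Rightarrow> complex \<Rightarrow> ((complex ^ 4) set \<Rightarrow> (complex ^ 4) set) \<Rightarrow> bool" where
  "associated_automorphism \<alpha> \<beta> \<gamma> \<sigma> \<longleftrightarrow>
     bij_betw \<sigma> (sklyanin_curve \<alpha> \<beta> \<gamma>) (sklyanin_curve \<alpha> \<beta> \<gamma>) \<and>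
     (\<forall>p\<in>sklyanin_curve \<alpha> \<beta> \<gamma>.
        \<exists>(M :: (4 presented, nat \<Rightarrow>\<^sub>0 complex) module) Mdeg.
          point_module_of \<alpha> \<beta> \<gamma> p M Mdeg \<and>
          point_module_of \<alpha> \<beta> \<gamma> (\<sigma> p) (shift_module M Mdeg) (shift_degree Mdeg))"

text \<open>
  The group law of a complex elliptic curve \<open>E\<close> in projective 3-space: it is transported from a complex torus
  \<open>\<complex>/\<Lambda>\<close> along a uniformisation \<open>\<phi>\<close>, which is holomorphic in the sense that locally it has nowhere
  vanishing holomorphic homogeneous coordinates. The neutral element \<open>\<phi> 0\<close> may be any point of \<open>E\<close>.
\<close>

definition elliptic_group_law :: "(complex ^ 4) set set \<Rightarrow> (complex ^ 4) set monoid \<Rightarrow> bool" where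
  "elliptic_group_law E L \<longleftrightarrow>
     group L \<and> carrier L = E \<and>
     (\<exists>\<omega>\<^sub>1 \<omega>\<^sub>2 (\<phi> :: complex \<Rightarrow> (complex ^ 4) set).
        Im (\<omega>\<^sub>2 * cnj \<omega>\<^sub>1) \<noteq> 0 \<and>
        (\<forall>z. \<exists>U f. open U \<and> z \<in> U \<and>
           (\<forall>i. (\<lambda>w. f w $ i) holomorphic_on U) \<and>
           (\<forall>w\<in>U. f w \<noteq> (0 :: complex ^ 4) \<and> \<phi> w = proj (f w))) \<and>
        range \<phi> = E \<and>
        (\<forall>z w. \<phi> z = \<phi> w \<longleftrightarrow> (\<exists>m n :: int. z - w = of_int m * \<omega>\<^sub>1 + of_int n * \<omega>\<^sub>2)) \<and>
        (\<forall>z w. \<phi> (z + w) = \<phi> z \<otimes>\<^bsub>L\<^esub> \<phi> w))"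


section \<open>Tensor products, group actions and invariants\<close>

text \<open>
  The tensor product of two algebras is the monoid algebra of the product of their multiplicative
  monoids (the free vector space on the symbols \<open>a \<otimes> b\<close>, with
  \<open>(a \<otimes> b)(a' \<otimes> b') = aa' \<otimes> bb'\<close>) modulo the bilinearity relations, whose linear span
  already is an ideal.
\<close>

definition tensor_relations :: "'a calgebra \<Rightarrow> 'b calgebra \<Rightarrow> ('a \<times> 'b \<Rightarrow>\<^sub>0 complex) set" where
  "tensor_relations A B =
     (let t = (\<lambda>a b c. Poly_Mapping.single (a, b) c) in
      {t (a \<oplus>\<^bsub>A\<^esub> a') b 1 - t a b 1 - t a' b 1 | a a' b.
         a \<in> carrier A \<and> a' \<in> carrier A \<and> b \<in> carrier B} \<union>
      {t a (b \<oplus>\<^bsub>B\<^esub> b') 1 - t a b 1 - t a b' 1 | a b b'.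
         a \<in> carrier A \<and> b \<in> carrier B \<and> b' \<in> carrier B} \<union>
      {t (c \<odot>\<^bsub>A\<^esub> a) b 1 - t a b c | c a b. a \<in> carrier A \<and> b \<in> carrier B} \<union>
      {t a (c \<odot>\<^bsub>B\<^esub> b) 1 - t a b c | c a b. a \<in> carrier A \<and> b \<in> carrier B})"

definition tensor_ideal :: "'a calgebra \<Rightarrow> 'b calgebra \<Rightarrow> ('a \<times> 'b \<Rightarrow>\<^sub>0 complex) set" where
  "tensor_ideal A B = genideal (monoid_algebra (A \<times>\<times> B)) (tensor_relations A B)"

definition tensor_calgebra :: "'a calgebra \<Rightarrow> 'b calgebra \<Rightarrow> ('a \<times> 'b \<Rightarrow>\<^sub>0 complex) set calgebra" where
  "tensor_calgebra A B = quotient_calgebra (monoid_algebra (A \<times>\<times> B)) (tensor_ideal A B)"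

text \<open>
  For linear maps \<open>f\<close> and \<open>h\<close>, the linear map \<open>f \<otimes> h\<close> with \<open>a \<otimes> b \<mapsto> f a \<otimes> h b\<close>,
  defined on representatives.
\<close>

definition tensor_map ::
    "'a calgebra \<Rightarrow> 'b calgebra \<Rightarrow> ('a \<Rightarrow> 'a) \<Rightarrow> ('b \<Rightarrow> 'b) \<Rightarrow>
     ('a \<times> 'b \<Rightarrow>\<^sub>0 complex) set \<Rightarrow> ('a \<times> 'b \<Rightarrow>\<^sub>0 complex) set" where
  "tensor_map A B f h X =
     (\<Union>u\<in>X. tensor_ideal A B +>\<^bsub>monoid_algebra (A \<times>\<times> B)\<^esub>
        (\<Sum>(a, b)\<in>Poly_Mapping.keys u. Poly_Mapping.single (f a, h b) (Poly_Mapping.lookup u (a, b))))"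

definition invariant_calgebra ::
    "('g, 'x) monoid_scheme \<Rightarrow> ('g \<Rightarrow> 'a \<Rightarrow> 'a) \<Rightarrow> 'a calgebra \<Rightarrow> 'a calgebra" where
  "invariant_calgebra G \<rho> A = A \<lparr>carrier := {a \<in> carrier A. \<forall>g\<in>carrier G. \<rho> g a = a}\<rparr>"

definition klein_four_group :: "('g, 'x) monoid_scheme \<Rightarrow> bool" where
  "klein_four_group G \<longleftrightarrow>
     group G \<and> Coset.order G = 4 \<and> (\<forall>g\<in>carrier G. g \<otimes>\<^bsub>G\<^esub> g = \<one>\<^bsub>G\<^esub>)"

definition mat2_calgebra :: "(complex ^ 2 ^ 2) calgebra" where
  "mat2_calgebra =
     \<lparr> carrier = UNIV, mult = (**), one = mat 1, zero = 0, add = (+),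
       smult = (\<lambda>c m. \<chi> i j. c * m $ i $ j) \<rparr>"

definition conjugation :: "complex ^ 2 ^ 2 \<Rightarrow> complex ^ 2 ^ 2 \<Rightarrow> complex ^ 2 ^ 2" where
  "conjugation P m = P ** m ** matrix_inv P"

end

(*
The degree-one part of A carries the regular representation of G. The one-dimensional representations of A
are the coordinate axes, so every graded automorphism permutes them; an involution that swaps two axes is
excluded by the relations, and hence G acts on the Sklyanin generators by signs, with each of the four
characters of G occurring once.
M_2(C) has a basis of orthogonal matrices m_i that affords the same characters. Therefore the invariants are
spanned by the elements x_w (x) m_w for words w, i.e. the invariant ring is a cocycle twist of A. Writing the
quadratic relations in the generators l_i x_i (x) m_i and choosing the scalars l_i gives Odesskii's relations,
the parameters being those of A or their inverses, depending on which m_i is the identity.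
*)
theory Submission
  imports Defs
begin

section \<open>Monoid algebras\<close>

text \<open>No basis and no Hilbert series of \<open>A\<close> enters. That the kernel of v_i -> l_i
  x_i (x) m_i is exactly the ideal of Odesskii's relations is seen from a left inverse, x_w (x) n ->
  (<m_w, n> / l_w) w. It respects the relations because the four words x_0 x_j, x_j x_0, x_k x_q,
  x_q x_k of one block of Sklyanin relations carry multiples of one and the same matrix. This
  proportionality comes from the signs: an automorphism must preserve the relations, which forces
  equal sign products on the pairs {0, j} and {k, q}, and each character of G has multiplicity one
  in M_2(C). The scalars l_i have to meet one condition per block; solving the three conditions
  costs two square roots. All maps are defined on formal sums (free algebras, free spaces on symbols
  a (x) b), and equations in the quotients are stated as membership in an ideal. Each
  well-definedness proof then becomes a check on relations multiplied by monomials on both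
  sides.\<close>

definition pm_scale :: "complex \<Rightarrow> ('m \<Rightarrow>\<^sub>0 complex) \<Rightarrow> ('m \<Rightarrow>\<^sub>0 complex)" where
  "pm_scale c = Poly_Mapping.map (\<lambda>x. c * x)"

lemma lookup_pm_scale [simp]: "Poly_Mapping.lookup (pm_scale c f) x = c * Poly_Mapping.lookup f x"
  by (simp add: pm_scale_def Poly_Mapping.map.rep_eq when_def)

lemma pm_scale_single [simp]: "pm_scale c (Poly_Mapping.single x d) = Poly_Mapping.single x (c * d)"
  by (rule poly_mapping_eqI) (simp add: lookup_single when_def)

lemma pm_scale_add: "pm_scale c (f + g) = pm_scale c f + pm_scale c g"
  by (rule poly_mapping_eqI) (simp add: lookup_add algebra_simps)

lemma pm_scale_minus: "pm_scale c (f - g) = pm_scale c f - pm_scale c g"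
  by (rule poly_mapping_eqI) (simp add: lookup_minus algebra_simps)

lemma pm_scale_scale [simp]: "pm_scale c (pm_scale d f) = pm_scale (c * d) f"
  by (rule poly_mapping_eqI) simp

lemma pm_scale_1 [simp]: "pm_scale 1 f = f"
  by (rule poly_mapping_eqI) simp

lemma pm_scale_0 [simp]: "pm_scale 0 f = 0"
  by (rule poly_mapping_eqI) simp

lemma pm_scale_zero [simp]: "pm_scale c 0 = 0"
  by (rule poly_mapping_eqI) simp

lemma pm_scale_left_add: "pm_scale (c + d) f = pm_scale c f + pm_scale d f"
  by (rule poly_mapping_eqI) (simp add: lookup_add algebra_simps)

lemma keys_pm_scale: "Poly_Mapping.keys (pm_scale c f) \<subseteq> Poly_Mapping.keys f"
  by (auto simp: in_keys_iff)

lemma pm_scale_sum: "pm_scale c (sum f S) = (\<Sum>x\<in>S. pm_scale c (f x))"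
  by (rule poly_mapping_eqI) (simp add: lookup_sum sum_distrib_left)

definition supported_on :: "'m set \<Rightarrow> ('m \<Rightarrow>\<^sub>0 complex) set" where
  "supported_on S = {f. Poly_Mapping.keys f \<subseteq> S}"

lemma supported_on_UNIV [simp]: "supported_on UNIV = UNIV"
  by (simp add: supported_on_def)

lemma supported_on_zero [simp]: "0 \<in> supported_on S"
  by (simp add: supported_on_def)

lemma supported_on_single [simp]: "x \<in> S \<Longrightarrow> Poly_Mapping.single x c \<in> supported_on S"
  by (auto simp: supported_on_def)

lemma supported_on_add: "f \<in> supported_on S \<Longrightarrow> g \<in> supported_on S \<Longrightarrow> f + g \<in> supported_on S"
  using keys_add[of f g] by (auto simp: supported_on_def)

lemma supported_on_minus: "f \<in> supported_on S \<Longrightarrow> g \<in> supported_on S \<Longrightarrow> f - g \<in> supported_on S"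
  using keys_diff[of f g] by (auto simp: supported_on_def)

lemma supported_on_uminus: "f \<in> supported_on S \<Longrightarrow> - f \<in> supported_on S"
  by (auto simp: supported_on_def)

lemma supported_on_scale: "f \<in> supported_on S \<Longrightarrow> pm_scale c f \<in> supported_on S"
  using keys_pm_scale[of c f] by (auto simp: supported_on_def)

lemma supported_on_sum: "(\<And>x. x \<in> X \<Longrightarrow> f x \<in> supported_on S) \<Longrightarrow> sum f X \<in> supported_on S"
  by (induction X rule: infinite_finite_induct) (auto intro: supported_on_add)

lemma supported_on_induct [consumes 1, case_names zero single add]:
  assumes "f \<in> supported_on S" and "P 0"
    and "\<And>x c. x \<in> S \<Longrightarrow> P (Poly_Mapping.single x c)"
    and add: "\<And>f g. f \<in> supported_on S \<Longrightarrow> g \<in> supported_on S \<Longrightarrow> P f \<Longrightarrow> P g \<Longrightarrow> P (f + g)"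
  shows "P f"
proof -
  have "finite X \<Longrightarrow> X \<subseteq> S \<Longrightarrow> P (\<Sum>x\<in>X. Poly_Mapping.single x (Poly_Mapping.lookup f x))" for X
  proof (induction X rule: finite_induct)
    case (insert x X)
    then show ?case
      by (auto intro!: add assms supported_on_sum)
  qed (simp add: assms)
  moreover have "(\<Sum>x\<in>Poly_Mapping.keys f. Poly_Mapping.single x (Poly_Mapping.lookup f x)) = f"
    by (rule poly_mapping_eqI) (simp add: lookup_sum lookup_single when_def sum.If_cases in_keys_iff Int_def)
  ultimately show ?thesis
    using assms(1) by (metis finite_keys mem_Collect_eq supported_on_def)
qed

section \<open>Linear extension of maps given on a basis\<close>

definition lin_ext :: "('m \<Rightarrow> 'n \<Rightarrow>\<^sub>0 complex) \<Rightarrow> ('m \<Rightarrow>\<^sub>0 complex) \<Rightarrow> ('n \<Rightarrow>\<^sub>0 complex)" where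
  "lin_ext \<phi> f = (\<Sum>x\<in>Poly_Mapping.keys f. pm_scale (Poly_Mapping.lookup f x) (\<phi> x))"

lemma lin_ext_superset:
  assumes "finite X" "Poly_Mapping.keys f \<subseteq> X"
  shows "lin_ext \<phi> f = (\<Sum>x\<in>X. pm_scale (Poly_Mapping.lookup f x) (\<phi> x))"
  unfolding lin_ext_def
  by (rule sum.mono_neutral_left) (use assms in \<open>auto simp: in_keys_iff\<close>)

lemma lin_ext_zero [simp]: "lin_ext \<phi> 0 = 0"
  by (simp add: lin_ext_def)

lemma lin_ext_single [simp]: "lin_ext \<phi> (Poly_Mapping.single x c) = pm_scale c (\<phi> x)"
  by (subst lin_ext_superset[of "{x}"]) auto

lemma lin_ext_add: "lin_ext \<phi> (f + g) = lin_ext \<phi> f + lin_ext \<phi> g"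
proof -
  let ?X = "Poly_Mapping.keys f \<union> Poly_Mapping.keys g"
  have "Poly_Mapping.keys (f + g) \<subseteq> ?X" by (rule keys_add)
  then show ?thesis
    by (simp add: lin_ext_superset[of ?X] lookup_add pm_scale_left_add sum.distrib)
qed

lemma lin_ext_scale: "lin_ext \<phi> (pm_scale c f) = pm_scale c (lin_ext \<phi> f)"
  using keys_pm_scale[of c f]
  by (simp add: lin_ext_superset[of "Poly_Mapping.keys f"] pm_scale_sum)

lemma lin_ext_uminus: "lin_ext \<phi> (- f) = - lin_ext \<phi> f"
  by (metis add_eq_0_iff2 lin_ext_add lin_ext_zero neg_eq_iff_add_eq_0)

lemma lin_ext_minus: "lin_ext \<phi> (f - g) = lin_ext \<phi> f - lin_ext \<phi> g"
  by (metis add_uminus_conv_diff lin_ext_add lin_ext_uminus)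

lemma lin_ext_supported:
  "f \<in> supported_on S \<Longrightarrow> (\<And>x. x \<in> S \<Longrightarrow> \<phi> x \<in> supported_on T) \<Longrightarrow> lin_ext \<phi> f \<in> supported_on T"
  unfolding lin_ext_def by (intro supported_on_sum supported_on_scale) (auto simp: supported_on_def)

lemma additive_zero:
  fixes F :: "'a::ab_group_add \<Rightarrow> 'b::ab_group_add"
  assumes "0 \<in> S" "\<And>f g. f \<in> S \<Longrightarrow> g \<in> S \<Longrightarrow> F (f + g) = F f + F g"
  shows "F 0 = 0"
  using assms(2)[of 0 0] assms(1) by simp

text \<open>Additivity alone suffices, without homogeneity, because the basis case ranges over all
  coefficients \<open>c\<close>.\<close>

lemma additive_eqI:
  fixes F G :: "('m \<Rightarrow>\<^sub>0 complex) \<Rightarrow> 'b::ab_group_add"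
  assumes "f \<in> supported_on S"
    and F: "\<And>f g. f \<in> supported_on S \<Longrightarrow> g \<in> supported_on S \<Longrightarrow> F (f + g) = F f + F g"
    and G: "\<And>f g. f \<in> supported_on S \<Longrightarrow> g \<in> supported_on S \<Longrightarrow> G (f + g) = G f + G g"
    and "\<And>x c. x \<in> S \<Longrightarrow> F (Poly_Mapping.single x c) = G (Poly_Mapping.single x c)"
  shows "F f = G f"
  using assms(1)
proof (induction rule: supported_on_induct)
  case zero
  then show ?case
    using additive_zero[of "supported_on S" F] additive_zero[of "supported_on S" G] F G by simp
qed (simp_all add: assms)

section \<open>The convolution product\<close>

abbreviation conv :: "'m monoid \<Rightarrow> ('m \<Rightarrow>\<^sub>0 complex) \<Rightarrow> ('m \<Rightarrow>\<^sub>0 complex) \<Rightarrow> ('m \<Rightarrow>\<^sub>0 complex)" where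
  "conv M f g \<equiv> f \<otimes>\<^bsub>monoid_algebra M\<^esub> g"

lemma carrier_monoid_algebra [simp]: "carrier (monoid_algebra M) = supported_on (carrier M)"
  and one_monoid_algebra: "\<one>\<^bsub>monoid_algebra M\<^esub> = Poly_Mapping.single \<one>\<^bsub>M\<^esub> 1"
  and zero_monoid_algebra [simp]: "\<zero>\<^bsub>monoid_algebra M\<^esub> = 0"
  and add_monoid_algebra [simp]: "f \<oplus>\<^bsub>monoid_algebra M\<^esub> g = f + g"
  and smult_monoid_algebra [simp]: "c \<odot>\<^bsub>monoid_algebra M\<^esub> f = pm_scale c f"
  by (simp_all add: monoid_algebra_def supported_on_def pm_scale_def)

text \<open>With the product written as an iterated linear extension, its bilinearity is inherited
  from \<open>lin_ext\<close>.\<close>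

lemma conv_eq_lin_ext:
  "conv M f g = lin_ext (\<lambda>x. lin_ext (\<lambda>y. Poly_Mapping.single (x \<otimes>\<^bsub>M\<^esub> y) 1) g) f"
  by (simp add: monoid_algebra_def lin_ext_def pm_scale_sum mult.commute)

lemma lin_ext_plus_fun: "lin_ext (\<lambda>x. \<phi> x + \<psi> x) f = lin_ext \<phi> f + lin_ext \<psi> f"
  by (simp add: lin_ext_def pm_scale_add sum.distrib)

lemma conv_add_left: "conv M (f + f') g = conv M f g + conv M f' g"
  by (simp add: conv_eq_lin_ext lin_ext_add)

lemma conv_add_right: "conv M f (g + g') = conv M f g + conv M f g'"
  by (simp add: conv_eq_lin_ext lin_ext_add lin_ext_plus_fun)

lemma conv_single [simp]:
  "conv M (Poly_Mapping.single x c) (Poly_Mapping.single y d) = Poly_Mapping.single (x \<otimes>\<^bsub>M\<^esub> y) (c * d)"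
  by (simp add: conv_eq_lin_ext)

lemma conv_zero [simp]: "conv M 0 f = 0" "conv M f 0 = 0"
  by (simp_all add: conv_eq_lin_ext lin_ext_def)

lemma conv_scale_left: "conv M (pm_scale c f) g = pm_scale c (conv M f g)"
  by (simp add: conv_eq_lin_ext lin_ext_scale)

lemma conv_scale_right: "conv M f (pm_scale c g) = pm_scale c (conv M f g)"
  by (simp add: conv_eq_lin_ext lin_ext_scale) (simp add: lin_ext_def pm_scale_sum mult.left_commute)

lemma conv_minus_left: "conv M (f - f') g = conv M f g - conv M f' g"
  by (simp add: conv_eq_lin_ext lin_ext_minus)

lemma conv_minus_right: "conv M f (g - g') = conv M f g - conv M f g'"
  by (metis add_diff_cancel conv_add_right diff_add_cancel)

lemma monoid_algebra_ring:
  assumes "Group.monoid M"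
  shows "ring (monoid_algebra M)"
proof -
  interpret M: Group.monoid M by fact
  let ?S = "supported_on (carrier M)"
  have closed: "conv M f g \<in> ?S" if "f \<in> ?S" "g \<in> ?S" for f g
    unfolding conv_eq_lin_ext by (auto intro!: lin_ext_supported[OF that(1)] lin_ext_supported[OF that(2)])
  have assoc: "conv M (conv M f g) h = conv M f (conv M g h)"
    if f: "f \<in> ?S" and g: "g \<in> ?S" and h: "h \<in> ?S" for f g h
  proof (rule additive_eqI[OF f])
    fix x c assume x: "x \<in> carrier M"
    show "conv M (conv M (Poly_Mapping.single x c) g) h = conv M (Poly_Mapping.single x c) (conv M g h)"
    proof (rule additive_eqI[OF g])
      fix y d assume y: "y \<in> carrier M"
      show "conv M (conv M (Poly_Mapping.single x c) (Poly_Mapping.single y d)) h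
          = conv M (Poly_Mapping.single x c) (conv M (Poly_Mapping.single y d) h)"
        by (rule additive_eqI[OF h]) (simp_all add: conv_add_left conv_add_right x y M.m_assoc mult.assoc)
    qed (simp_all add: conv_add_left conv_add_right)
  qed (simp_all add: conv_add_left conv_add_right)
  have one: "conv M (Poly_Mapping.single \<one>\<^bsub>M\<^esub> 1) f = f" "conv M f (Poly_Mapping.single \<one>\<^bsub>M\<^esub> 1) = f" if f: "f \<in> ?S" for f
    by (rule additive_eqI[OF f]; simp add: conv_add_left conv_add_right)+
  show ?thesis
  proof (rule ringI)
    show "abelian_group (monoid_algebra M)"
    proof (rule abelian_groupI)
      fix f assume "f \<in> carrier (monoid_algebra M)"
      then show "\<exists>g\<in>carrier (monoid_algebra M). g \<oplus>\<^bsub>monoid_algebra M\<^esub> f = \<zero>\<^bsub>monoid_algebra M\<^esub>"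
        by (auto intro!: bexI[of _ "- f"] supported_on_uminus)
    qed (auto intro: supported_on_add simp: add_ac)
    show "Group.monoid (monoid_algebra M)"
      by (rule Group.monoidI) (auto simp: one_monoid_algebra intro!: closed one assoc)
  qed (simp_all add: conv_add_left conv_add_right)
qed

lemma a_inv_monoid_algebra:
  assumes "Group.monoid M" "f \<in> supported_on (carrier M)"
  shows "\<ominus>\<^bsub>monoid_algebra M\<^esub> f = - f"
proof -
  interpret ring "monoid_algebra M" using assms by (intro monoid_algebra_ring)
  show ?thesis
    by (rule minus_equality) (use assms in \<open>auto intro: supported_on_uminus\<close>)
qed

lemma minus_monoid_algebra:
  assumes "Group.monoid M" "f \<in> supported_on (carrier M)" "g \<in> supported_on (carrier M)"
  shows "f \<ominus>\<^bsub>monoid_algebra M\<^esub> g = f - g"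
  using assms by (simp add: a_minus_def a_inv_monoid_algebra)

lemma lin_ext_conv:
  assumes "f \<in> supported_on (carrier M)" "g \<in> supported_on (carrier M)"
    and "\<And>x y. x \<in> carrier M \<Longrightarrow> y \<in> carrier M \<Longrightarrow> \<phi> (x \<otimes>\<^bsub>M\<^esub> y) = conv N (\<phi> x) (\<phi> y)"
  shows "lin_ext \<phi> (conv M f g) = conv N (lin_ext \<phi> f) (lin_ext \<phi> g)"
proof (rule additive_eqI[OF assms(1)])
  fix x c assume x: "x \<in> carrier M"
  have r: "conv N (pm_scale a u) (pm_scale b v) = pm_scale (a * b) (conv N u v)" for a b u v
    by (simp add: conv_scale_left conv_scale_right mult.commute)
  show "lin_ext \<phi> (conv M (Poly_Mapping.single x c) g) = conv N (lin_ext \<phi> (Poly_Mapping.single x c)) (lin_ext \<phi> g)"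
    by (rule additive_eqI[OF assms(2)]) (simp_all add: conv_add_right lin_ext_add x assms(3) r)
qed (simp_all add: conv_add_left lin_ext_add)

text \<open>The elements f with L(s f t) in \<open>N\<close> for all s and t form a two-sided ideal,
  so it contains the generated ideal as soon as it contains \<open>rels\<close>; by additivity
  monomials s and t suffice for that. \<open>N\<close> need only be an additive subgroup of the
  target.\<close>

lemma genideal_additive_induct:
  fixes L :: "('m \<Rightarrow>\<^sub>0 complex) \<Rightarrow> 'b::ab_group_add"
  assumes M: "Group.monoid M" and rels: "rels \<subseteq> supported_on (carrier M)"
    and add: "\<And>f g. f \<in> supported_on (carrier M) \<Longrightarrow> g \<in> supported_on (carrier M) \<Longrightarrow> L (f + g) = L f + L g"
    and N: "0 \<in> N" "\<And>a b. a \<in> N \<Longrightarrow> b \<in> N \<Longrightarrow> a + b \<in> N" "\<And>a. a \<in> N \<Longrightarrow> - a \<in> N"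
    and L: "\<And>r s c t d. r \<in> rels \<Longrightarrow> s \<in> carrier M \<Longrightarrow> t \<in> carrier M \<Longrightarrow>
        L (conv M (conv M (Poly_Mapping.single s c) r) (Poly_Mapping.single t d)) \<in> N"
    and f: "f \<in> genideal (monoid_algebra M) rels"
  shows "L f \<in> N"
proof -
  interpret M: Group.monoid M by fact
  interpret R: ring "monoid_algebra M" using M by (rule monoid_algebra_ring)
  let ?S = "supported_on (carrier M)"
  define J where "J = {f \<in> ?S. \<forall>s\<in>?S. \<forall>t\<in>?S. L (conv M (conv M s f) t) \<in> N}"
  have L0: "L 0 = 0" by (rule additive_zero[where S = ?S]) (simp_all add: add)
  have Lneg: "L (- f) = - L f" if "f \<in> ?S" for f
    using add[of f "- f"] that L0 by (simp add: supported_on_uminus eq_neg_iff_add_eq_0 add.commute)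
  have closed: "conv M f g \<in> ?S" if "f \<in> ?S" "g \<in> ?S" for f g
    using R.m_closed[of f g] that by simp
  have "ideal J (monoid_algebra M)"
  proof (rule idealI)
    show "ring (monoid_algebra M)" by unfold_locales
    show "subgroup J (add_monoid (monoid_algebra M))"
    proof (rule R.add.subgroupI)
      show "J \<subseteq> carrier (monoid_algebra M)" by (auto simp: J_def)
      show "J \<noteq> {}" using N L0 by (auto simp: J_def intro!: exI[of _ 0])
      fix a assume a: "a \<in> J"
      then have aS: "a \<in> ?S" by (simp add: J_def)
      have neg: "conv M (conv M s (- a)) t = - conv M (conv M s a) t" for s t
        using conv_minus_left[of M 0 _ t] conv_minus_right[of M s 0 a] by simp
      have "- a \<in> J"
        using a N Lneg by (auto simp: J_def neg closed intro: supported_on_uminus)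
      then show "\<ominus>\<^bsub>monoid_algebra M\<^esub> a \<in> J"
        using a_inv_monoid_algebra[OF M aS] by simp
    next
      fix a b assume "a \<in> J" "b \<in> J"
      then show "a \<oplus>\<^bsub>monoid_algebra M\<^esub> b \<in> J"
        using N by (auto simp: J_def conv_add_right conv_add_left closed add intro: supported_on_add)
    qed
  next
    fix a x assume a: "a \<in> J" and x: "x \<in> carrier (monoid_algebra M)"
    have aS: "a \<in> ?S" using a by (simp add: J_def)
    show "x \<otimes>\<^bsub>monoid_algebra M\<^esub> a \<in> J"
      unfolding J_def
    proof (intro CollectI conjI ballI)
      show "conv M x a \<in> ?S" using aS x by (simp add: closed)
      fix s t assume "s \<in> ?S" "t \<in> ?S"
      then show "L (conv M (conv M s (conv M x a)) t) \<in> N"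
        using a x aS R.m_assoc[of s x a, symmetric] closed[of s x] by (simp add: J_def)
    qed
    show "a \<otimes>\<^bsub>monoid_algebra M\<^esub> x \<in> J"
      unfolding J_def
    proof (intro CollectI conjI ballI)
      show "conv M a x \<in> ?S" using aS x by (simp add: closed)
      fix s t assume st: "s \<in> ?S" "t \<in> ?S"
      have "conv M (conv M s (conv M a x)) t = conv M (conv M s a) (conv M x t)"
        using R.m_assoc[of s a x] R.m_assoc[of "conv M s a" x t] aS x st closed by simp
      then show "L (conv M (conv M s (conv M a x)) t) \<in> N"
        using a x st closed[of x t] by (simp add: J_def)
    qed
  qed
  moreover have "rels \<subseteq> J"
  proof
    fix r assume r: "r \<in> rels"
    then have rS: "r \<in> ?S" using rels by auto
    have "L (conv M (conv M s r) t) \<in> N" if s: "s \<in> ?S" and t: "t \<in> ?S" for s t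
      using s
    proof (induction rule: supported_on_induct)
      case (single x c)
      show ?case
        using t
      proof (induction rule: supported_on_induct)
        case (single y d)
        then show ?case using L r \<open>x \<in> carrier M\<close> by blast
      qed (use N L0 \<open>x \<in> carrier M\<close> rS in \<open>simp_all add: conv_add_right add closed\<close>)
    qed (use N L0 t rS in \<open>simp_all add: conv_add_left add closed\<close>)
    then show "r \<in> J" using rS by (simp add: J_def)
  qed
  ultimately have "genideal (monoid_algebra M) rels \<subseteq> J"
    by (rule R.genideal_minimal)
  then have fJ: "f \<in> J" using f by blast
  then have "f \<in> ?S" by (simp add: J_def)
  \<comment> \<open>Taking s = t = 1 in the definition of \<open>J\<close> recovers
    \<open>L f\<close> itself.\<close>
  then have "conv M (conv M (Poly_Mapping.single \<one>\<^bsub>M\<^esub> 1) f) (Poly_Mapping.single \<one>\<^bsub>M\<^esub> 1) = f"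
    using R.l_one[of f] R.r_one[of f] by (simp add: one_monoid_algebra)
  then show ?thesis
    using fJ by (metis (no_types, lifting) J_def M.one_closed mem_Collect_eq supported_on_single)
qed

section \<open>Quotients and presented algebras\<close>

lemma ring_extend:
  assumes "ring X"
  shows "ring (ring.extend X f)"
proof -
  have "carrier (ring.extend X f) = carrier X" "mult (ring.extend X f) = mult X"
    "add (ring.extend X f) = add X" "one (ring.extend X f) = one X" "zero (ring.extend X f) = zero X"
    by (simp_all add: ring.defs)
  note eqs = this
  interpret X: ring X by fact
  have "\<exists>y\<in>carrier X. y \<oplus>\<^bsub>X\<^esub> x = \<zero>\<^bsub>X\<^esub>" if "x \<in> carrier X" for x
    using that X.l_neg X.a_inv_closed by blast
  then show ?thesis
    by (intro ringI abelian_groupI Group.monoidI; unfold eqs)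
      (simp_all add: X.m_assoc X.a_ac X.l_distr X.r_distr)
qed

text \<open>Instantiated twice: words modulo relations give the presented algebras, and the product
  of two multiplicative monoids modulo bilinearity gives the tensor product.\<close>

locale monoid_algebra_quotient =
  fixes M :: "'m monoid" and I :: "('m \<Rightarrow>\<^sub>0 complex) set"
  assumes monoid: "Group.monoid M" and ideal: "ideal I (monoid_algebra M)"
begin

sublocale R: ring "monoid_algebra M" using monoid by (rule monoid_algebra_ring)
sublocale I: ideal I "monoid_algebra M" by (rule ideal)

abbreviation S where "S \<equiv> supported_on (carrier M)"
abbreviation Q where "Q \<equiv> quotient_calgebra (monoid_algebra M) I"
abbreviation cls where "cls f \<equiv> I +>\<^bsub>monoid_algebra M\<^esub> f"

lemma I_subset: "f \<in> I \<Longrightarrow> f \<in> S"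
  using I.a_Hcarr by simp

lemma I_zero: "0 \<in> I"
  using I.zero_closed by simp

lemma I_add: "f \<in> I \<Longrightarrow> g \<in> I \<Longrightarrow> f + g \<in> I"
  using I.a_closed[of f g] by simp

lemma I_uminus: "f \<in> I \<Longrightarrow> - f \<in> I"
  using I.a_inv_closed[of f] a_inv_monoid_algebra[OF monoid, of f] I_subset[of f] by simp

lemma I_minus: "f \<in> I \<Longrightarrow> g \<in> I \<Longrightarrow> f - g \<in> I"
  using I_add[of f "- g"] I_uminus[of g] by simp

lemma I_conv_left: "f \<in> S \<Longrightarrow> g \<in> I \<Longrightarrow> conv M f g \<in> I"
  using I.I_l_closed[of g f] by simp

lemma I_conv_right: "f \<in> S \<Longrightarrow> g \<in> I \<Longrightarrow> conv M g f \<in> I"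
  using I.I_r_closed[of g f] by simp

text \<open>A ring ideal is not assumed to be a subspace; it is one because scaling by
  \<open>c\<close> is multiplication by the element \<open>c\<close> times the unit.\<close>

lemma I_scale: "f \<in> I \<Longrightarrow> pm_scale c f \<in> I"
proof -
  assume f: "f \<in> I"
  then have "pm_scale c f = conv M (pm_scale c \<one>\<^bsub>monoid_algebra M\<^esub>) f"
    using R.l_one[of f] I_subset by (simp add: conv_scale_left)
  then show ?thesis
    using f R.one_closed by (simp add: I_conv_left supported_on_scale)
qed

lemma I_sum: "(\<And>x. x \<in> X \<Longrightarrow> f x \<in> I) \<Longrightarrow> sum f X \<in> I"
  by (induction X rule: infinite_finite_induct) (auto intro: I_add I_zero)

lemma cls_eq_iff: "f \<in> S \<Longrightarrow> g \<in> S \<Longrightarrow> cls f = cls g \<longleftrightarrow> f - g \<in> I"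
  using R.quotient_eq_iff_same_a_r_cos[OF ideal, of f g] by (simp add: minus_monoid_algebra[OF monoid])

lemma carrier_Q: "carrier Q = cls ` S"
  by (auto simp: quotient_calgebra_def ring.defs FactRing_def A_RCOSETS_def')

lemma cls_closed: "f \<in> S \<Longrightarrow> cls f \<in> carrier Q"
  by (auto simp: carrier_Q)

lemma mult_Q: "f \<in> S \<Longrightarrow> g \<in> S \<Longrightarrow> cls f \<otimes>\<^bsub>Q\<^esub> cls g = cls (conv M f g)"
  using I.rcoset_mult_add[of f g] by (simp add: quotient_calgebra_def ring.defs FactRing_def)

lemma add_Q: "f \<in> S \<Longrightarrow> g \<in> S \<Longrightarrow> cls f \<oplus>\<^bsub>Q\<^esub> cls g = cls (f + g)"
  using I.a_rcos_sum[of f g] by (simp add: quotient_calgebra_def ring.defs FactRing_def)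

lemma one_Q: "\<one>\<^bsub>Q\<^esub> = cls (Poly_Mapping.single \<one>\<^bsub>M\<^esub> 1)"
  by (simp add: quotient_calgebra_def ring.defs FactRing_def one_monoid_algebra)

lemma zero_Q: "\<zero>\<^bsub>Q\<^esub> = I"
  by (simp add: quotient_calgebra_def ring.defs FactRing_def)

lemma cls_zero: "cls 0 = I"
  using I.a_rcos_const[of 0] I_zero by simp

lemma cls_eq_I_iff: "f \<in> S \<Longrightarrow> cls f = I \<longleftrightarrow> f \<in> I"
  using cls_eq_iff[of f 0] by (simp add: cls_zero)

lemma mem_clsE: "f \<in> S \<Longrightarrow> g \<in> cls f \<Longrightarrow> g \<in> S \<and> g - f \<in> I"
  by (auto simp: a_r_coset_def' intro: supported_on_add I_subset)

lemma self_in_cls: "f \<in> S \<Longrightarrow> f \<in> cls f"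
  using I_zero by (force simp: a_r_coset_def')

text \<open>Scalar multiplication on cosets and \<open>tensor_map\<close> are defined as unions over
  representatives; such a union collapses to one coset when the choice of representative does not
  matter.\<close>

lemma UN_cls:
  assumes "f \<in> S" and "\<And>g. g \<in> S \<Longrightarrow> g - f \<in> I \<Longrightarrow> F g = F f"
  shows "(\<Union>g\<in>cls f. F g) = F f"
  using assms self_in_cls mem_clsE by blast

lemma smult_Q: "f \<in> S \<Longrightarrow> c \<odot>\<^bsub>Q\<^esub> cls f = cls (pm_scale c f)"
  by (simp add: quotient_calgebra_def ring.defs module.defs)
    (rule UN_cls, simp, simp add: cls_eq_iff supported_on_scale I_scale flip: pm_scale_minus)

lemma ring_Q: "ring Q"
  unfolding quotient_calgebra_def by (rule ring_extend) (rule I.quotient_is_ring)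

end

section \<open>Free algebras on words and presented algebras\<close>

abbreviation word_monoid :: "'i list monoid" where
  "word_monoid \<equiv> \<lparr>carrier = UNIV, mult = (@), one = []\<rparr>"

lemma word_monoid: "Group.monoid word_monoid"
  by (rule Group.monoidI) auto

lemma presented_quotient: "monoid_algebra_quotient word_monoid (relation_ideal rels)"
proof (rule monoid_algebra_quotient.intro[OF word_monoid])
  interpret ring "monoid_algebra (word_monoid :: 'i list monoid)"
    by (rule monoid_algebra_ring[OF word_monoid])
  show "ideal (relation_ideal rels) (monoid_algebra word_monoid)"
    unfolding relation_ideal_def free_calgebra_def by (rule genideal_ideal) simp
qed

lemma relations_in_ideal: "r \<in> rels \<Longrightarrow> r \<in> relation_ideal rels"
  by (auto simp: relation_ideal_def genideal_def)

definition pcls :: "('i list \<Rightarrow>\<^sub>0 complex) set \<Rightarrow> ('i list \<Rightarrow>\<^sub>0 complex) \<Rightarrow> 'i presented" where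
  "pcls rels f = relation_ideal rels +>\<^bsub>free_calgebra\<^esub> f"

abbreviation fmult (infixl "\<star>" 70) where "f \<star> g \<equiv> conv word_monoid f g"

context
  fixes rels :: "('i list \<Rightarrow>\<^sub>0 complex) set"
begin

interpretation P: monoid_algebra_quotient word_monoid "relation_ideal rels"
  by (rule presented_quotient)

lemma presented_eq: "presented_calgebra rels = P.Q"
  by (simp add: presented_calgebra_def free_calgebra_def)

lemma pcls_eq: "pcls rels f = P.cls f"
  by (simp add: pcls_def free_calgebra_def)

lemma carrier_presented: "carrier (presented_calgebra rels) = range (pcls rels)"
  using P.carrier_Q by (simp add: presented_eq pcls_eq[abs_def])

lemma pcls_closed [simp]: "pcls rels f \<in> carrier (presented_calgebra rels)"
  by (simp add: carrier_presented)

lemma pcls_eq_iff: "pcls rels f = pcls rels g \<longleftrightarrow> f - g \<in> relation_ideal rels"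
  by (simp add: pcls_eq P.cls_eq_iff)

lemma mult_presented [simp]: "pcls rels f \<otimes>\<^bsub>presented_calgebra rels\<^esub> pcls rels g = pcls rels (f \<star> g)"
  by (simp add: pcls_eq presented_eq P.mult_Q)

lemma add_presented [simp]: "pcls rels f \<oplus>\<^bsub>presented_calgebra rels\<^esub> pcls rels g = pcls rels (f + g)"
  by (simp add: pcls_eq presented_eq P.add_Q)

lemma smult_presented [simp]: "c \<odot>\<^bsub>presented_calgebra rels\<^esub> pcls rels f = pcls rels (pm_scale c f)"
  by (simp add: pcls_eq presented_eq P.smult_Q)

lemma one_presented: "\<one>\<^bsub>presented_calgebra rels\<^esub> = pcls rels (Poly_Mapping.single [] 1)"
  by (simp add: pcls_eq presented_eq P.one_Q)

lemma zero_presented: "\<zero>\<^bsub>presented_calgebra rels\<^esub> = pcls rels 0"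
  by (simp add: pcls_eq presented_eq P.zero_Q P.cls_zero)

lemma ring_presented: "ring (presented_calgebra rels)"
  unfolding presented_eq by (rule P.ring_Q)

lemmas relation_ideal_closed =
  P.I_zero P.I_add P.I_uminus P.I_minus P.I_scale P.I_sum

lemma relation_ideal_conv:
  "f \<in> relation_ideal rels \<Longrightarrow> g \<star> f \<in> relation_ideal rels"
  "f \<in> relation_ideal rels \<Longrightarrow> f \<star> g \<in> relation_ideal rels"
  using P.I_conv_left[of g f] P.I_conv_right[of g f] by simp_all

lemma cls_presentedE:
  assumes "a \<in> carrier (presented_calgebra rels)"
  obtains f where "a = pcls rels f"
  using assms by (auto simp: carrier_presented)

end

lemma presented_degree_eq:
  "presented_degree rels n = pcls rels ` {f. \<forall>w\<in>Poly_Mapping.keys f. length w = n}"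
  by (auto simp: presented_degree_def pcls_def)

lemma relation_ideal_additive_induct:
  fixes L :: "('i list \<Rightarrow>\<^sub>0 complex) \<Rightarrow> 'b::ab_group_add"
  assumes "f \<in> relation_ideal rels" and "\<And>f g. L (f + g) = L f + L g"
    and "0 \<in> N" "\<And>a b. a \<in> N \<Longrightarrow> b \<in> N \<Longrightarrow> a + b \<in> N" "\<And>a. a \<in> N \<Longrightarrow> - a \<in> N"
    and "\<And>r s c t d. r \<in> rels \<Longrightarrow> L (Poly_Mapping.single s c \<star> r \<star> Poly_Mapping.single t d) \<in> N"
  shows "L f \<in> N"
proof (rule genideal_additive_induct[where M = word_monoid and rels = rels and N = N and L = L])
  show "f \<in> genideal (monoid_algebra word_monoid) rels"
    using assms(1) by (simp add: relation_ideal_def free_calgebra_def)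
qed (simp_all only: word_monoid assms partial_object.simps supported_on_UNIV subset_UNIV)

section \<open>Tensor products with the matrix algebra\<close>

type_synonym mat2 = "complex ^ 2 ^ 2"

definition mat_scale :: "complex \<Rightarrow> mat2 \<Rightarrow> mat2" where
  "mat_scale c m = (\<chi> i j. c * m $ i $ j)"

lemma mat_scale_nth [simp]: "mat_scale c m $ i $ j = c * m $ i $ j"
  by (simp add: mat_scale_def)

lemma mat2_eq_iff: "m = n \<longleftrightarrow> m $ 1 $ 1 = n $ 1 $ 1 \<and> m $ 1 $ 2 = n $ 1 $ 2 \<and>
    m $ 2 $ 1 = n $ 2 $ 1 \<and> m $ 2 $ 2 = (n :: mat2) $ 2 $ 2"
  by (auto simp: vec_eq_iff forall_2)

lemma mat2_mult_nth: "(m ** n) $ i $ j = m $ i $ 1 * n $ 1 $ j + m $ i $ 2 * (n :: mat2) $ 2 $ j"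
  by (simp add: matrix_matrix_mult_def sum_2)

lemma mat_scale_mult: "mat_scale c m ** n = mat_scale c (m ** n)" "m ** mat_scale c n = mat_scale c (m ** n)"
  by (simp_all add: mat2_eq_iff mat2_mult_nth algebra_simps)

lemma mat_scale_mat_scale [simp]: "mat_scale c (mat_scale d m) = mat_scale (c * d) m"
  by (simp add: mat2_eq_iff)

lemma mat_scale_1 [simp]: "mat_scale 1 m = m"
  by (simp add: mat2_eq_iff)

lemma mat2_calgebra_simps [simp]:
  "carrier mat2_calgebra = UNIV" "m \<otimes>\<^bsub>mat2_calgebra\<^esub> n = m ** n" "\<one>\<^bsub>mat2_calgebra\<^esub> = mat 1"
  "m \<oplus>\<^bsub>mat2_calgebra\<^esub> n = m + n" "c \<odot>\<^bsub>mat2_calgebra\<^esub> m = mat_scale c m"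
  by (simp_all add: mat2_calgebra_def mat_scale_def)

lemma mat2_add_mult: "(m + n) ** k = m ** k + n ** (k :: mat2)" "k ** (m + n) = k ** m + k ** n"
  by (simp_all add: mat2_eq_iff mat2_mult_nth algebra_simps)

lemma mat2_monoid: "Group.monoid mat2_calgebra"
  by (rule Group.monoidI) (auto simp: matrix_mul_assoc)

lemma DirProd_simps:
  "carrier (G \<times>\<times> H) = carrier G \<times> carrier H"
  "(a, m) \<otimes>\<^bsub>G \<times>\<times> H\<^esub> (b, n) = (a \<otimes>\<^bsub>G\<^esub> b, m \<otimes>\<^bsub>H\<^esub> n)"
  "\<one>\<^bsub>G \<times>\<times> H\<^esub> = (\<one>\<^bsub>G\<^esub>, \<one>\<^bsub>H\<^esub>)"
  by (simp_all add: DirProd_def)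

text \<open>Keeps the carrier of the product folded, so that facts about elements supported on it
  still match; \<open>DirProd_simps\<close> unfolds it on demand.\<close>

declare carrier_DirProd [simp del]

context
  fixes rels :: "('i list \<Rightarrow>\<^sub>0 complex) set"
begin

abbreviation (input) "tA \<equiv> presented_calgebra rels"
abbreviation (input) "tM \<equiv> tA \<times>\<times> mat2_calgebra"
abbreviation (input) "tS \<equiv> supported_on (carrier tM)"
abbreviation (input) "tI \<equiv> tensor_ideal tA mat2_calgebra"

lemma tensor_monoid: "Group.monoid tM"
  using DirProd_monoid[OF _ mat2_monoid] ring.is_monoid[OF ring_presented] by blast

text \<open>A formal symbol, before bilinearity is imposed. It depends on \<open>f\<close> only
  through its class, so relations of the algebra hold here as equations and not merely modulo the
  tensor ideal.\<close>

definition ten :: "('i list \<Rightarrow>\<^sub>0 complex) \<Rightarrow> mat2 \<Rightarrow> complex \<Rightarrow> ('i presented \<times> mat2 \<Rightarrow>\<^sub>0 complex)" where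
  "ten f m c = Poly_Mapping.single (pcls rels f, m) c"

lemma ten_supported [simp]: "ten f m c \<in> tS"
  by (simp add: ten_def DirProd_simps)

lemma tensor_relation_cases:
  assumes "r \<in> tensor_relations tA mat2_calgebra"
  obtains f g m where "r = ten (f + g) m 1 - ten f m 1 - ten g m 1"
  | f m n where "r = ten f (m + n) 1 - ten f m 1 - ten f n 1"
  | c f m where "r = ten (pm_scale c f) m 1 - ten f m c"
  | c f m where "r = ten f (mat_scale c m) 1 - ten f m c"
  using assms
  by (auto simp: tensor_relations_def Let_def ten_def carrier_presented)

lemma tensor_relations_supported: "tensor_relations tA mat2_calgebra \<subseteq> tS"
proof
  fix r assume "r \<in> tensor_relations tA mat2_calgebra"
  then show "r \<in> tS"
    by (cases r rule: tensor_relation_cases)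
      (simp_all only: supported_on_minus ten_supported)
qed

lemma tensor_quotient: "monoid_algebra_quotient tM tI"
proof (rule monoid_algebra_quotient.intro[OF tensor_monoid])
  interpret ring "monoid_algebra tM" by (rule monoid_algebra_ring[OF tensor_monoid])
  show "ideal tI (monoid_algebra tM)"
    unfolding tensor_ideal_def using tensor_relations_supported by (intro genideal_ideal) simp
qed

interpretation T: monoid_algebra_quotient tM tI
  by (rule tensor_quotient)

lemma tensor_relations_in_ideal: "r \<in> tensor_relations tA mat2_calgebra \<Longrightarrow> r \<in> tI"
  by (auto simp: tensor_ideal_def genideal_def)

lemma ten_relations:
  "ten (f + g) m 1 - ten f m 1 - ten g m 1 \<in> tI"
  "ten f (m + n) 1 - ten f m 1 - ten f n 1 \<in> tI"
  "ten (pm_scale c f) m 1 - ten f m c \<in> tI"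
  "ten f (mat_scale c m) 1 - ten f m c \<in> tI"
proof -
  note [simp] = tensor_relations_def Let_def ten_def
  show "ten (f + g) m 1 - ten f m 1 - ten g m 1 \<in> tI"
    by (rule tensor_relations_in_ideal, simp, rule disjI1, rule exI[of _ "pcls rels f"], rule exI[of _ "pcls rels g"])
      auto
  show "ten f (m + n) 1 - ten f m 1 - ten f n 1 \<in> tI"
    by (rule tensor_relations_in_ideal, simp, rule disjI2, rule disjI1, rule exI[of _ "pcls rels f"]) auto
  show "ten (pm_scale c f) m 1 - ten f m c \<in> tI"
    by (rule tensor_relations_in_ideal, simp, rule disjI2, rule disjI2, rule disjI1, rule exI[of _ c],
        rule exI[of _ "pcls rels f"]) auto
  show "ten f (mat_scale c m) 1 - ten f m c \<in> tI"
    by (rule tensor_relations_in_ideal, simp, rule disjI2, rule disjI2, rule disjI2, rule exI[of _ c],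
        rule exI[of _ "pcls rels f"]) auto
qed

lemma ten_scale: "pm_scale d (ten f m c) = ten f m (d * c)"
  by (simp add: ten_def)

lemma ten_add_left: "ten (f + g) m c - ten f m c - ten g m c \<in> tI"
  using T.I_scale[OF ten_relations(1)[of f g m], of c] by (simp add: pm_scale_minus ten_scale)

lemma ten_add_right: "ten f (m + n) c - ten f m c - ten f n c \<in> tI"
  using T.I_scale[OF ten_relations(2)[of f m n], of c] by (simp add: pm_scale_minus ten_scale)

lemma ten_scale_left: "ten (pm_scale d f) m c - ten f m (d * c) \<in> tI"
  using T.I_scale[OF ten_relations(3)[of d f m], of c] by (simp add: pm_scale_minus ten_scale mult.commute)

lemma ten_scale_right: "ten f (mat_scale d m) c - ten f m (d * c) \<in> tI"
  using T.I_scale[OF ten_relations(4)[of f d m], of c] by (simp add: pm_scale_minus ten_scale mult.commute)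

lemma tensor_ideal_trans: "u - v \<in> tI \<Longrightarrow> v - w \<in> tI \<Longrightarrow> u - w \<in> tI"
  using T.I_add[of "u - v" "v - w"] by simp

lemma tensor_ideal_sym: "u - v \<in> tI \<Longrightarrow> v - u \<in> tI"
  using T.I_uminus[of "u - v"] by simp

text \<open>Additivity and homogeneity in the first factor reduce every formal tensor to tensors of
  words, on which all later maps are computed.\<close>

lemma ten_expand: "ten f m c - lin_ext (\<lambda>w. ten (Poly_Mapping.single w 1) m c) f \<in> tI"
proof (induction f rule: supported_on_induct[of _ UNIV, simplified, case_names zero single add])
  case zero
  then show ?case
    using ten_scale_left[of 0 0 m c] by (simp add: ten_def)
next
  case (single w d)
  then show ?case
    using ten_scale_left[of d "Poly_Mapping.single w 1" m c] by (simp add: ten_scale)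
next
  case (add f g)
  then show ?case
    using T.I_add[OF T.I_add[OF add] ten_add_left[of f g m c]] by (simp add: lin_ext_add algebra_simps)
qed

text \<open>Such an \<open>f\<close> has the class of 0, so the symbol equals that of 0, and the
  expansion of 0 into words is empty.\<close>

lemma ten_zero: "f \<in> relation_ideal rels \<Longrightarrow> ten f m c \<in> tI"
  using ten_expand[of 0 m c] pcls_eq_iff[of rels f 0] by (simp add: ten_def)

text \<open>Bilinearity is only required modulo \<open>N\<close>, since \<open>\<beta>\<close> may be defined by choosing representatives.\<close>

lemma tensor_ideal_lin_ext:
  assumes N: "0 \<in> N" "\<And>a b. a \<in> N \<Longrightarrow> b \<in> N \<Longrightarrow> a + b \<in> N" "\<And>a c. a \<in> N \<Longrightarrow> pm_scale c a \<in> N"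
    and add_left: "\<And>f g m. \<beta> (pcls rels (f + g), m) - \<beta> (pcls rels f, m) - \<beta> (pcls rels g, m) \<in> N"
    and add_right: "\<And>f m n. \<beta> (pcls rels f, m + n) - \<beta> (pcls rels f, m) - \<beta> (pcls rels f, n) \<in> N"
    and scale_left: "\<And>f c m. \<beta> (pcls rels (pm_scale c f), m) - pm_scale c (\<beta> (pcls rels f, m)) \<in> N"
    and scale_right: "\<And>f c m. \<beta> (pcls rels f, mat_scale c m) - pm_scale c (\<beta> (pcls rels f, m)) \<in> N"
    and u: "u \<in> tI"
  shows "lin_ext \<beta> u \<in> N"
proof (rule genideal_additive_induct[where L = "lin_ext \<beta>", OF tensor_monoid tensor_relations_supported])
  fix r s c t d
  assume r: "r \<in> tensor_relations tA mat2_calgebra" and s: "s \<in> carrier tM" and t: "t \<in> carrier tM"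
  obtain p n q k where st: "s = (pcls rels p, n)" "t = (pcls rels q, k)"
    using s t by (auto simp: DirProd_simps carrier_presented)
  \<comment> \<open>Multiplying symbols by a symbol on either side is bilinear in both entries, so a
    bilinearity relation placed between two monomials is again a multiple of a bilinearity
    relation.\<close>
  have ten_mult: "conv tM (conv tM (Poly_Mapping.single s c) (ten f m e)) (Poly_Mapping.single t d)
      = ten (p \<star> f \<star> q) (n ** m ** k) (c * d * e)" for f m e
    by (simp add: ten_def st DirProd_simps mult_ac)
  have lin_ten: "lin_ext \<beta> (ten f m e) = pm_scale e (\<beta> (pcls rels f, m))" for f m e
    by (simp add: ten_def)
  have mem: "pm_scale (c * d) x \<in> N \<Longrightarrow> pm_scale (c * d) x = y \<Longrightarrow> y \<in> N" for x y
    by simp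
  show "lin_ext \<beta> (conv tM (conv tM (Poly_Mapping.single s c) r) (Poly_Mapping.single t d)) \<in> N"
    using r
  proof (cases r rule: tensor_relation_cases)
    case (1 f g m)
    show ?thesis
      by (rule mem[OF N(3)[OF add_left[of "p \<star> f \<star> q" "p \<star> g \<star> q" "n ** m ** k"]]])
        (simp add: 1 conv_minus_left conv_minus_right ten_mult lin_ext_minus lin_ten pm_scale_minus
          conv_add_left conv_add_right)
  next
    case (2 f m m')
    show ?thesis
      by (rule mem[OF N(3)[OF add_right[of "p \<star> f \<star> q" "n ** m ** k" "n ** m' ** k"]]])
        (simp add: 2 conv_minus_left conv_minus_right ten_mult lin_ext_minus lin_ten pm_scale_minus
          mat2_add_mult)
  next
    case (3 e f m)
    show ?thesis
      by (rule mem[OF N(3)[OF scale_left[of e "p \<star> f \<star> q" "n ** m ** k"]]])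
        (simp add: 3 conv_minus_left conv_minus_right ten_mult lin_ext_minus lin_ten pm_scale_minus
          conv_scale_left conv_scale_right)
  next
    case (4 e f m)
    show ?thesis
      by (rule mem[OF N(3)[OF scale_right[of "p \<star> f \<star> q" e "n ** m ** k"]]])
        (simp add: 4 conv_minus_left conv_minus_right ten_mult lin_ext_minus lin_ten pm_scale_minus
          mat_scale_mult)
  qed
next
  show "u \<in> genideal (monoid_algebra tM) (tensor_relations tA mat2_calgebra)"
    using u by (simp add: tensor_ideal_def)
next
  fix a assume "a \<in> N"
  then have "pm_scale (-1) a \<in> N" by (rule N)
  moreover have "pm_scale (-1) a = - a" by (rule poly_mapping_eqI) simp
  ultimately show "- a \<in> N" by simp
qed (simp_all add: lin_ext_add N)

lemma tensor_calgebra_eq: "tensor_calgebra tA mat2_calgebra = T.Q"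
  by (simp add: tensor_calgebra_def)

text \<open>Linear \<open>F\<close> and \<open>h\<close> send bilinearity relations to bilinearity
  relations, so their linear extension to symbols preserves the tensor ideal and the union in
  \<open>tensor_map\<close> is a single coset.\<close>

lemma tensor_map_cls:
  assumes u: "u \<in> tS"
    and f: "\<And>a. a \<in> carrier tA \<Longrightarrow> F a \<in> carrier tA"
      "\<And>a b. a \<in> carrier tA \<Longrightarrow> b \<in> carrier tA \<Longrightarrow> F (a \<oplus>\<^bsub>tA\<^esub> b) = F a \<oplus>\<^bsub>tA\<^esub> F b"
      "\<And>a c. a \<in> carrier tA \<Longrightarrow> F (c \<odot>\<^bsub>tA\<^esub> a) = c \<odot>\<^bsub>tA\<^esub> F a"
    and h: "\<And>m n. h (m + n) = h m + h n" "\<And>m c. h (mat_scale c m) = mat_scale c (h m)"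
  defines "\<phi> \<equiv> lin_ext (\<lambda>x. Poly_Mapping.single (F (fst x), h (snd x)) 1)"
  shows "tensor_map tA mat2_calgebra F h (T.cls u) = T.cls (\<phi> u)"
    and "\<phi> u \<in> tS"
    and "\<And>v. v \<in> tI \<Longrightarrow> \<phi> v \<in> tI"
proof -
  have supp: "\<phi> v \<in> tS" if "v \<in> tS" for v
    unfolding \<phi>_def by (rule lin_ext_supported[OF that]) (auto simp: DirProd_simps f)
  then show "\<phi> u \<in> tS" using u by blast
  have "\<exists>f'. F (pcls rels f) = pcls rels f'" for f
    using f(1)[OF pcls_closed[of rels f]] by (rule cls_presentedE) blast
  \<comment> \<open>The chosen representatives \<open>F'\<close> need not depend additively on
    \<open>f\<close>; they do so modulo the relations, and \<open>ten\<close> sees only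
    classes.\<close>
  then obtain F' where F': "F (pcls rels f) = pcls rels (F' f)" for f
    by metis
  have add: "F (pcls rels (f + g)) = pcls rels (F' f + F' g)" for f g
    using f(2)[of "pcls rels f" "pcls rels g"] by (simp add: F')
  have scale: "F (pcls rels (pm_scale c f)) = pcls rels (pm_scale c (F' f))" for f c
    using f(3)[of "pcls rels f" c] by (simp add: F')
  have \<phi>_ten: "Poly_Mapping.single (F (fst (pcls rels f, m)), h (snd (pcls rels f, m))) 1 = ten (F' f) (h m) 1"
    for f m by (simp add: F' ten_def)
  have "pcls rels (F' (f + g)) = pcls rels (F' f + F' g)"
    "pcls rels (F' (pm_scale c f)) = pcls rels (pm_scale c (F' f))" for f g c
    using add[of f g] scale[of c f] by (simp_all add: F')
  then have ten_F': "ten (F' (f + g)) m c = ten (F' f + F' g) m c"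
    "ten (F' (pm_scale d f)) m c = ten (pm_scale d (F' f)) m c" for f g m c d
    by (simp_all add: ten_def)
  show ideal: "\<phi> v \<in> tI" if "v \<in> tI" for v
    unfolding \<phi>_def
  proof (rule tensor_ideal_lin_ext[where N = tI], goal_cases)
    case 4 show ?case unfolding \<phi>_ten ten_F' by (rule ten_add_left)
  next
    case 5 show ?case unfolding \<phi>_ten h by (rule ten_add_right)
  next
    case (6 f c m) show ?case
      using ten_scale_left[of c "F' f" "h m" 1] unfolding \<phi>_ten ten_F' by (simp add: ten_scale)
  next
    case (7 f c m) show ?case
      using ten_scale_right[of "F' f" c "h m" 1] unfolding \<phi>_ten h by (simp add: ten_scale)
  qed (use that T.I_zero T.I_add T.I_scale in auto)
  have "(\<Sum>(a, b)\<in>Poly_Mapping.keys v. Poly_Mapping.single (F a, h b) (Poly_Mapping.lookup v (a, b))) = \<phi> v" for v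
    by (simp add: \<phi>_def lin_ext_def case_prod_beta)
  then have "tensor_map tA mat2_calgebra F h (T.cls u) = (\<Union>v\<in>T.cls u. T.cls (\<phi> v))"
    by (simp add: tensor_map_def)
  also have "\<dots> = T.cls (\<phi> u)"
  proof (rule T.UN_cls[OF u])
    fix v assume v: "v \<in> T.S" "v - u \<in> tI"
    then have "\<phi> v - \<phi> u \<in> tI"
      using ideal[of "v - u"] by (simp add: \<phi>_def lin_ext_minus)
    then show "T.cls (\<phi> v) = T.cls (\<phi> u)"
      using v u supp T.cls_eq_iff by blast
  qed
  finally show "tensor_map tA mat2_calgebra F h (T.cls u) = T.cls (\<phi> u)" .
qed

end

section \<open>Twisting a presented algebra by matrices\<close>

text \<open>Half the trace of m times the transpose of n: complex bilinear rather than Hermitian,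
  and scaled so that an orthogonal matrix pairs to 1 with itself.\<close>

definition mat_ip :: "mat2 \<Rightarrow> mat2 \<Rightarrow> complex" where
  "mat_ip m n = (m$1$1 * n$1$1 + m$1$2 * n$1$2 + m$2$1 * n$2$1 + m$2$2 * n$2$2) / 2"

lemma mat_ip_mult: "mat_ip (a ** m ** b) n = mat_ip m (transpose a ** n ** transpose b)"
  by (simp add: mat_ip_def mat2_mult_nth transpose_def algebra_simps)

lemma mat_ip_add_right: "mat_ip m (n + k) = mat_ip m n + mat_ip m k"
  by (simp add: mat_ip_def field_simps)

lemma mat_ip_scale: "mat_ip m (mat_scale c n) = c * mat_ip m n" "mat_ip (mat_scale c m) n = c * mat_ip m n"
  by (simp_all add: mat_ip_def field_simps)

lemma mat_ip_self:
  assumes "m ** transpose m = mat 1"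
  shows "mat_ip m m = 1"
proof -
  have "(m ** transpose m) $ 1 $ 1 + (m ** transpose m) $ 2 $ 2 = 2"
    unfolding assms by (simp add: mat_def)
  then show ?thesis
    by (simp add: mat_ip_def mat2_mult_nth transpose_def algebra_simps)
qed

text \<open>
  The generator \<open>v\<^sub>i\<close> of the algebra with relations \<open>rC\<close> is sent to \<open>l\<^sub>i x\<^sub>i \<otimes> m\<^sub>i\<close>. Pairing the matrix factor
  with \<open>m\<^sub>w\<close> and dividing by \<open>l\<^sub>w\<close> recovers the word \<open>w\<close>; this gives the inverse on the image.
\<close>

locale matrix_twist =
  fixes rA rC :: "('i list \<Rightarrow>\<^sub>0 complex) set" and m :: "'i \<Rightarrow> mat2" and l :: "'i \<Rightarrow> complex"
  assumes orthogonal: "m i ** transpose (m i) = mat 1" and l_nonzero: "l i \<noteq> 0"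
begin

abbreviation (input) "A \<equiv> presented_calgebra rA"
abbreviation (input) "AM \<equiv> A \<times>\<times> mat2_calgebra"
abbreviation (input) "TI \<equiv> tensor_ideal A mat2_calgebra"
abbreviation "word w \<equiv> Poly_Mapping.single w (1::complex)"

sublocale T: monoid_algebra_quotient AM TI
  by (rule tensor_quotient)

definition mw :: "'i list \<Rightarrow> mat2" where
  "mw w = foldr (\<lambda>i n. m i ** n) w (mat 1)"

definition lw :: "'i list \<Rightarrow> complex" where
  "lw w = prod_list (map l w)"

lemma mw_simps [simp]: "mw [] = mat 1" "mw (i # w) = m i ** mw w"
  by (simp_all add: mw_def)

lemma mw_append: "mw (v @ w) = mw v ** mw w"
  by (induction v) (simp_all add: matrix_mul_assoc)

lemma lw_simps [simp]: "lw [] = 1" "lw (i # w) = l i * lw w" "lw (v @ w) = lw v * lw w"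
  by (simp_all add: lw_def)

lemma lw_nonzero [simp]: "lw w \<noteq> 0"
  by (induction w) (auto simp: l_nonzero)

lemma mw_orthogonal: "mw w ** transpose (mw w) = mat 1"
proof (induction w)
  case (Cons i w)
  have "mw (i # w) ** transpose (mw (i # w)) = m i ** (mw w ** transpose (mw w)) ** transpose (m i)"
    by (simp add: matrix_transpose_mul matrix_mul_assoc)
  then show ?case
    by (simp add: Cons orthogonal)
qed simp

text \<open>The algebra map v_i -> l_i x_i (x) m_i at the level of formal symbols. On a word the
  scalars and the matrices multiply up separately.\<close>

definition \<psi> :: "('i list \<Rightarrow>\<^sub>0 complex) \<Rightarrow> ('i presented \<times> mat2 \<Rightarrow>\<^sub>0 complex)" where
  "\<psi> = lin_ext (\<lambda>w. ten rA (word w) (mw w) (lw w))"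

lemma \<psi>_add: "\<psi> (f + g) = \<psi> f + \<psi> g"
  by (simp add: \<psi>_def lin_ext_add)

lemma \<psi>_minus: "\<psi> (f - g) = \<psi> f - \<psi> g"
  by (simp add: \<psi>_def lin_ext_minus)

lemma \<psi>_scale: "\<psi> (pm_scale c f) = pm_scale c (\<psi> f)"
  by (simp add: \<psi>_def lin_ext_scale)

lemma \<psi>_single: "\<psi> (Poly_Mapping.single w c) = ten rA (word w) (mw w) (c * lw w)"
  by (simp add: \<psi>_def ten_scale)

lemma \<psi>_supported [simp]: "\<psi> f \<in> T.S"
  unfolding \<psi>_def by (rule lin_ext_supported[of _ UNIV]) simp_all

lemma \<psi>_conv: "\<psi> (f \<star> g) = conv AM (\<psi> f) (\<psi> g)"
  unfolding \<psi>_def by (rule lin_ext_conv) (simp_all add: ten_def DirProd_simps mw_append)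

lemma \<psi>_one: "\<psi> (word []) = Poly_Mapping.single \<one>\<^bsub>AM\<^esub> 1"
  by (simp add: \<psi>_single ten_def DirProd_simps one_presented)

definition untwist :: "mat2 \<Rightarrow> ('i list \<Rightarrow>\<^sub>0 complex) \<Rightarrow> ('i list \<Rightarrow>\<^sub>0 complex)" where
  "untwist n = lin_ext (\<lambda>w. Poly_Mapping.single w (mat_ip (mw w) n / lw w))"

lemma untwist_add: "untwist n (f + g) = untwist n f + untwist n g"
  by (simp add: untwist_def lin_ext_add)

lemma untwist_minus: "untwist n (f - g) = untwist n f - untwist n g"
  by (simp add: untwist_def lin_ext_minus)

lemma untwist_scale: "untwist n (pm_scale c f) = pm_scale c (untwist n f)"
  by (simp add: untwist_def lin_ext_scale)

lemma untwist_single: "untwist n (Poly_Mapping.single w c) = Poly_Mapping.single w (c * mat_ip (mw w) n / lw w)"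
  by (simp add: untwist_def)

lemma untwist_add_mat: "untwist (n + k) f = untwist n f + untwist k f"
  by (simp add: untwist_def lin_ext_plus_fun[symmetric] mat_ip_add_right single_add add_divide_distrib)

lemma untwist_scale_mat: "untwist (mat_scale c n) f = pm_scale c (untwist n f)"
  by (simp add: untwist_def lin_ext_def pm_scale_sum mat_ip_scale mult_ac)

text \<open>Outer words move across the bilinear form as transposed matrices and so only change
  \<open>n\<close>. Hence the relations have to be tested against every matrix \<open>n\<close>, not
  one fixed matrix.\<close>

lemma untwist_conv:
  "untwist n (Poly_Mapping.single s c \<star> f \<star> Poly_Mapping.single t d) =
    Poly_Mapping.single s (c / lw s) \<star> untwist (transpose (mw s) ** n ** transpose (mw t)) f
      \<star> Poly_Mapping.single t (d / lw t)"
  by (rule additive_eqI[of f UNIV])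
    (simp_all add: untwist_add conv_add_left conv_add_right untwist_single mw_append mat_ip_mult[symmetric]
      mult_ac flip: append_assoc)

end

text \<open>A finite check on the defining relations in both directions; it is all that is needed
  for an isomorphism onto the image of \<open>\<psi>\<close>.\<close>

locale matrix_twist_relations = matrix_twist +
  assumes twist_rel: "r \<in> rC \<Longrightarrow> \<psi> r \<in> TI"
    and untwist_rel: "r \<in> rA \<Longrightarrow> untwist n r \<in> relation_ideal rC"
begin

lemma \<psi>_ideal:
  assumes "f \<in> relation_ideal rC"
  shows "\<psi> f \<in> TI"
proof (rule relation_ideal_additive_induct[where N = TI and L = \<psi>, OF assms])
  show "\<psi> (Poly_Mapping.single s c \<star> r \<star> Poly_Mapping.single t d) \<in> TI" if "r \<in> rC" for r s c t d
    unfolding \<psi>_conv by (intro T.I_conv_right T.I_conv_left \<psi>_supported twist_rel that)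
qed (auto simp: \<psi>_add intro: T.I_zero T.I_add T.I_uminus)

lemma untwist_ideal:
  assumes "f \<in> relation_ideal rA"
  shows "untwist n f \<in> relation_ideal rC"
proof (rule relation_ideal_additive_induct[where N = "relation_ideal rC" and L = "untwist n", OF assms])
  show "untwist n (Poly_Mapping.single s c \<star> r \<star> Poly_Mapping.single t d) \<in> relation_ideal rC"
    if "r \<in> rA" for r s c t d
    unfolding untwist_conv by (intro relation_ideal_conv untwist_rel that)
qed (auto simp: untwist_add intro: relation_ideal_closed)

text \<open>Injectivity of the twist. The pairing \<open>\<beta>\<close>, sending x (x) n to
  \<open>untwist n\<close> of x, kills the tensor ideal modulo the relations \<open>rC\<close>, and
  it undoes \<open>\<psi>\<close> on each word because m_w is orthogonal and so pairs to 1 with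
  itself.\<close>

lemma \<psi>_mem_ideal_iff: "\<psi> f \<in> TI \<longleftrightarrow> f \<in> relation_ideal rC"
proof
  \<comment> \<open>\<open>SOME\<close> picks a representative of the class. Another choice alters
    the value by the untwist of a relation of \<open>rA\<close>, which lies in the ideal of
    \<open>rC\<close>.\<close>
  define \<beta> where "\<beta> = (\<lambda>x. untwist (snd x) (SOME f. fst x = pcls rA f))"
  let ?N = "relation_ideal rC"
  have \<beta>: "\<beta> (pcls rA f, n) - untwist n f \<in> ?N" for f n
  proof -
    have "pcls rA f = pcls rA (SOME f'. pcls rA f = pcls rA f')"
      by (rule someI[of "\<lambda>f'. pcls rA f = pcls rA f'" f]) simp
    then have "(SOME f'. pcls rA f = pcls rA f') - f \<in> relation_ideal rA"
      using pcls_eq_iff by metis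
    then show ?thesis
      using untwist_ideal by (simp add: \<beta>_def flip: untwist_minus)
  qed
  have kills: "lin_ext \<beta> u \<in> ?N" if "u \<in> TI" for u
  proof (rule tensor_ideal_lin_ext[where N = ?N and rels = rA], goal_cases)
    case (4 f g n)
    show ?case
      using relation_ideal_closed(4)[OF relation_ideal_closed(4)[OF \<beta>[of "f + g" n] \<beta>[of f n]] \<beta>[of g n]]
      by (simp add: untwist_add)
  next
    case (5 f n k)
    show ?case
      using relation_ideal_closed(4)[OF relation_ideal_closed(4)[OF \<beta>[of f "n + k"] \<beta>[of f n]] \<beta>[of f k]]
      by (simp add: untwist_add_mat)
  next
    case (6 f c n)
    show ?case
      using relation_ideal_closed(4)[OF \<beta>[of "pm_scale c f" n] relation_ideal_closed(5)[OF \<beta>[of f n], of c]]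
      by (simp add: untwist_scale pm_scale_minus)
  next
    case (7 f c n)
    show ?case
      using relation_ideal_closed(4)[OF \<beta>[of f "mat_scale c n"] relation_ideal_closed(5)[OF \<beta>[of f n], of c]]
      by (simp add: untwist_scale_mat pm_scale_minus)
  qed (use that in \<open>auto intro: relation_ideal_closed\<close>)
  have inverse: "lin_ext \<beta> (\<psi> f) - f \<in> ?N"
  proof (induction f rule: supported_on_induct[of _ UNIV, simplified, case_names zero single add])
    case zero
    then show ?case by (simp add: \<psi>_def relation_ideal_closed)
  next
    case (single w c)
    have "untwist (mw w) (word w) = Poly_Mapping.single w (1 / lw w)"
      using mw_orthogonal by (simp add: untwist_single mat_ip_self)
    then show ?case
      using relation_ideal_closed(5)[OF \<beta>[of "word w" "mw w"], of "c * lw w"]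
      by (simp add: \<psi>_single ten_def pm_scale_minus)
  next
    case (add f g)
    then show ?case
      using relation_ideal_closed(2)[OF add] by (simp add: \<psi>_add lin_ext_add algebra_simps)
  qed
  show "f \<in> ?N" if "\<psi> f \<in> TI"
    using relation_ideal_closed(4)[OF kills[OF that] inverse] by simp
qed (rule \<psi>_ideal)

lemma twist_ring_hom: "ring_hom_ring free_calgebra T.Q (\<lambda>f. T.cls (\<psi> f))"
proof (rule ring_hom_ringI)
  show "ring (free_calgebra :: ('i list \<Rightarrow>\<^sub>0 complex) calgebra)"
    unfolding free_calgebra_def by (rule monoid_algebra_ring[OF word_monoid])
  show "ring T.Q" by (rule T.ring_Q)
qed (simp_all add: free_calgebra_def T.cls_closed T.mult_Q T.add_Q T.one_Q \<psi>_conv \<psi>_add \<psi>_one one_monoid_algebra)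

lemma twist_isomorphic:
  assumes "Inv = range (\<lambda>f. T.cls (\<psi> f))"
  shows "calgebra_isomorphic (T.Q\<lparr>carrier := Inv\<rparr>) (presented_calgebra rC)"
proof -
  let ?h = "\<lambda>f. T.cls (\<psi> f)"
  let ?g = "\<lambda>X. the_elem (?h ` X)"
  let ?B = "T.Q\<lparr>carrier := Inv\<rparr>"
  let ?C = "presented_calgebra rC"
  have carrier_F: "carrier (free_calgebra :: ('i list \<Rightarrow>\<^sub>0 complex) calgebra) = UNIV"
    by (simp add: free_calgebra_def)
  have ker: "a_kernel free_calgebra T.Q ?h = relation_ideal rC"
    unfolding a_kernel_def' T.zero_Q carrier_F T.cls_eq_I_iff[OF \<psi>_supported] \<psi>_mem_ideal_iff by simp
  \<comment> \<open>First isomorphism theorem for rings; compatibility with scalars has to be added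
    separately, on representatives.\<close>
  have "?g \<in> ring_iso (free_calgebra Quot relation_ideal rC) ?B"
    using ring_hom_ring.FactRing_iso_set_aux[OF twist_ring_hom] unfolding ker carrier_F assms .
  then have g: "?g \<in> ring_iso ?C ?B"
    by (simp add: ring_iso_def ring_hom_def presented_calgebra_def quotient_calgebra_def ring.defs)
  have g_pcls: "?g (pcls rC f) = ?h f" for f
  proof -
    have "?h ` pcls rC f = {?h f}"
    proof -
      have "?h f' = ?h f" if "f' \<in> pcls rC f" for f'
      proof -
        interpret P: monoid_algebra_quotient word_monoid "relation_ideal rC" by (rule presented_quotient)
        have "f' - f \<in> relation_ideal rC"
          using that P.mem_clsE[of f f'] by (simp add: pcls_eq)
        then show ?thesis
          by (simp add: T.cls_eq_iff \<psi>_mem_ideal_iff flip: \<psi>_minus)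
      qed
      moreover have "f \<in> pcls rC f"
        using monoid_algebra_quotient.self_in_cls[OF presented_quotient] by (simp add: pcls_eq)
      ultimately show ?thesis by blast
    qed
    then show ?thesis by simp
  qed
  have g_smult: "?g (c \<odot>\<^bsub>?C\<^esub> X) = c \<odot>\<^bsub>?B\<^esub> ?g X" if XC: "X \<in> carrier ?C" for c X
  proof -
    obtain f where X: "X = pcls rC f" using XC by (rule cls_presentedE)
    show ?thesis
      unfolding X smult_presented g_pcls by (simp add: \<psi>_scale T.smult_Q)
  qed
  \<comment> \<open>The isomorphism theorem yields a map from the quotient to the image, while the
    claim asks for the opposite direction; linearity is carried over to the inverse.\<close>
  let ?k = "inv_into (carrier ?C) ?g"
  have bij: "bij_betw ?g (carrier ?C) (carrier ?B)"
    using g by (simp add: ring_iso_def)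
  have "?k (c \<odot>\<^bsub>?B\<^esub> b) = c \<odot>\<^bsub>?C\<^esub> ?k b" if b: "b \<in> carrier ?B" for c b
  proof -
    obtain X where X: "X \<in> carrier ?C" "b = ?g X"
      using b bij unfolding bij_betw_def by (metis (no_types, lifting) imageE)
    have "c \<odot>\<^bsub>?C\<^esub> X \<in> carrier ?C"
      using X(1) by (elim cls_presentedE) (simp only: smult_presented pcls_closed)
    then have "?k (?g (c \<odot>\<^bsub>?C\<^esub> X)) = c \<odot>\<^bsub>?C\<^esub> X" "?k (?g X) = X"
      using X(1) bij unfolding bij_betw_def by (metis (no_types, lifting) inv_into_f_f)+
    then show ?thesis
      using X g_smult by metis
  qed
  moreover have "?k \<in> ring_iso ?B ?C"
    using ring_iso_set_sym[OF ring_presented g] .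
  ultimately show ?thesis
    unfolding calgebra_isomorphic_def calgebra_iso_def by blast
qed

end

section \<open>Invariants\<close>

abbreviation dm :: mat2 where "dm \<equiv> vector [vector [-1, 0], vector [0, 1]]"
abbreviation pm :: mat2 where "pm \<equiv> vector [vector [0, 1], vector [1, 0]]"

lemma matrix_inv_involution:
  fixes m :: mat2
  assumes "m ** m = mat 1"
  shows "matrix_inv m = m"
  unfolding matrix_inv_def
  by (rule some_equality) (simp add: assms, metis assms matrix_mul_assoc matrix_mul_lid matrix_mul_rid)

lemma conjugation_dm_nth:
  "conjugation dm n $ 1 $ 1 = n $ 1 $ 1" "conjugation dm n $ 1 $ 2 = - n $ 1 $ 2"
  "conjugation dm n $ 2 $ 1 = - n $ 2 $ 1" "conjugation dm n $ 2 $ 2 = n $ 2 $ 2"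
proof -
  have "matrix_inv dm = dm"
    by (rule matrix_inv_involution) (simp add: mat2_eq_iff mat2_mult_nth mat_def)
  then show "conjugation dm n $ 1 $ 1 = n $ 1 $ 1" "conjugation dm n $ 1 $ 2 = - n $ 1 $ 2"
    "conjugation dm n $ 2 $ 1 = - n $ 2 $ 1" "conjugation dm n $ 2 $ 2 = n $ 2 $ 2"
    by (simp_all add: conjugation_def mat2_mult_nth)
qed

lemma conjugation_pm_nth:
  "conjugation pm n $ 1 $ 1 = n $ 2 $ 2" "conjugation pm n $ 1 $ 2 = n $ 2 $ 1"
  "conjugation pm n $ 2 $ 1 = n $ 1 $ 2" "conjugation pm n $ 2 $ 2 = n $ 1 $ 1"
proof -
  have "matrix_inv pm = pm"
    by (rule matrix_inv_involution) (simp add: mat2_eq_iff mat2_mult_nth mat_def)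
  then show "conjugation pm n $ 1 $ 1 = n $ 2 $ 2" "conjugation pm n $ 1 $ 2 = n $ 2 $ 1"
    "conjugation pm n $ 2 $ 1 = n $ 1 $ 2" "conjugation pm n $ 2 $ 2 = n $ 1 $ 1"
    by (simp_all add: conjugation_def mat2_mult_nth)
qed

definition mat2_endo :: "(mat2 \<Rightarrow> mat2) \<Rightarrow> bool" where
  "mat2_endo h \<longleftrightarrow> (\<forall>m n. h (m + n) = h m + h n) \<and> (\<forall>c m. h (mat_scale c m) = mat_scale c (h m)) \<and>
     (\<forall>m n. h (m ** n) = h m ** h n) \<and> h (mat 1) = mat 1"

lemma mat2_endo_dm: "mat2_endo (conjugation dm)"
  by (simp add: mat2_endo_def mat2_eq_iff conjugation_dm_nth mat2_mult_nth mat_def)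

lemma mat2_endo_pm: "mat2_endo (conjugation pm)"
  by (simp add: mat2_endo_def mat2_eq_iff conjugation_pm_nth mat2_mult_nth mat_def)

text \<open>Multiplicity one: \<open>s = 1\<close> leaves only the diagonal and
  \<open>s = -1\<close> only the off-diagonal entries, and \<open>t\<close> determines one of the
  two remaining entries from the other.\<close>

lemma common_eigenspace:
  assumes "s * s = 1" "t * t = 1" "a \<noteq> 0"
    and "conjugation dm a = mat_scale s a" "conjugation pm a = mat_scale t a"
    and "conjugation dm b = mat_scale s b" "conjugation pm b = mat_scale t b"
  obtains c where "b = mat_scale c a"
proof -
  have eq: "conjugation dm x = mat_scale s x \<Longrightarrow> conjugation pm x = mat_scale t x \<Longrightarrow>
      x$1$1 = s * x$1$1 \<and> x$2$2 = s * x$2$2 \<and> - x$1$2 = s * x$1$2 \<and> - x$2$1 = s * x$2$1 \<and>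
      x$2$2 = t * x$1$1 \<and> x$2$1 = t * x$1$2" for x
    unfolding mat2_eq_iff conjugation_dm_nth conjugation_pm_nth mat_scale_nth by blast
  note a = eq[OF assms(4,5)] and b = eq[OF assms(6,7)]
  consider "s = 1" | "s = -1"
    using assms(1) square_eq_1_iff by blast
  then show ?thesis
  proof cases
    case 1
    then have "a$1$2 = 0" "a$2$1 = 0" "b$1$2 = 0" "b$2$1 = 0"
      using a b by simp_all
    moreover from this have "a$1$1 \<noteq> 0"
      using assms(3) a by (metis mat2_eq_iff mult_zero_right zero_index)
    ultimately have "b = mat_scale (b$1$1 / a$1$1) a"
      using conjunct1[OF b] a b by (simp add: mat2_eq_iff)
    then show ?thesis by (rule that)
  next
    case 2
    then have "a$1$1 = 0" "a$2$2 = 0" "b$1$1 = 0" "b$2$2 = 0"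
      using a b by simp_all
    moreover from this have "a$1$2 \<noteq> 0"
      using assms(3) a by (metis mat2_eq_iff mult_zero_right zero_index)
    ultimately have "b = mat_scale (b$1$2 / a$1$2) a"
      using a b by (simp add: mat2_eq_iff)
    then show ?thesis by (rule that)
  qed
qed

section \<open>Invariants of the tensor product under compatible pairs of automorphisms\<close>

context matrix_twist
begin

text \<open>\<open>F\<close> and \<open>h\<close> act on \<open>x\<^sub>i\<close> and \<open>m\<^sub>i\<close> by the same sign, so that \<open>F \<otimes> h\<close> fixes \<open>x\<^sub>i \<otimes> m\<^sub>i\<close>.\<close>

definition compatible :: "('i \<Rightarrow> complex) \<Rightarrow> ('i presented \<Rightarrow> 'i presented) \<Rightarrow> (mat2 \<Rightarrow> mat2) \<Rightarrow> bool" where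
  "compatible \<epsilon> F h \<longleftrightarrow> F \<in> calgebra_iso A A \<and> mat2_endo h \<and> (\<forall>i. \<epsilon> i * \<epsilon> i = 1) \<and>
     (\<forall>i. F (pcls rA (word [i])) = pcls rA (Poly_Mapping.single [i] (\<epsilon> i))) \<and>
     (\<forall>i. h (m i) = mat_scale (\<epsilon> i) (m i))"

abbreviation sign_of :: "('i \<Rightarrow> complex) \<Rightarrow> 'i list \<Rightarrow> complex" where
  "sign_of \<epsilon> w \<equiv> prod_list (map \<epsilon> w)"

context
  fixes \<epsilon> F h
  assumes compatible: "compatible \<epsilon> F h"
begin

lemma compatible_hom:
  "a \<in> carrier A \<Longrightarrow> F a \<in> carrier A"
  "a \<in> carrier A \<Longrightarrow> b \<in> carrier A \<Longrightarrow> F (a \<oplus>\<^bsub>A\<^esub> b) = F a \<oplus>\<^bsub>A\<^esub> F b"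
  "a \<in> carrier A \<Longrightarrow> b \<in> carrier A \<Longrightarrow> F (a \<otimes>\<^bsub>A\<^esub> b) = F a \<otimes>\<^bsub>A\<^esub> F b"
  "a \<in> carrier A \<Longrightarrow> F (c \<odot>\<^bsub>A\<^esub> a) = c \<odot>\<^bsub>A\<^esub> F a"
  "F \<one>\<^bsub>A\<^esub> = \<one>\<^bsub>A\<^esub>"
  using compatible ring_iso_memE[of F A A] by (auto simp: compatible_def calgebra_iso_def)

lemma compatible_endo:
  "h (n + k) = h n + h k" "h (mat_scale c n) = mat_scale c (h n)" "h (n ** k) = h n ** h k" "h (mat 1) = mat 1"
  using compatible by (auto simp: compatible_def mat2_endo_def)

lemma sign_of_square: "sign_of \<epsilon> w * sign_of \<epsilon> w = 1"
proof (induction w)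
  case (Cons i w)
  have "sign_of \<epsilon> (i # w) * sign_of \<epsilon> (i # w) = (\<epsilon> i * \<epsilon> i) * (sign_of \<epsilon> w * sign_of \<epsilon> w)"
    by (simp add: mult_ac)
  also have "\<dots> = 1"
    using compatible unfolding Cons.IH by (simp add: compatible_def)
  finally show ?case .
qed simp

lemma compatible_word: "F (pcls rA (word w)) = pcls rA (Poly_Mapping.single w (sign_of \<epsilon> w))"
proof (induction w)
  case Nil
  then show ?case using compatible_hom(5) by (simp add: one_presented)
next
  case (Cons i w)
  have "F (pcls rA (word (i # w))) = F (pcls rA (word [i]) \<otimes>\<^bsub>A\<^esub> pcls rA (word w))"
    by simp
  also have "\<dots> = F (pcls rA (word [i])) \<otimes>\<^bsub>A\<^esub> F (pcls rA (word w))"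
    by (rule compatible_hom) (rule pcls_closed)+
  also have "\<dots> = pcls rA (Poly_Mapping.single (i # w) (sign_of \<epsilon> (i # w)))"
    using compatible unfolding Cons by (simp add: compatible_def)
  finally show ?case .
qed

lemma compatible_mw: "h (mw w) = mat_scale (sign_of \<epsilon> w) (mw w)"
proof (induction w)
  case Nil
  then show ?case by (simp add: compatible_endo)
next
  case (Cons i w)
  then show ?case
    using compatible by (simp add: compatible_endo compatible_def mat_scale_mult mult.commute)
qed

definition "\<phi> = lin_ext (\<lambda>x. Poly_Mapping.single (F (fst x), h (snd x)) 1)"

lemma \<phi>_add: "\<phi> (u + v) = \<phi> u + \<phi> v"
  by (simp add: \<phi>_def lin_ext_add)

lemma \<phi>_minus: "\<phi> (u - v) = \<phi> u - \<phi> v"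
  by (simp add: \<phi>_def lin_ext_minus)

lemma \<phi>_scale: "\<phi> (pm_scale c u) = pm_scale c (\<phi> u)"
  by (simp add: \<phi>_def lin_ext_scale)

lemma \<phi>_supported: "u \<in> T.S \<Longrightarrow> \<phi> u \<in> T.S"
  unfolding \<phi>_def by (rule tensor_map_cls(2)) (use compatible_hom compatible_endo in auto)

lemma \<phi>_ideal: "u \<in> TI \<Longrightarrow> \<phi> u \<in> TI"
  unfolding \<phi>_def
  by (rule tensor_map_cls(3)[where u = 0]) (use compatible_hom compatible_endo in auto)

lemma tensor_map_\<phi>: "u \<in> T.S \<Longrightarrow> tensor_map A mat2_calgebra F h (T.cls u) = T.cls (\<phi> u)"
  unfolding \<phi>_def by (rule tensor_map_cls(1)) (use compatible_hom compatible_endo in auto)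

lemma \<phi>_ten_word: "\<phi> (ten rA (word w) n c) - ten rA (word w) (h n) (sign_of \<epsilon> w * c) \<in> TI"
  using ten_scale_left[of rA "sign_of \<epsilon> w" "word w" "h n" c]
  by (simp add: \<phi>_def ten_def compatible_word)

text \<open>The word w and the matrix m_w pick up the same sign, and its square is 1.\<close>

lemma \<phi>_\<psi>: "\<phi> (\<psi> f) - \<psi> f \<in> TI"
proof (induction f rule: supported_on_induct[of _ UNIV, simplified, case_names zero single add])
  case zero
  then show ?case by (simp add: \<psi>_def \<phi>_def T.I_zero)
next
  case (single w c)
  have "ten rA (word w) (mat_scale (sign_of \<epsilon> w) (mw w)) (sign_of \<epsilon> w * (c * lw w)) - \<psi> (Poly_Mapping.single w c) \<in> TI"
    using ten_scale_right[of rA "word w" "sign_of \<epsilon> w" "mw w" "sign_of \<epsilon> w * (c * lw w)"] sign_of_square[of w]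
    by (simp add: \<psi>_single flip: mult.assoc)
  then show ?case
    using T.I_add[OF \<phi>_ten_word[of w "mw w" "c * lw w"]] by (fastforce simp: \<psi>_single compatible_mw)
next
  case (add f g)
  then show ?case
    using T.I_add[OF add] by (simp add: \<psi>_add \<phi>_add algebra_simps)
qed

lemma tensor_map_fixes_\<psi>: "tensor_map A mat2_calgebra F h (T.cls (\<psi> f)) = T.cls (\<psi> f)"
  by (simp add: tensor_map_\<phi> T.cls_eq_iff \<phi>_supported \<phi>_\<psi>)

end

text \<open>\<open>(1 + \<phi>\<^sub>2)(1 + \<phi>\<^sub>1)\<close> is four times the projection to the invariants of both maps.\<close>

lemma invariants_subset_range:
  assumes c1: "compatible \<epsilon>1 F1 (conjugation dm)" and c2: "compatible \<epsilon>2 F2 (conjugation pm)"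
    and X: "X \<in> carrier T.Q"
    and X1: "tensor_map A mat2_calgebra F1 (conjugation dm) X = X"
    and X2: "tensor_map A mat2_calgebra F2 (conjugation pm) X = X"
  shows "X \<in> range (\<lambda>f. T.cls (\<psi> f))"
proof -
  define \<phi>1 where "\<phi>1 = \<phi> F1 (conjugation dm)"
  define \<phi>2 where "\<phi>2 = \<phi> F2 (conjugation pm)"
  note p1 = \<phi>_add[OF c1] \<phi>_minus[OF c1] \<phi>_scale[OF c1] \<phi>_supported[OF c1] \<phi>_ideal[OF c1]
    tensor_map_\<phi>[OF c1] \<phi>_ten_word[OF c1]
  note p1 = p1[folded \<phi>1_def]
  note p2 = \<phi>_add[OF c2] \<phi>_minus[OF c2] \<phi>_scale[OF c2] \<phi>_supported[OF c2] \<phi>_ideal[OF c2]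
    tensor_map_\<phi>[OF c2] \<phi>_ten_word[OF c2]
  note p2 = p2[folded \<phi>2_def]
  define E where "E u = \<phi>2 (\<phi>1 u + u) + (\<phi>1 u + u)" for u
  \<comment> \<open>\<open>K\<close> collects the formal tensors whose average \<open>E\<close> lies
    in the image of \<open>\<psi>\<close> modulo the tensor ideal. It is additive, so it suffices to
    treat a word tensored with an arbitrary matrix.\<close>
  define K where "K = {u. \<exists>f. E u - \<psi> f \<in> TI}"
  have K_add: "u + v \<in> K" if uv: "u \<in> K" "v \<in> K" for u v
  proof -
    obtain f g where "E u - \<psi> f \<in> TI" "E v - \<psi> g \<in> TI" using uv by (auto simp: K_def)
    then have "E (u + v) - \<psi> (f + g) \<in> TI"
      using T.I_add[of "E u - \<psi> f" "E v - \<psi> g"] by (simp add: E_def p1 p2 \<psi>_add algebra_simps)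
    then show ?thesis by (auto simp: K_def)
  qed
  have K_ideal: "u \<in> K" if u: "u \<in> TI" for u
  proof -
    have "E u - \<psi> 0 \<in> TI"
      using u by (simp add: E_def \<psi>_def p1 p2 T.I_add)
    then show ?thesis unfolding K_def by blast
  qed
  have K_word: "ten rA (word w) n c \<in> K" for w n c
  proof -
    let ?s = "sign_of \<epsilon>1 w" and ?t = "sign_of \<epsilon>2 w"
    \<comment> \<open>Both maps act on the word by a sign, so averaging happens in the matrix factor
      alone: \<open>n2\<close> is four times the projection of \<open>n\<close> to the eigenline
      with signs \<open>?s\<close> and \<open>?t\<close>, the line spanned by m_w.\<close>
    define n1 where "n1 = n + mat_scale ?s (conjugation dm n)"
    define n2 where "n2 = n1 + mat_scale ?t (conjugation pm n1)"
    have st: "?s * ?s = 1" "?t * ?t = 1"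
      using sign_of_square c1 c2 by blast+
    then have st': "?s * (?s * x) = x" "?t * (?t * x) = x" for x
      by (simp_all flip: mult.assoc)
    have average: "\<phi>' (ten rA (word w) k c) + ten rA (word w) k c
        - ten rA (word w) (k + mat_scale e (h' k)) c \<in> TI"
      if "\<phi>' (ten rA (word w) k c) - ten rA (word w) (h' k) (e * c) \<in> TI" for \<phi>' h' e k
    proof -
      have "ten rA (word w) (h' k) (e * c) - ten rA (word w) (mat_scale e (h' k)) c \<in> TI"
        by (rule tensor_ideal_sym) (rule ten_scale_right)
      moreover have "ten rA (word w) k c + ten rA (word w) (mat_scale e (h' k)) c
          - ten rA (word w) (k + mat_scale e (h' k)) c \<in> TI"
        using T.I_uminus[OF ten_add_right[of rA "word w" k "mat_scale e (h' k)" c]] by (simp add: algebra_simps)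
      ultimately show ?thesis
        using T.I_add[OF T.I_add[OF that]] by (fastforce simp: algebra_simps)
    qed
    let ?u = "ten rA (word w) n c" and ?u1 = "ten rA (word w) n1 c" and ?u2 = "ten rA (word w) n2 c"
    have a1: "\<phi>1 ?u + ?u - ?u1 \<in> TI"
      unfolding n1_def by (rule average) (rule p1)
    have a2: "\<phi>2 ?u1 + ?u1 - ?u2 \<in> TI"
      unfolding n2_def by (rule average) (rule p2)
    have "\<phi>2 (\<phi>1 ?u + ?u) - \<phi>2 ?u1 \<in> TI"
      using p2(5)[OF a1] by (simp add: p2(2))
    then have E_u: "E ?u - ?u2 \<in> TI"
      using T.I_add[OF T.I_add[OF _ a1] a2] unfolding E_def by (fastforce simp: algebra_simps)
    have "mw w \<noteq> 0"
      using mw_orthogonal[of w] by (auto simp: mat2_eq_iff mat2_mult_nth mat_def)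
    moreover have "conjugation dm n2 = mat_scale ?s n2" "conjugation pm n2 = mat_scale ?t n2"
      by (simp_all add: n2_def n1_def mat2_eq_iff conjugation_dm_nth conjugation_pm_nth algebra_simps st')
    ultimately obtain a where "n2 = mat_scale a (mw w)"
      using common_eigenspace[OF st] compatible_mw[OF c1] compatible_mw[OF c2] by metis
    \<comment> \<open>The division by \<open>lw w\<close> cancels the factor that
      \<open>\<psi>\<close> puts on the word w.\<close>
    then have "?u2 - \<psi> (Poly_Mapping.single w (a * c / lw w)) \<in> TI"
      using ten_scale_right[of rA "word w" a "mw w" c] by (simp add: \<psi>_single)
    with E_u have "E ?u - \<psi> (Poly_Mapping.single w (a * c / lw w)) \<in> TI"
      by (rule tensor_ideal_trans)
    then show ?thesis unfolding K_def by blast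
  qed
  have K_ten: "ten rA f n c \<in> K" for f n c
  proof -
    have "lin_ext (\<lambda>w. ten rA (word w) n c) f \<in> K"
    proof (induction f rule: supported_on_induct[of _ UNIV, simplified, case_names zero single add])
      case zero
      show ?case by (simp add: K_ideal T.I_zero)
    next
      case (single w d)
      show ?case by (simp add: ten_scale K_word)
    next
      case (add f g)
      then show ?case by (simp add: lin_ext_add K_add)
    qed
    then show ?thesis
      using K_add[OF _ K_ideal[OF ten_expand[of rA f n c]]] by fastforce
  qed
  have K_all: "u \<in> K" if "u \<in> T.S" for u
    using that
  proof (induction rule: supported_on_induct)
    case zero
    show ?case by (simp add: K_ideal T.I_zero)
  next
    case (single x c)
    then obtain f n where "x = (pcls rA f, n)"
      by (auto simp: DirProd_simps carrier_presented)
    then show ?case using K_ten[of f n c] by (simp add: ten_def)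
  next
    case (add u v)
    then show ?case by (simp add: K_add)
  qed
  obtain u where u: "u \<in> T.S" "X = T.cls u"
    using X by (auto simp: T.carrier_Q)
  have i1: "\<phi>1 u - u \<in> TI" and i2: "\<phi>2 u - u \<in> TI"
    using X1 X2 u by (simp_all add: p1 p2 T.cls_eq_iff)
  obtain f where f: "E u - \<psi> f \<in> TI"
    using K_all[OF u(1)] by (auto simp: K_def)
  have "\<phi>2 (\<phi>1 u) - \<phi>2 u \<in> TI"
    using p2(5)[OF i1] by (simp add: p2)
  \<comment> \<open>On an invariant each of the two factors of \<open>E\<close> acts as
    multiplication by 2.\<close>
  then have "E u - pm_scale 4 u \<in> TI"
  proof -
    have "pm_scale 2 u = u + u"
      using pm_scale_left_add[of 1 1 u] by simp
    then have "pm_scale 4 u = (u + u) + (u + u)"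
      using pm_scale_left_add[of 2 2 u] by simp
    moreover have "\<phi>2 (\<phi>1 u) - \<phi>2 u + ((\<phi>2 u - u) + (\<phi>2 u - u) + (\<phi>1 u - u)) \<in> TI"
      using \<open>\<phi>2 (\<phi>1 u) - \<phi>2 u \<in> TI\<close> i1 i2 by (intro T.I_add)
    ultimately show ?thesis
      by (simp add: E_def p2 algebra_simps)
  qed
  then have "pm_scale 4 u - \<psi> f \<in> TI"
    using f tensor_ideal_trans tensor_ideal_sym by blast
  then have "pm_scale (1/4) (pm_scale 4 u - \<psi> f) \<in> TI"
    by (rule T.I_scale)
  then have "u - \<psi> (pm_scale (1/4) f) \<in> TI"
    by (simp add: pm_scale_minus \<psi>_scale)
  then have "X = T.cls (\<psi> (pm_scale (1/4) f))"
    using u by (simp add: T.cls_eq_iff)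
  then show ?thesis by blast
qed

end

section \<open>Sign changes as the only graded involutions\<close>

text \<open>One shape for the relations of both algebras: \<open>s = 1\<close> gives a commutator
  and \<open>s = -1\<close> an anticommutator in i and j, while \<open>p = q\<close> gives an
  anticommutator and \<open>p = - q\<close> a commutator in k and l.\<close>

definition quad :: "'i \<Rightarrow> 'i \<Rightarrow> 'i \<Rightarrow> 'i \<Rightarrow> complex \<Rightarrow> complex \<Rightarrow> complex \<Rightarrow> ('i list \<Rightarrow>\<^sub>0 complex)" where
  "quad i j k l s p q = Poly_Mapping.single [i, j] 1 - Poly_Mapping.single [j, i] s
     - Poly_Mapping.single [k, l] p - Poly_Mapping.single [l, k] q"

definition quads :: "(4 \<times> 4 \<times> 4 \<times> 4 \<times> complex) set \<Rightarrow> (4 list \<Rightarrow>\<^sub>0 complex) set" where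
  "quads T = (\<Union>(i, j, k, l, p)\<in>T. {quad i j k l 1 p p, quad i j k l (-1) 1 (-1)})"

abbreviation sklyanin_index :: "complex \<Rightarrow> complex \<Rightarrow> complex \<Rightarrow> (4 \<times> 4 \<times> 4 \<times> 4 \<times> complex) set" where
  "sklyanin_index \<alpha> \<beta> \<gamma> \<equiv> {(0, 1, 2, 3, \<alpha>), (0, 2, 3, 1, \<beta>), (0, 3, 1, 2, \<gamma>)}"

lemma free_calgebra_simps:
  "f \<otimes>\<^bsub>free_calgebra\<^esub> g = f \<star> g" "f \<oplus>\<^bsub>free_calgebra\<^esub> g = f + g" "f \<ominus>\<^bsub>free_calgebra\<^esub> g = f - g"
  "c \<odot>\<^bsub>free_calgebra\<^esub> f = pm_scale c f"
  by (simp_all add: free_calgebra_def minus_monoid_algebra[OF word_monoid])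

lemma sklyanin_relations_eq: "sklyanin_relations \<alpha> \<beta> \<gamma> = quads (sklyanin_index \<alpha> \<beta> \<gamma>)"
  by (simp add: sklyanin_relations_def quads_def quad_def comm_def anticomm_def Let_def free_calgebra_simps free_gen_def
      pm_scale_add insert_commute algebra_simps single_uminus)

lemma odesskii_relations_eq: "odesskii_relations \<alpha> \<beta> \<gamma> =
   {quad 0 1 2 3 1 \<alpha> (-\<alpha>), quad 0 1 2 3 (-1) 1 1, quad 0 2 3 1 1 \<beta> (-\<beta>), quad 0 2 3 1 (-1) 1 1,
    quad 0 3 1 2 1 (-\<gamma>) \<gamma>, quad 0 3 1 2 (-1) (-1) (-1)}"
  by (simp add: odesskii_relations_def quad_def comm_def anticomm_def Let_def free_calgebra_simps free_gen_def
      pm_scale_minus insert_commute algebra_simps single_uminus)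

lemma exhaust_mod_4: "x = 0 \<or> x = 1 \<or> x = 2 \<or> x = (3::4)"
  using exhaust_4[of x] by auto

lemma sklyanin_index_cases:
  assumes "(i, j, k, l, p) \<in> sklyanin_index \<alpha> \<beta> \<gamma>"
  obtains "i = 0" "j = 1" "k = 2" "l = 3" "p = \<alpha>" | "i = 0" "j = 2" "k = 3" "l = 1" "p = \<beta>"
  | "i = 0" "j = 3" "k = 1" "l = 2" "p = \<gamma>"
  using assms by auto

lemma sklyanin_index_distinct:
  assumes "(i, j, k, l, p) \<in> sklyanin_index \<alpha> \<beta> \<gamma>"
  shows "distinct [i, j, k, l]"
  using assms by (cases rule: sklyanin_index_cases) simp_all

subsection \<open>Low degree coefficients of the relation ideal\<close>

text \<open>The relations are homogeneous of degree 2. Multiplying one by a nonempty word produces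
  only words longer than 2, which \<open>L\<close> ignores; multiplying by constants only rescales
  it.\<close>

lemma quads_ideal_functional:
  fixes L :: "(4 list \<Rightarrow>\<^sub>0 complex) \<Rightarrow> complex"
  assumes f: "f \<in> relation_ideal (quads T)"
    and add: "\<And>f g. L (f + g) = L f + L g" and scale: "\<And>c f. L (pm_scale c f) = c * L f"
    and long: "\<And>w c. length w > 2 \<Longrightarrow> L (Poly_Mapping.single w c) = 0"
    and rel: "\<And>r. r \<in> quads T \<Longrightarrow> L r = 0"
  shows "L f = 0"
proof -
  have minus: "L (f - g) = L f - L g" for f g
    using add[of "f - g" g] by simp
  have "L f \<in> {0}"
  proof (rule relation_ideal_additive_induct[OF f, where L = L])
    fix r s c t d assume r: "r \<in> quads T"
    then obtain i j k l e p q where q: "r = quad i j k l e p q"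
      by (auto simp: quads_def)
    show "L (Poly_Mapping.single s c \<star> r \<star> Poly_Mapping.single t d) \<in> {0}"
    proof (cases "s = [] \<and> t = []")
      case True
      have "Poly_Mapping.single [] c \<star> r \<star> Poly_Mapping.single [] d = pm_scale (c * d) r"
        unfolding q quad_def by (simp add: conv_minus_left conv_minus_right pm_scale_minus mult_ac)
      then show ?thesis using True r rel scale by simp
    next
      case False
      then have "length s + length t > 0" by simp
      then show ?thesis
        unfolding q quad_def by (simp add: conv_minus_left conv_minus_right minus long)
    qed
  qed (auto simp: add)
  then show ?thesis by simp
qed

lemma lookup_quad:
  "Poly_Mapping.lookup (quad i j k l s p q) w =
    (1 when [i, j] = w) - (s when [j, i] = w) - (p when [k, l] = w) - (q when [l, k] = w)"
  by (simp add: quad_def lookup_minus lookup_single)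

text \<open>Each functional vanishes on the relations and on long words. In the four-dimensional
  block with words ij, ji, kl, lk the two relations span a plane, and the last two functionals span
  its annihilator.\<close>

lemma sklyanin_ideal_coeffs:
  assumes f: "f \<in> relation_ideal (sklyanin_relations \<alpha> \<beta> \<gamma>)"
  shows "Poly_Mapping.lookup f [] = 0" "Poly_Mapping.lookup f [i] = 0" "Poly_Mapping.lookup f [i, i] = 0"
    and "(i, j, k, l, p) \<in> sklyanin_index \<alpha> \<beta> \<gamma> \<Longrightarrow>
      p * (Poly_Mapping.lookup f [i, j] - Poly_Mapping.lookup f [j, i])
        + Poly_Mapping.lookup f [k, l] + Poly_Mapping.lookup f [l, k] = 0"
    and "(i, j, k, l, p) \<in> sklyanin_index \<alpha> \<beta> \<gamma> \<Longrightarrow>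
      Poly_Mapping.lookup f [i, j] + Poly_Mapping.lookup f [j, i]
        + Poly_Mapping.lookup f [k, l] - Poly_Mapping.lookup f [l, k] = 0"
proof -
  note f' = f[unfolded sklyanin_relations_eq]
  have short: "length w > 2 \<Longrightarrow> w \<noteq> []" "length w > 2 \<Longrightarrow> w \<noteq> [a]" "length w > 2 \<Longrightarrow> w \<noteq> [a, b]"
    for w and a b :: 4 by auto
  note [simp] = lookup_add lookup_single when_def short algebra_simps
  show "Poly_Mapping.lookup f [] = 0"
    by (rule quads_ideal_functional[OF f']) (auto simp: quads_def lookup_quad)
  show "Poly_Mapping.lookup f [i] = 0"
    by (rule quads_ideal_functional[OF f']) (auto simp: quads_def lookup_quad)
  show "Poly_Mapping.lookup f [i, i] = 0"
    by (rule quads_ideal_functional[OF f']) (auto simp: quads_def lookup_quad)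
  assume T: "(i, j, k, l, p) \<in> sklyanin_index \<alpha> \<beta> \<gamma>"
  show "p * (Poly_Mapping.lookup f [i, j] - Poly_Mapping.lookup f [j, i])
        + Poly_Mapping.lookup f [k, l] + Poly_Mapping.lookup f [l, k] = 0"
    by (rule quads_ideal_functional[OF f']) (use T in \<open>auto simp: quads_def lookup_quad\<close>)
  show "Poly_Mapping.lookup f [i, j] + Poly_Mapping.lookup f [j, i]
        + Poly_Mapping.lookup f [k, l] - Poly_Mapping.lookup f [l, k] = 0"
    by (rule quads_ideal_functional[OF f']) (use T in \<open>auto simp: quads_def lookup_quad\<close>)
qed

subsection \<open>Involutions of the space of quadratic relations\<close>

definition linear_form :: "(4 \<Rightarrow> complex) \<Rightarrow> (4 list \<Rightarrow>\<^sub>0 complex)" where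
  "linear_form a = (\<Sum>i\<in>UNIV. Poly_Mapping.single [i] (a i))"

lemma lookup_linear_form: "Poly_Mapping.lookup (linear_form a) [i] = a i"
  by (simp add: linear_form_def lookup_sum lookup_single when_def)

lemma linear_form_eqI:
  assumes "\<forall>w\<in>Poly_Mapping.keys f. length w = 1"
  shows "f = linear_form (\<lambda>i. Poly_Mapping.lookup f [i])"
proof (rule poly_mapping_eqI)
  fix w
  show "Poly_Mapping.lookup f w = Poly_Mapping.lookup (linear_form (\<lambda>i. Poly_Mapping.lookup f [i])) w"
  proof (cases "length w = 1")
    case True
    then obtain i where "w = [i]" by (auto simp: length_Suc_conv)
    then show ?thesis by (simp add: lookup_linear_form)
  next
    case False
    then have "Poly_Mapping.lookup f w = 0" and "[i] \<noteq> w" for i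
      using assms by (auto simp: in_keys_iff)
    then show ?thesis by (simp add: linear_form_def lookup_sum lookup_single when_def)
  qed
qed

lemma conv_sum_left: "sum f X \<star> g = (\<Sum>x\<in>X. f x \<star> g)"
  by (induction X rule: infinite_finite_induct) (simp_all add: conv_add_left)

lemma conv_sum_right: "g \<star> sum f X = (\<Sum>x\<in>X. g \<star> f x)"
  by (induction X rule: infinite_finite_induct) (simp_all add: conv_add_right)

lemma lookup_conv_linear_form:
  "Poly_Mapping.lookup (linear_form a \<star> linear_form b) [i, j] = a i * b j"
proof -
  have nest: "(v when c = i \<and> d = j) = (if c = i then (if d = j then v else 0) else 0)" for c d and v :: complex
    by simp
  show ?thesis
    by (simp add: linear_form_def conv_sum_left conv_sum_right lookup_sum lookup_single nest)
qed

text \<open>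
  Since \<open>H\<close> permutes the coordinate axes (the points where \<open>p \<otimes> p\<close> kills the relations), a nonzero
  off-diagonal entry means that two axes are swapped; the relations involving these exclude this.
\<close>

lemma involution_diagonal:
  fixes H :: "4 \<Rightarrow> 4 \<Rightarrow> complex"
  assumes T: "distinct [i, j, k, l]" and p: "p \<noteq> 0"
    and col: "\<And>x y c. x \<noteq> y \<Longrightarrow> H x c * H y c = 0"
    and sq: "\<And>x y. (\<Sum>z\<in>UNIV. H x z * H z y) = (if x = y then 1 else 0)"
    and M1: "\<And>a b. M1 a b = H i a * H j b - H j a * H i b - p * (H k a * H l b + H l a * H k b)"
    and M2: "\<And>a b. M2 a b = H i a * H j b + H j a * H i b - H k a * H l b + H l a * H k b"
    and M1_eq: "p * (M1 i j - M1 j i) + M1 k l + M1 l k = 0"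
    and M2_eq: "M2 i j + M2 j i + M2 k l - M2 l k = 0"
  shows "H i j = 0" "H j i = 0" "H k l = 0" "H l k = 0" "H i i * H j j = H k k * H l l"
proof -
  \<comment> \<open>By \<open>col\<close> each column has at most one nonzero entry, so the diagonal
    entry (y, y) of the square of \<open>H\<close> reduces to one product, which must be 1.\<close>
  have swap: "H x y * H y x = 1 \<and> H y x * H x y = 1 \<and> H x x = 0 \<and> H y y = 0" if "H x y \<noteq> 0" "x \<noteq> y" for x y
  proof -
    have col_y: "H z y = 0" if "z \<noteq> x" for z
      using col[of z x y] that \<open>H x y \<noteq> 0\<close> by auto
    have "(\<Sum>z\<in>UNIV. H y z * H z y) = H y x * H x y"
      using col_y by (subst sum.remove[of _ x]) auto
    then have yx: "H y x * H x y = 1" using sq[of y y] by simp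
    then have "H y x \<noteq> 0" by auto
    then have "H x x = 0" using col[of x y x] that by auto
    then show ?thesis using yx col_y[of y] that by (simp add: mult.commute)
  qed
  \<comment> \<open>\<open>M1\<close> and \<open>M2\<close> hold the coefficients of the images of
    the two relations of a block, and the hypotheses apply to them the functionals that annihilate
    the block. Everything except products of entries inside the 2 by 2 minors of {i, j} and {k, l}
    cancels.\<close>
  have "p * (M1 i j - M1 j i) + M1 k l + M1 l k
      = 2 * p * (H i i * H j j - H j i * H i j - H k k * H l l - H l k * H k l)"
    unfolding M1 by (simp add: algebra_simps)
  then have e1: "H i i * H j j - H j i * H i j - H k k * H l l - H l k * H k l = 0"
    using p M1_eq by simp
  have "M2 i j + M2 j i + M2 k l - M2 l k
      = 2 * (H i i * H j j + H j i * H i j - H k k * H l l + H l k * H k l)"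
    unfolding M2 by (simp add: algebra_simps)
  then have e2: "H i i * H j j + H j i * H i j - H k k * H l l + H l k * H k l = 0"
    using M2_eq by (metis mult_eq_0_iff zero_neq_numeral)
  \<comment> \<open>Difference and sum of \<open>e2\<close> and \<open>e1\<close> separate the
    off-diagonal products from the diagonal ones.\<close>
  have "2 * (H j i * H i j + H l k * H k l) = 0" "2 * (H i i * H j j - H k k * H l l) = 0"
    using arg_cong2[OF e2 e1, of "(-)"] arg_cong2[OF e2 e1, of "(+)"] by (simp_all add: algebra_simps)
  then have "H j i * H i j + H l k * H k l = 0" "H i i * H j j - H k k * H l l = 0"
    by (metis mult_eq_0_iff zero_neq_numeral)+
  then have e3: "H l k * H k l = - (H j i * H i j)" and e4: "H i i * H j j = H k k * H l l"
    by (simp_all only: add_eq_0_iff right_minus_eq)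
  show "H i j = 0"
  proof (rule ccontr)
    assume "H i j \<noteq> 0"
    then have "H j i * H i j = 1" using swap[of i j] T by auto
    \<comment> \<open>A swap of i and j has product 1 and forces the product -1 on {k, l}; but a
      nonzero product there is again a swap, whose product is 1.\<close>
    with e3 have *: "H l k * H k l = -1" by simp
    then have "H l k \<noteq> 0" by auto
    then show False using * swap[of l k] T by auto
  qed
  then show "H j i = 0" using swap[of j i] T by force
  then have **: "H l k * H k l = 0" using e3 by simp
  show "H k l = 0" by (rule ccontr) (use ** swap[of k l] T in auto)
  show "H l k = 0" by (rule ccontr) (use ** swap[of l k] T in auto)
  show "H i i * H j j = H k k * H l l" by (rule e4)
qed

lemma single_sum: "Poly_Mapping.single x (sum f X) = (\<Sum>i\<in>X. Poly_Mapping.single x (f i))"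
  by (induction X rule: infinite_finite_induct) (simp_all add: single_add)

lemma single_linear_form: "Poly_Mapping.single [i] c = linear_form (\<lambda>j. if j = i then c else 0)"
  by (simp add: linear_form_def if_distrib[of "Poly_Mapping.single _"] cong: if_cong)

section \<open>Graded automorphisms of a Sklyanin algebra as 4 by 4 matrices\<close>

context
  fixes \<alpha> \<beta> \<gamma> :: complex
  assumes parameters: "sklyanin_parameters \<alpha> \<beta> \<gamma>"
begin

abbreviation (input) "sk_rels \<equiv> sklyanin_relations \<alpha> \<beta> \<gamma>"
abbreviation (input) "sk_alg \<equiv> presented_calgebra sk_rels"
abbreviation (input) "sk_gen i \<equiv> pcls sk_rels (Poly_Mapping.single [i] 1)"

lemma index_nonzero: "(i, j, k, l, p) \<in> sklyanin_index \<alpha> \<beta> \<gamma> \<Longrightarrow> p \<noteq> 0"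
  using parameters by (auto simp: sklyanin_parameters_def)

lemma pcls_linear_form_eq_iff: "pcls sk_rels (linear_form a) = pcls sk_rels (linear_form b) \<longleftrightarrow> a = b"
proof
  assume "pcls sk_rels (linear_form a) = pcls sk_rels (linear_form b)"
  then have "linear_form a - linear_form b \<in> relation_ideal sk_rels"
    by (simp add: pcls_eq_iff)
  from sklyanin_ideal_coeffs(2)[OF this] show "a = b"
    by (simp add: lookup_minus lookup_linear_form fun_eq_iff)
qed simp

lemma gen_linear_form: "sk_gen i = pcls sk_rels (linear_form (\<lambda>j. if j = i then 1 else 0))"
  by (simp add: linear_form_def if_distrib[of "Poly_Mapping.single _"] cong: if_cong)

lemma degree_one_linear_form:
  assumes "a \<in> presented_degree sk_rels 1"
  obtains c where "a = pcls sk_rels (linear_form c)"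
proof -
  obtain f where "a = pcls sk_rels f" "\<forall>w\<in>Poly_Mapping.keys f. length w = 1"
    using assms by (auto simp: presented_degree_eq)
  then show ?thesis
    using linear_form_eqI[of f] that[of "\<lambda>i. Poly_Mapping.lookup f [i]"] by simp
qed

lemma gen_degree: "sk_gen i \<in> presented_degree sk_rels 1"
  by (auto simp: presented_degree_eq intro!: image_eqI[OF refl])

lemma calgebra_iso_simps:
  assumes "h \<in> calgebra_iso sk_alg sk_alg"
  shows "h (pcls sk_rels f) \<in> carrier sk_alg"
    "h (pcls sk_rels (f + g)) = h (pcls sk_rels f) \<oplus>\<^bsub>sk_alg\<^esub> h (pcls sk_rels g)"
    "h (pcls sk_rels (f \<star> g)) = h (pcls sk_rels f) \<otimes>\<^bsub>sk_alg\<^esub> h (pcls sk_rels g)"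
    "h (pcls sk_rels (pm_scale c f)) = c \<odot>\<^bsub>sk_alg\<^esub> h (pcls sk_rels f)"
  using assms ring_iso_memE(1,2,3)[of h sk_alg sk_alg]
  by (auto simp: calgebra_iso_def simp flip: mult_presented add_presented smult_presented)

lemma calgebra_iso_linear_form:
  assumes h: "h \<in> calgebra_iso sk_alg sk_alg" and H: "\<And>i. h (sk_gen i) = pcls sk_rels (linear_form (H i))"
  shows "h (pcls sk_rels (linear_form a)) = pcls sk_rels (linear_form (\<lambda>j. \<Sum>i\<in>UNIV. a i * H i j))"
proof -
  note h = calgebra_iso_simps[OF h]
  have h_single: "h (pcls sk_rels (Poly_Mapping.single [i] c)) = pcls sk_rels (pm_scale c (linear_form (H i)))" for i c
    using h(4)[of c "Poly_Mapping.single [i] 1"] H by simp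
  have "h (pcls sk_rels (\<Sum>i\<in>X. Poly_Mapping.single [i] (a i))) = pcls sk_rels (\<Sum>i\<in>X. pm_scale (a i) (linear_form (H i)))"
    if "finite X" for X
    using that
  proof (induction X rule: finite_induct)
    case empty
    then show ?case using h(4)[of 0 0] h(1)[of 0] by (auto simp: carrier_presented)
  next
    case (insert i X)
    then show ?case by (simp add: h(2) h_single)
  qed
  moreover have "(\<Sum>i\<in>UNIV. pm_scale (a i) (linear_form (H i))) = linear_form (\<lambda>j. \<Sum>i\<in>UNIV. a i * H i j)"
    by (simp add: linear_form_def pm_scale_sum single_sum) (rule sum.swap)
  ultimately show ?thesis by (simp add: linear_form_def)
qed

text \<open>An automorphism maps relations to elements of the ideal, and coefficient functionals
  turn this into quadratic equations for its degree-one matrix \<open>H\<close>. With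
  \<open>H\<close> squared equal to 1 these force \<open>H\<close> to be diagonal with entries 1 and
  -1.\<close>

lemma graded_involution_signs:
  assumes auto: "graded_automorphism sk_alg (presented_degree sk_rels) h"
    and involution: "\<And>a. a \<in> carrier sk_alg \<Longrightarrow> h (h a) = a"
  obtains \<epsilon> where "\<And>i. h (sk_gen i) = pcls sk_rels (Poly_Mapping.single [i] (\<epsilon> i))" "\<And>i. \<epsilon> i * \<epsilon> i = 1"
    "\<And>i j k l p. (i, j, k, l, p) \<in> sklyanin_index \<alpha> \<beta> \<gamma> \<Longrightarrow> \<epsilon> i * \<epsilon> j = \<epsilon> k * \<epsilon> l"
proof -
  have iso: "h \<in> calgebra_iso sk_alg sk_alg" and deg: "h ` presented_degree sk_rels 1 = presented_degree sk_rels 1"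
    using auto by (auto simp: graded_automorphism_def)
  have "\<exists>c. h (sk_gen i) = pcls sk_rels (linear_form c)" for i
    using gen_degree[of i] deg degree_one_linear_form by (metis imageI)
  then obtain H where H: "h (sk_gen i) = pcls sk_rels (linear_form (H i))" for i
    by metis
  have hh: "h (h (sk_gen i)) = sk_gen i" for i
    by (rule involution) simp
  have sq: "(\<Sum>z\<in>UNIV. H x z * H z y) = (if x = y then 1 else 0)" for x y
    using hh[of x, unfolded H, unfolded calgebra_iso_linear_form[OF iso H],
        unfolded gen_linear_form pcls_linear_form_eq_iff]
    by (simp add: fun_eq_iff eq_commute[of x y])
  have h_quad: "linear_form (H i) \<star> linear_form (H j) - pm_scale s (linear_form (H j) \<star> linear_form (H i))
      - pm_scale p (linear_form (H k) \<star> linear_form (H l)) - pm_scale q (linear_form (H l) \<star> linear_form (H k))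
      \<in> relation_ideal sk_rels" if "quad i j k l s p q \<in> sk_rels" for i j k l s p q
  proof -
    note h = calgebra_iso_simps[OF iso]
    have h2: "h (pcls sk_rels (Poly_Mapping.single [x, y] c)) = pcls sk_rels (pm_scale c (linear_form (H x) \<star> linear_form (H y)))" for x y c
      using h(4)[of c "Poly_Mapping.single [x] 1 \<star> Poly_Mapping.single [y] 1"] unfolding h(3) H by simp
    have "quad i j k l s p q = Poly_Mapping.single [i, j] 1 + Poly_Mapping.single [j, i] (-s)
        + Poly_Mapping.single [k, l] (-p) + Poly_Mapping.single [l, k] (-q)"
      by (simp add: quad_def single_uminus)
    then have "h (pcls sk_rels (quad i j k l s p q)) = pcls sk_rels (linear_form (H i) \<star> linear_form (H j)
      + pm_scale (-s) (linear_form (H j) \<star> linear_form (H i))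
      + pm_scale (-p) (linear_form (H k) \<star> linear_form (H l)) + pm_scale (-q) (linear_form (H l) \<star> linear_form (H k)))"
      by (simp only: h(2) h2 add_presented pm_scale_1)
    moreover have "pcls sk_rels (quad i j k l s p q) = pcls sk_rels 0"
      using relations_in_ideal[OF that] by (simp add: pcls_eq_iff)
    moreover have "h (pcls sk_rels 0) = pcls sk_rels 0"
      using h(4)[of 0 0] h(1)[of 0] by (auto simp: carrier_presented)
    ultimately have "pcls sk_rels (linear_form (H i) \<star> linear_form (H j)
      + pm_scale (-s) (linear_form (H j) \<star> linear_form (H i))
      + pm_scale (-p) (linear_form (H k) \<star> linear_form (H l))
      + pm_scale (-q) (linear_form (H l) \<star> linear_form (H k))) = pcls sk_rels 0"
      by simp
    moreover have "pm_scale (- c) f = - pm_scale c f" for c and f :: "4 list \<Rightarrow>\<^sub>0 complex"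
      by (rule poly_mapping_eqI) simp
    ultimately show ?thesis
      unfolding pcls_eq_iff by simp
  qed
  have quad1: "quad i j k l 1 p p \<in> sk_rels" and quad2: "quad i j k l (-1) 1 (-1) \<in> sk_rels"
    if "(i, j, k, l, p) \<in> sklyanin_index \<alpha> \<beta> \<gamma>" for i j k l p
    using that unfolding sklyanin_relations_eq quads_def by blast+
  note coeffs1 = sklyanin_ideal_coeffs[OF h_quad[OF quad1]]
    and coeffs2 = sklyanin_ideal_coeffs[OF h_quad[OF quad2]]
  note lookups = lookup_minus lookup_pm_scale lookup_conv_linear_form
  \<comment> \<open>No relation contains a square x_c x_c. In the image of the second relation its
    coefficient is 2 \<open>H i c\<close> \<open>H j c\<close>, in that of the first it is -2p
    \<open>H k c\<close> \<open>H l c\<close>.\<close>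
  have col_index: "H i c * H j c = 0" "H k c * H l c = 0"
    if T: "(i, j, k, l, p) \<in> sklyanin_index \<alpha> \<beta> \<gamma>" for i j k l p c
    using coeffs1(3)[OF T, of c] coeffs2(3)[OF T, of c] index_nonzero[OF T]
    unfolding lookups by (simp_all add: algebra_simps)
  \<comment> \<open>Each of the six pairs of indices occurs in one of the three blocks, as {i, j} or
    as {k, l}.\<close>
  have col: "H x c * H y c = 0" if "x \<noteq> y" for x y c
    using exhaust_mod_4[of x] exhaust_mod_4[of y] that
      col_index[of 0 1 2 3 \<alpha> c] col_index[of 0 2 3 1 \<beta> c] col_index[of 0 3 1 2 \<gamma> c]
    by auto
  have diag: "H i j = 0 \<and> H j i = 0 \<and> H k l = 0 \<and> H l k = 0 \<and> H i i * H j j = H k k * H l l"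
    if T: "(i, j, k, l, p) \<in> sklyanin_index \<alpha> \<beta> \<gamma>" for i j k l p
  proof -
    note eqs = involution_diagonal[OF sklyanin_index_distinct[OF T] index_nonzero[OF T] col sq,
        of "\<lambda>a b. H i a * H j b - H j a * H i b - p * (H k a * H l b + H l a * H k b)"
           "\<lambda>a b. H i a * H j b + H j a * H i b - H k a * H l b + H l a * H k b"]
    have "p * ((H i i * H j j - H j i * H i j - p * (H k i * H l j + H l i * H k j))
        - (H i j * H j i - H j j * H i i - p * (H k j * H l i + H l j * H k i)))
      + (H i k * H j l - H j k * H i l - p * (H k k * H l l + H l k * H k l))
      + (H i l * H j k - H j l * H i k - p * (H k l * H l k + H l l * H k k)) = 0"
      using coeffs1(4)[OF T T] unfolding lookups by (simp add: algebra_simps)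
    moreover have "(H i i * H j j + H j i * H i j - H k i * H l j + H l i * H k j)
      + (H i j * H j i + H j j * H i i - H k j * H l i + H l j * H k i)
      + (H i k * H j l + H j k * H i l - H k k * H l l + H l k * H k l)
      - (H i l * H j k + H j l * H i k - H k l * H l k + H l l * H k k) = 0"
      using coeffs2(5)[OF T T] unfolding lookups by (simp add: algebra_simps)
    ultimately show ?thesis
      using eqs by blast
  qed
  have off: "H x y = 0" if "x \<noteq> y" for x y
    using exhaust_mod_4[of x] exhaust_mod_4[of y] that
      diag[of 0 1 2 3 \<alpha>] diag[of 0 2 3 1 \<beta>] diag[of 0 3 1 2 \<gamma>]
    by auto
  show ?thesis
  proof (rule that[of "\<lambda>i. H i i"])
    fix i
    have "H i = (\<lambda>j. if j = i then H i i else 0)"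
      using off by fastforce
    then have "linear_form (H i) = Poly_Mapping.single [i] (H i i)"
      unfolding single_linear_form by (rule arg_cong)
    then show "h (sk_gen i) = pcls sk_rels (Poly_Mapping.single [i] (H i i))"
      using H by simp
    have "(\<Sum>z\<in>UNIV. H i z * H z i) = H i i * H i i"
      using off by (subst sum.remove[of _ i]) auto
    then show "H i i * H i i = 1" using sq[of i i] by simp
  qed (use diag in blast)
qed

text \<open>
  If \<open>(\<epsilon>1, \<epsilon>2)\<close> took the same value at \<open>j \<noteq> k\<close>, the coordinate functions \<open>j\<close> and \<open>k\<close> would be
  proportional on the \<open>X\<^sub>i\<close>, and the \<open>X\<^sub>i\<close> would not span the degree-one part.
\<close>

lemma signs_inj:
  fixes x :: "4 \<Rightarrow> 4 presented"
  assumes iso1: "h1 \<in> calgebra_iso sk_alg sk_alg" and iso2: "h2 \<in> calgebra_iso sk_alg sk_alg"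
    and \<epsilon>1: "\<And>i. h1 (sk_gen i) = pcls sk_rels (Poly_Mapping.single [i] (\<epsilon>1 i))"
    and \<epsilon>2: "\<And>i. h2 (sk_gen i) = pcls sk_rels (Poly_Mapping.single [i] (\<epsilon>2 i))"
    and \<epsilon>2_sq: "\<And>i. \<epsilon>2 i * \<epsilon>2 i = 1"
    and x: "\<And>i. x i \<in> presented_degree sk_rels 1" and gen: "generates_calgebra sk_alg (range x)"
    and x1: "\<And>i. h1 (x i) = x (i + 2)"
    and x2: "\<And>i::nat. h2 (x (of_nat i)) = (-1) ^ i \<odot>\<^bsub>sk_alg\<^esub> x (of_nat i)"
  shows "inj (\<lambda>i. (\<epsilon>1 i, \<epsilon>2 i))"
proof (rule injI, rule ccontr)
  fix j k assume eq: "(\<epsilon>1 j, \<epsilon>2 j) = (\<epsilon>1 k, \<epsilon>2 k)" and jk: "j \<noteq> k"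
  have "\<exists>c. x i = pcls sk_rels (linear_form c)" for i
    using degree_one_linear_form[OF x] by metis
  then obtain X where X: "x i = pcls sk_rels (linear_form (X i))" for i
    by metis
  have act: "h (pcls sk_rels (linear_form a)) = pcls sk_rels (linear_form (\<lambda>i. a i * \<epsilon> i))"
    if "h \<in> calgebra_iso sk_alg sk_alg" "\<And>i. h (sk_gen i) = pcls sk_rels (Poly_Mapping.single [i] (\<epsilon> i))" for h \<epsilon> a
  proof -
    have "(\<Sum>i\<in>UNIV. a i * (if j = i then \<epsilon> i else 0)) = a j * \<epsilon> j" for j
      by (simp add: if_distrib cong: if_cong)
    then show ?thesis
      using calgebra_iso_linear_form[OF that(1), of "\<lambda>i j. if j = i then \<epsilon> i else 0" a] that(2)
      by (simp add: single_linear_form)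
  qed
  have X1: "X (i + 2) c = X i c * \<epsilon>1 c" for i c
    using x1[of i] unfolding X act[OF iso1 \<epsilon>1] pcls_linear_form_eq_iff by (simp add: fun_eq_iff)
  have X2: "X (of_nat i) c * \<epsilon>2 c = (-1) ^ i * X (of_nat i) c" for i c
  proof -
    have "pm_scale d (linear_form a) = linear_form (\<lambda>i. d * a i)" for d a
      by (simp add: linear_form_def pm_scale_sum)
    then show ?thesis
      using x2[of i] unfolding X act[OF iso2 \<epsilon>2] smult_presented by (simp add: pcls_linear_form_eq_iff fun_eq_iff)
  qed
  have odd: "X 1 c = 0 \<and> X 3 c = 0" if "\<epsilon>2 c = 1" for c
    using X2[of 1 c] X2[of 3 c] that by simp
  have even: "X 0 c = 0 \<and> X 2 c = 0" if "\<epsilon>2 c = -1" for c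
    using X2[of 0 c] X2[of 2 c] that by simp
  have step: "X 2 c = X 0 c * \<epsilon>1 c" "X 3 c = X 1 c * \<epsilon>1 c" for c
    using X1[of 0 c] X1[of 1 c] by simp_all
  \<comment> \<open>Coordinates j and k of \<open>X i\<close> vanish unless the parity of i fits the
    common sign of \<open>\<epsilon>2\<close>; the two generators that remain differ in these
    coordinates only by the common sign of \<open>\<epsilon>1\<close>. So \<open>X u\<close>, with u
    = 0 or u = 1, determines both columns.\<close>
  have "\<epsilon>2 j = 1 \<or> \<epsilon>2 j = -1"
    using \<epsilon>2_sq[of j] square_eq_1_iff by blast
  then obtain u where u: "\<And>i. X i j * X u k = X i k * X u j" "\<And>i. X u j = 0 \<Longrightarrow> X u k = 0 \<Longrightarrow> X i j = 0 \<and> X i k = 0"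
  proof
    assume e: "\<epsilon>2 j = 1"
    show thesis
    proof (rule that[of 0])
      fix i
      show "X i j * X 0 k = X i k * X 0 j"
        using exhaust_mod_4[of i] odd[of j] odd[of k] step[of j] step[of k] e eq by auto
      show "X 0 j = 0 \<Longrightarrow> X 0 k = 0 \<Longrightarrow> X i j = 0 \<and> X i k = 0"
        using exhaust_mod_4[of i] odd[of j] odd[of k] step[of j] step[of k] e eq by auto
    qed
  next
    assume e: "\<epsilon>2 j = -1"
    show thesis
    proof (rule that[of 1])
      fix i
      show "X i j * X 1 k = X i k * X 1 j"
        using exhaust_mod_4[of i] even[of j] even[of k] step[of j] step[of k] e eq by auto
      show "X 1 j = 0 \<Longrightarrow> X 1 k = 0 \<Longrightarrow> X i j = 0 \<and> X i k = 0"
        using exhaust_mod_4[of i] even[of j] even[of k] step[of j] step[of k] e eq by auto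
    qed
  qed
  obtain s t where st: "s \<noteq> 0 \<or> t \<noteq> 0" "\<And>i. s * X i j + t * X i k = 0"
  proof (cases "X u j = 0 \<and> X u k = 0")
    case True
    then show thesis using that[of 1 0] u(2) by simp
  next
    case False
    then show thesis using that[of "X u k" "- X u j"] u(1) by (auto simp: algebra_simps)
  qed
  \<comment> \<open>\<open>D\<close> is the linear form on degree one that vanishes on all
    generators \<open>x i\<close>, extended by 0 to the other degrees. Its kernel \<open>K\<close>
    will be a proper subalgebra containing them.\<close>
  define D where "D f = s * Poly_Mapping.lookup f [j] + t * Poly_Mapping.lookup f [k]" for f
  define K where "K = pcls sk_rels ` {f. D f = 0}"
  have D_add: "D (f + g) = D f + D g" and D_minus: "D (f - g) = D f - D g"
    and D_scale: "D (pm_scale c f) = c * D f" for f g c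
    by (simp_all add: D_def lookup_add lookup_minus algebra_simps)
  have D_cong: "D f = D g" if "pcls sk_rels f = pcls sk_rels g" for f g
  proof -
    have "D (f - g) = 0"
      using that sklyanin_ideal_coeffs(2)[of "f - g" \<alpha> \<beta> \<gamma>] by (simp add: pcls_eq_iff D_def)
    then show ?thesis by (simp add: D_minus)
  qed
  \<comment> \<open>\<open>D\<close> is a derivation over the constant term, which makes its kernel
    closed under products.\<close>
  have D_conv: "D (f \<star> g) = Poly_Mapping.lookup f [] * D g + D f * Poly_Mapping.lookup g []" for f g
  proof -
    have "Poly_Mapping.lookup (f \<star> g) [i] = Poly_Mapping.lookup f [] * Poly_Mapping.lookup g [i]
        + Poly_Mapping.lookup f [i] * Poly_Mapping.lookup g []" for i
    proof (rule additive_eqI[of f UNIV])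
      fix v c
      show "Poly_Mapping.lookup (Poly_Mapping.single v c \<star> g) [i] = Poly_Mapping.lookup (Poly_Mapping.single v c) [] * Poly_Mapping.lookup g [i]
        + Poly_Mapping.lookup (Poly_Mapping.single v c) [i] * Poly_Mapping.lookup g []"
        by (rule additive_eqI[of g UNIV])
          (auto simp: conv_add_right lookup_add lookup_single when_def algebra_simps append_eq_Cons_conv)
    qed (simp_all add: conv_add_left lookup_add algebra_simps)
    then show ?thesis by (simp add: D_def algebra_simps)
  qed
  interpret S: ring sk_alg by (rule ring_presented)
  have "subring K sk_alg"
  proof (rule S.subringI)
    show "K \<subseteq> carrier sk_alg" by (auto simp: K_def)
    show "\<one>\<^bsub>sk_alg\<^esub> \<in> K" by (auto simp: K_def one_presented D_def lookup_single)
    show "\<ominus>\<^bsub>sk_alg\<^esub> a \<in> K" if a: "a \<in> K" for a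
    proof -
      obtain f where f: "a = pcls sk_rels f" "D f = 0" using a by (auto simp: K_def)
      have "pcls sk_rels (- f) \<oplus>\<^bsub>sk_alg\<^esub> pcls sk_rels f = \<zero>\<^bsub>sk_alg\<^esub>"
        by (simp add: zero_presented)
      then have "\<ominus>\<^bsub>sk_alg\<^esub> a = pcls sk_rels (- f)"
        unfolding f(1) by (rule S.minus_equality) simp_all
      moreover have "D (- f) = 0" using f(2) D_minus[of 0 f] by (simp add: D_def)
      ultimately show ?thesis by (auto simp: K_def)
    qed
    show "a \<otimes>\<^bsub>sk_alg\<^esub> b \<in> K" "a \<oplus>\<^bsub>sk_alg\<^esub> b \<in> K" if ab: "a \<in> K" "b \<in> K" for a b
    proof -
      obtain f g where fg: "a = pcls sk_rels f" "D f = 0" "b = pcls sk_rels g" "D g = 0"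
        using ab by (auto simp: K_def)
      then have "D (f \<star> g) = 0" "D (f + g) = 0" by (simp_all add: D_conv D_add)
      then show "a \<otimes>\<^bsub>sk_alg\<^esub> b \<in> K" "a \<oplus>\<^bsub>sk_alg\<^esub> b \<in> K"
        unfolding fg mult_presented add_presented K_def by blast+
    qed
  qed
  moreover have "c \<odot>\<^bsub>sk_alg\<^esub> a \<in> K" if a: "a \<in> K" for a c
  proof -
    obtain f where f: "a = pcls sk_rels f" "D f = 0" using a by (auto simp: K_def)
    then have "D (pm_scale c f) = 0" by (simp add: D_scale)
    then show ?thesis unfolding f(1) smult_presented K_def by blast
  qed
  moreover have "range x \<subseteq> K"
    using st(2) by (auto simp: K_def X D_def lookup_linear_form)
  ultimately have "K = carrier sk_alg"
    using gen by (simp add: generates_calgebra_def)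
  have "D (Poly_Mapping.single [i] 1) = 0" for i
  proof -
    have "sk_gen i \<in> K" unfolding \<open>K = carrier sk_alg\<close> by (rule pcls_closed)
    then obtain f where "sk_gen i = pcls sk_rels f" "D f = 0" unfolding K_def by blast
    then show ?thesis using D_cong by metis
  qed
  \<comment> \<open>\<open>D\<close> takes the values s and t on the Sklyanin generators j and k,
    and these are not both 0.\<close>
  from this[of j] this[of k] show False
    using st(1) jk by (simp add: D_def lookup_single)
qed

end

section \<open>Odesskii's example\<close>

context matrix_twist
begin

text \<open>All four words carry multiples of m_i m_j, so modulo bilinearity the image is a single
  relation of \<open>rA\<close> tensored with that matrix. The pairs {i, j} and {k, q} have opposite
  commutation signs \<open>s'\<close> and \<open>- s'\<close>; hypothesis \<open>b\<close> says that
  the scalars \<open>l\<close> match the factor \<open>\<kappa>\<close> with the coefficient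
  \<open>e\<close>.\<close>

lemma \<psi>_quad:
  assumes ji: "m j ** m i = mat_scale s' (m i ** m j)" and kq: "m k ** m q = mat_scale \<kappa> (m i ** m j)"
    and qk: "m q ** m k = mat_scale (- s' * \<kappa>) (m i ** m j)"
    and b: "b * \<kappa> * (l k * l q) = e * (l i * l j)"
    and rel: "quad i j k q (s * s') (p * e) (- t * s' * e) \<in> relation_ideal rA"
  shows "\<psi> (quad i j k q s (p * b) (t * b)) \<in> TI"
proof -
  let ?n = "m i ** m j" and ?c = "l i * l j"
  let ?f = "pm_scale ?c (quad i j k q (s * s') (p * e) (- t * s' * e))"
  have pp: "p * b * (l k * l q) * \<kappa> = ?c * (p * e)" and tt: "t * b * (l k * l q) * (- s' * \<kappa>) = ?c * (- t * s' * e)"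
    using arg_cong[OF b, of "\<lambda>x. p * x"] arg_cong[OF b, of "\<lambda>x. - t * s' * x"] by (simp_all add: mult_ac)
  have right: "ten rA (word w) (mat_scale d ?n) c - ten rA (word w) ?n (c * d) \<in> TI" for w c d
    using ten_scale_right[of rA "word w" d ?n c] by (simp add: mult.commute)
  have comb: "(a - u1 - u2 - u3) - (a - v1 - v2 - v3) \<in> TI"
    if "u1 - v1 \<in> TI" "u2 - v2 \<in> TI" "u3 - v3 \<in> TI" for a u1 u2 u3 v1 v2 v3
    using T.I_uminus[OF T.I_add[OF T.I_add[OF that(1,2)] that(3)]] by (simp add: algebra_simps)
  have psi: "\<psi> (quad i j k q s (p * b) (t * b)) = ten rA (word [i, j]) ?n ?c
      - ten rA (word [j, i]) (mat_scale s' ?n) (s * ?c)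
      - ten rA (word [k, q]) (mat_scale \<kappa> ?n) (p * b * (l k * l q))
      - ten rA (word [q, k]) (mat_scale (- s' * \<kappa>) ?n) (t * b * (l k * l q))"
    by (simp add: quad_def \<psi>_minus \<psi>_single ji kq qk mult_ac)
  have lin: "lin_ext (\<lambda>w. ten rA (word w) ?n 1) ?f
    = ten rA (word [i, j]) ?n ?c - ten rA (word [j, i]) ?n (s * ?c * s')
      - ten rA (word [k, q]) ?n (p * b * (l k * l q) * \<kappa>)
      - ten rA (word [q, k]) ?n (t * b * (l k * l q) * (- s' * \<kappa>))"
    unfolding pp tt by (simp add: quad_def pm_scale_minus lin_ext_minus ten_scale mult_ac)
  have "\<psi> (quad i j k q s (p * b) (t * b)) - lin_ext (\<lambda>w. ten rA (word w) ?n 1) ?f \<in> TI"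
    unfolding psi lin by (intro comb right)
  moreover have "lin_ext (\<lambda>w. ten rA (word w) ?n 1) ?f \<in> TI"
    using T.I_minus[OF ten_zero[OF relation_ideal_closed(5)[OF rel, of ?c], of ?n 1] ten_expand[of rA ?f ?n 1]]
    by simp
  ultimately show ?thesis
    using T.I_add by fastforce
qed

text \<open>The same computation backwards: pairing with \<open>n\<close> gives a common factor <m_i
  m_j, n> / (l_i l_j) times a single relation of \<open>rC\<close>.\<close>

lemma untwist_quad:
  assumes ji: "m j ** m i = mat_scale s' (m i ** m j)" and kq: "m k ** m q = mat_scale \<kappa> (m i ** m j)"
    and qk: "m q ** m k = mat_scale (- s' * \<kappa>) (m i ** m j)"
    and b: "b * \<kappa> * (l k * l q) = e * (l i * l j)" and "\<kappa> * \<kappa> = 1" "b * b = 1" "e \<noteq> 0"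
    and rel: "quad i j k q (s * s') (p * b / e) (- t * s' * b / e) \<in> relation_ideal rC"
  shows "untwist n (quad i j k q s p t) \<in> relation_ideal rC"
proof -
  let ?c = "mat_ip (m i ** m j) n / (l i * l j)"
  \<comment> \<open>Hypothesis \<open>b\<close> multiplied by \<open>\<kappa>\<close>, whose square
    is 1, and solved for the scalar of the pair {k, q}.\<close>
  have "\<kappa> / (l k * l q) = b / e / (l i * l j)"
  proof -
    have "\<kappa> * (e * (l i * l j)) = b * (\<kappa> * \<kappa>) * (l k * l q)"
      unfolding b[symmetric] by (simp add: mult_ac)
    also have "\<dots> = b * (l k * l q)" using assms by simp
    finally show ?thesis using l_nonzero \<open>e \<noteq> 0\<close> by (simp add: field_simps)
  qed
  then have x: "x * (\<kappa> * mat_ip (m i ** m j) n) / (l k * l q) = ?c * (x * b / e)" for x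
    by (metis (no_types, opaque_lifting) mult.assoc mult.commute times_divide_eq_left times_divide_eq_right)
  have "untwist n (quad i j k q s p t) = pm_scale ?c (quad i j k q (s * s') (p * b / e) (- t * s' * b / e))"
    using x[of p] x[of "- t * s'"]
    by (simp add: quad_def untwist_minus untwist_single ji kq qk mat_ip_scale pm_scale_minus mult_ac)
  then show ?thesis using relation_ideal_closed(5)[OF rel] by simp
qed

end

text \<open>One orthogonal matrix for each character of the group, given by its values (s, t) on the
  two generators. Values other than 1 are read as -1.\<close>

definition klein_matrix :: "complex \<Rightarrow> complex \<Rightarrow> mat2" where
  "klein_matrix s t = (if s = 1 then if t = 1 then mat 1 else dm else if t = 1 then pm else dm ** pm)"

lemma klein_matrix_properties:
  assumes "s * s = 1" "t * t = 1"
  shows "klein_matrix s t ** transpose (klein_matrix s t) = mat 1"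
    "conjugation dm (klein_matrix s t) = mat_scale s (klein_matrix s t)"
    "conjugation pm (klein_matrix s t) = mat_scale t (klein_matrix s t)"
proof -
  have "s = 1 \<or> s = -1" "t = 1 \<or> t = -1"
    using assms square_eq_1_iff by blast+
  then show "klein_matrix s t ** transpose (klein_matrix s t) = mat 1"
    "conjugation dm (klein_matrix s t) = mat_scale s (klein_matrix s t)"
    "conjugation pm (klein_matrix s t) = mat_scale t (klein_matrix s t)"
    by (auto simp: klein_matrix_def mat2_eq_iff conjugation_dm_nth conjugation_pm_nth mat2_mult_nth mat_def transpose_def)
qed

text \<open>Up to scalars these are the identity and the three Pauli matrices, and two different
  Pauli matrices anticommute.\<close>

lemma klein_matrix_commute:
  assumes "s * s = 1" "t * t = 1" "u * u = 1" "v * v = 1" "(s, t) \<noteq> (u, v)"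
  shows "klein_matrix u v ** klein_matrix s t =
    mat_scale (if (s, t) = (1, 1) \<or> (u, v) = (1, 1) then 1 else -1) (klein_matrix s t ** klein_matrix u v)"
proof -
  have "s = 1 \<or> s = -1" "t = 1 \<or> t = -1" "u = 1 \<or> u = -1" "v = 1 \<or> v = -1"
    using assms square_eq_1_iff by blast+
  then show ?thesis
    using assms(5) by (elim disjE) (simp_all add: klein_matrix_def mat2_eq_iff mat2_mult_nth mat_def)
qed

lemma orthogonal_mult:
  assumes "a ** transpose a = mat 1" "b ** transpose b = (mat 1 :: mat2)"
  shows "(a ** b) ** transpose (a ** b) = mat 1"
proof -
  have "(a ** b) ** transpose (a ** b) = a ** (b ** transpose b) ** transpose a"
    by (simp add: matrix_transpose_mul matrix_mul_assoc)
  then show ?thesis using assms by simp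
qed

text \<open>Equal sign products put both matrix products on the same eigenline, so they are
  proportional. Both are orthogonal and hence have norm 1 under the bilinear form, so the factor
  squares to 1.\<close>

lemma klein_matrix_product:
  fixes \<epsilon>1 \<epsilon>2 :: "'i \<Rightarrow> complex"
  assumes sq: "\<And>i. \<epsilon>1 i * \<epsilon>1 i = 1" "\<And>i. \<epsilon>2 i * \<epsilon>2 i = 1"
    and eq: "\<epsilon>1 i * \<epsilon>1 j = \<epsilon>1 k * \<epsilon>1 q" "\<epsilon>2 i * \<epsilon>2 j = \<epsilon>2 k * \<epsilon>2 q"
  defines "m \<equiv> \<lambda>i. klein_matrix (\<epsilon>1 i) (\<epsilon>2 i)"
  obtains \<kappa> where "m k ** m q = mat_scale \<kappa> (m i ** m j)" "\<kappa> * \<kappa> = 1"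
proof -
  have orth: "(m i ** m j) ** transpose (m i ** m j) = mat 1" for i j
    by (intro orthogonal_mult) (simp_all add: m_def klein_matrix_properties sq)
  have conj: "conjugation dm (m i ** m j) = mat_scale (\<epsilon>1 i * \<epsilon>1 j) (m i ** m j)"
    "conjugation pm (m i ** m j) = mat_scale (\<epsilon>2 i * \<epsilon>2 j) (m i ** m j)" for i j
    using mat2_endo_dm mat2_endo_pm
    by (simp_all add: mat2_endo_def m_def klein_matrix_properties sq mat_scale_mult mult.commute)
  have sqs: "\<epsilon>1 i * \<epsilon>1 j * (\<epsilon>1 i * \<epsilon>1 j) = 1" "\<epsilon>2 i * \<epsilon>2 j * (\<epsilon>2 i * \<epsilon>2 j) = 1"
    using sq[of i] sq[of j] by (simp_all add: mult_ac)
  have "m i ** m j \<noteq> 0"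
    using mat_ip_self[OF orth[of i j]] by (auto simp: mat_ip_def)
  then obtain \<kappa> where \<kappa>: "m k ** m q = mat_scale \<kappa> (m i ** m j)"
    using common_eigenspace[OF sqs _ conj[of i j], of "m k ** m q"] conj[of k q] eq by metis
  have "\<kappa> * \<kappa> = 1"
    using mat_ip_self[OF orth[of k q]] mat_ip_self[OF orth[of i j]] unfolding \<kappa> by (simp add: mat_ip_scale)
  with \<kappa> that show ?thesis by blast
qed

text \<open>Normalise l_0 = 1 and solve the first equation for l_1; the other two then read l_3^2 =
  c1 c2 and l_2^2 = c1 c3.\<close>

lemma scaling_factors:
  assumes "c1 \<noteq> (0::complex)" "c2 \<noteq> 0" "c3 \<noteq> 0"
  obtains l :: "4 \<Rightarrow> complex" where "\<And>i. l i \<noteq> 0"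
    "l 2 * l 3 = c1 * (l 0 * l 1)" "l 3 * l 1 = c2 * (l 0 * l 2)" "l 1 * l 2 = c3 * (l 0 * l 3)"
proof -
  define u v where "u = csqrt (c1 * c3)" and "v = csqrt (c1 * c2)"
  have u: "u * u = c1 * c3" and v: "v * v = c1 * c2"
    using power2_csqrt[of "c1 * c3"] power2_csqrt[of "c1 * c2"] by (simp_all add: u_def v_def power2_eq_square)
  have nz: "u \<noteq> 0" "v \<noteq> 0"
    using u v assms by auto
  define l :: "4 \<Rightarrow> complex" where "l i = (if i = 0 then 1 else if i = 1 then u * v / c1 else if i = 2 then u else v)" for i
  have l: "l 0 = 1" "l 1 = u * v / c1" "l 2 = u" "l 3 = v"
    by (simp_all add: l_def)
  show ?thesis
  proof (rule that[of l])
    show "l i \<noteq> 0" for i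
      using nz assms by (simp add: l_def)
    show "l 2 * l 3 = c1 * (l 0 * l 1)"
      using assms by (simp add: l)
    have "v * (u * v / c1) = u * (v * v) / c1" by (simp add: mult_ac)
    then show "l 3 * l 1 = c2 * (l 0 * l 2)"
      using assms by (simp add: l v)
    have "u * v / c1 * u = v * (u * u) / c1" by (simp add: mult_ac)
    then show "l 1 * l 2 = c3 * (l 0 * l 3)"
      using assms by (simp add: l u)
  qed
qed

text \<open>The fifth entry is the sign that sets the third pair of Odesskii's relations apart from
  the first two.\<close>

definition odesskii_index ::
    "complex \<Rightarrow> complex \<Rightarrow> complex \<Rightarrow> (4 \<times> 4 \<times> 4 \<times> 4 \<times> complex \<times> complex) set" where
  "odesskii_index \<alpha> \<beta> \<gamma> = {(0, 1, 2, 3, 1, \<alpha>), (0, 2, 3, 1, 1, \<beta>), (0, 3, 1, 2, -1, \<gamma>)}"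

lemma odesskii_relations_index: "odesskii_relations \<alpha> \<beta> \<gamma> =
    (\<Union>(i, j, k, q, b, p)\<in>odesskii_index \<alpha> \<beta> \<gamma>. {quad i j k q 1 (p * b) (- p * b), quad i j k q (-1) b b})"
  by (simp add: odesskii_relations_eq odesskii_index_def insert_commute)

text \<open>Here \<open>z\<close> is the index that carries the identity matrix, and
  \<open>i\<close> names the block whose first pair is {0, i}.\<close>

definition twisted_parameter :: "4 \<Rightarrow> 4 \<Rightarrow> complex \<Rightarrow> complex" where
  "twisted_parameter z i p = (if z = 0 \<or> z = i then p else 1 / p)"

text \<open>Either no parameter or exactly two are inverted, and inverting two divides the defining
  equation by their product.\<close>

lemma twisted_parameters:
  assumes "sklyanin_parameters \<alpha> \<beta> \<gamma>"
  shows "sklyanin_parameters (twisted_parameter z 1 \<alpha>) (twisted_parameter z 2 \<beta>) (twisted_parameter z 3 \<gamma>)"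
proof -
  have nz: "\<alpha> \<noteq> 0" "\<beta> \<noteq> 0" "\<gamma> \<noteq> 0" and sum: "\<alpha> + \<beta> + \<gamma> + \<alpha> * \<beta> * \<gamma> = 0"
    using assms by (auto simp: sklyanin_parameters_def)
  have "\<alpha> + 1 / \<beta> + 1 / \<gamma> + \<alpha> * (1 / \<beta>) * (1 / \<gamma>) = (\<alpha> + \<beta> + \<gamma> + \<alpha> * \<beta> * \<gamma>) / (\<beta> * \<gamma>)"
    "1 / \<alpha> + \<beta> + 1 / \<gamma> + 1 / \<alpha> * \<beta> * (1 / \<gamma>) = (\<alpha> + \<beta> + \<gamma> + \<alpha> * \<beta> * \<gamma>) / (\<alpha> * \<gamma>)"
    "1 / \<alpha> + 1 / \<beta> + \<gamma> + 1 / \<alpha> * (1 / \<beta>) * \<gamma> = (\<alpha> + \<beta> + \<gamma> + \<alpha> * \<beta> * \<gamma>) / (\<alpha> * \<beta>)"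
    using nz by (simp_all add: field_simps)
  moreover have "- 1 \<noteq> 1 / \<alpha>" "- 1 \<noteq> 1 / \<beta>" "- 1 \<noteq> 1 / \<gamma>"
  proof -
    have "- 1 \<noteq> 1 / p" if "p \<noteq> -1" for p :: complex
      using that by (metis div_by_1 divide_divide_eq_right divide_minus_right mult_1)
    moreover have "\<alpha> \<noteq> -1" "\<beta> \<noteq> -1" "\<gamma> \<noteq> -1"
      using assms by (auto simp: sklyanin_parameters_def)
    ultimately show "- 1 \<noteq> 1 / \<alpha>" "- 1 \<noteq> 1 / \<beta>" "- 1 \<noteq> 1 / \<gamma>" by blast+
  qed
  ultimately show ?thesis
    using assms exhaust_mod_4[of z]
    by (elim disjE) (simp_all add: twisted_parameter_def sklyanin_parameters_def)
qed

text \<open>Four distinct pairs among the four possible ones: by counting every pair of signs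
  occurs, in particular the trivial one.\<close>

lemma sign_pairs_onto:
  fixes \<epsilon>1 \<epsilon>2 :: "4 \<Rightarrow> complex"
  assumes "\<And>i. \<epsilon>1 i * \<epsilon>1 i = 1" "\<And>i. \<epsilon>2 i * \<epsilon>2 i = 1" "inj (\<lambda>i. (\<epsilon>1 i, \<epsilon>2 i))"
  obtains z where "\<epsilon>1 z = 1" "\<epsilon>2 z = 1"
proof -
  let ?f = "\<lambda>i. (\<epsilon>1 i, \<epsilon>2 i)"
  let ?U = "{1, -1 :: complex} \<times> {1, -1 :: complex}"
  have "range ?f \<subseteq> ?U"
    using assms(1,2) square_eq_1_iff by auto
  moreover have "card (range ?f) = 4"
    unfolding card_image[OF assms(3)] by simp
  moreover have "card ?U = 4"
    unfolding card_cartesian_product by simp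
  ultimately have "range ?f = ?U"
    by (intro card_subset_eq) simp_all
  then have "(1, 1) \<in> range ?f" by simp
  then show ?thesis using that by auto
qed

text \<open>
  Let \<open>z\<close> be the index with \<open>m\<^sub>z = 1\<close>. For a pair \<open>i, j\<close> containing \<open>z\<close>, twisting preserves the type of the
  relations (commutator or anticommutator) on \<open>i, j\<close>; otherwise it exchanges the two types, which replaces the
  parameter by its inverse.
\<close>

lemma odesskii_twist:
  fixes \<epsilon>1 \<epsilon>2 :: "4 \<Rightarrow> complex"
  assumes par: "sklyanin_parameters \<alpha> \<beta> \<gamma>"
    and sq: "\<And>i. \<epsilon>1 i * \<epsilon>1 i = 1" "\<And>i. \<epsilon>2 i * \<epsilon>2 i = 1" and inj: "inj (\<lambda>i. (\<epsilon>1 i, \<epsilon>2 i))"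
    and eq1: "\<And>i j k q p. (i, j, k, q, p) \<in> sklyanin_index \<alpha> \<beta> \<gamma> \<Longrightarrow> \<epsilon>1 i * \<epsilon>1 j = \<epsilon>1 k * \<epsilon>1 q"
    and eq2: "\<And>i j k q p. (i, j, k, q, p) \<in> sklyanin_index \<alpha> \<beta> \<gamma> \<Longrightarrow> \<epsilon>2 i * \<epsilon>2 j = \<epsilon>2 k * \<epsilon>2 q"
  defines "m \<equiv> \<lambda>i. klein_matrix (\<epsilon>1 i) (\<epsilon>2 i)"
  obtains \<alpha>' \<beta>' \<gamma>' l where "sklyanin_parameters \<alpha>' \<beta>' \<gamma>'"
    "matrix_twist_relations (sklyanin_relations \<alpha> \<beta> \<gamma>) (odesskii_relations \<alpha>' \<beta>' \<gamma>') m l"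
proof -
  obtain z where z: "\<epsilon>1 z = 1" "\<epsilon>2 z = 1"
    using sign_pairs_onto[OF sq inj] by blast
  define \<alpha>' \<beta>' \<gamma>' where "\<alpha>' = twisted_parameter z 1 \<alpha>" and "\<beta>' = twisted_parameter z 2 \<beta>" and "\<gamma>' = twisted_parameter z 3 \<gamma>"
  have z_iff: "(\<epsilon>1 i, \<epsilon>2 i) = (1, 1) \<longleftrightarrow> i = z" for i
    using z injD[OF inj, of i z] by auto
  have comm: "m j ** m i = mat_scale (if z = i \<or> z = j then 1 else -1) (m i ** m j)" if "i \<noteq> j" for i j
  proof -
    have "(\<epsilon>1 i, \<epsilon>2 i) \<noteq> (\<epsilon>1 j, \<epsilon>2 j)" using injD[OF inj, of i j] that by auto
    from klein_matrix_commute[OF sq(1) sq(2) sq(1) sq(2) this] show ?thesis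
      unfolding m_def z_iff by (simp only: eq_commute[of i] eq_commute[of j])
  qed
  have nz: "\<alpha> \<noteq> 0" "\<beta> \<noteq> 0" "\<gamma> \<noteq> 0"
    using par by (auto simp: sklyanin_parameters_def)
  have ex: "\<exists>\<kappa>. m k ** m q = mat_scale \<kappa> (m i ** m j) \<and> \<kappa> * \<kappa> = 1" if "(i, j, k, q, p) \<in> sklyanin_index \<alpha> \<beta> \<gamma>" for i j k q p
    using klein_matrix_product[OF sq eq1[OF that] eq2[OF that]] unfolding m_def by metis
  obtain \<kappa>1 where \<kappa>1: "m 2 ** m 3 = mat_scale \<kappa>1 (m 0 ** m 1)" "\<kappa>1 * \<kappa>1 = 1"
    using ex[of 0 1 2 3 \<alpha>] by auto
  obtain \<kappa>2 where \<kappa>2: "m 3 ** m 1 = mat_scale \<kappa>2 (m 0 ** m 2)" "\<kappa>2 * \<kappa>2 = 1"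
    using ex[of 0 2 3 1 \<beta>] by auto
  obtain \<kappa>3 where \<kappa>3: "m 1 ** m 2 = mat_scale \<kappa>3 (m 0 ** m 3)" "\<kappa>3 * \<kappa>3 = 1"
    using ex[of 0 3 1 2 \<gamma>] by auto
  \<comment> \<open>When the twist exchanges types, Odesskii's anticommutator relation comes from
    the Sklyanin commutator relation, whose right side has coefficient \<open>p\<close>. The scalars
    \<open>l\<close> must absorb this coefficient; otherwise it is 1.\<close>
  define e where "e i p = (if z = 0 \<or> z = i then 1 else p)" for i :: 4 and p :: complex
  have e_nz: "e i p \<noteq> 0" if "p \<noteq> 0" for i p using that by (simp add: e_def)
  have \<kappa>_nz: "\<kappa>1 \<noteq> 0" "\<kappa>2 \<noteq> 0" "\<kappa>3 \<noteq> 0" using \<kappa>1 \<kappa>2 \<kappa>3 by auto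
  obtain l :: "4 \<Rightarrow> complex" where l_nz: "\<And>i. l i \<noteq> 0"
    and l: "l 2 * l 3 = e 1 \<alpha> / \<kappa>1 * (l 0 * l 1)" "l 3 * l 1 = e 2 \<beta> / \<kappa>2 * (l 0 * l 2)"
      \<comment> \<open>The extra minus sign realises the fifth entry -1 of the third block.\<close>
      "l 1 * l 2 = (- e 3 \<gamma> / \<kappa>3) * (l 0 * l 3)"
    using scaling_factors[of "e 1 \<alpha> / \<kappa>1" "e 2 \<beta> / \<kappa>2" "- e 3 \<gamma> / \<kappa>3"] e_nz nz \<kappa>_nz by auto
  interpret matrix_twist "sklyanin_relations \<alpha> \<beta> \<gamma>" "odesskii_relations \<alpha>' \<beta>' \<gamma>'" m l
    by unfold_locales (simp_all add: m_def klein_matrix_properties sq l_nz)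
  have triple: "(r \<in> {quad 0 j k q 1 (p' * b) (- p' * b), quad 0 j k q (-1) b b} \<longrightarrow> \<psi> r \<in> TI) \<and>
      (r \<in> {quad 0 j k q 1 p p, quad 0 j k q (-1) 1 (-1)} \<longrightarrow> untwist n r \<in> relation_ideal (odesskii_relations \<alpha>' \<beta>' \<gamma>'))"
    if S: "(0, j, k, q, p) \<in> sklyanin_index \<alpha> \<beta> \<gamma>" and O: "(0, j, k, q, b, p') \<in> odesskii_index \<alpha>' \<beta>' \<gamma>'"
      and \<kappa>: "m k ** m q = mat_scale \<kappa> (m 0 ** m j)" "\<kappa> * \<kappa> = 1" and p': "p' = twisted_parameter z j p"
      and b: "b * b = 1" and bl: "b * \<kappa> * (l k * l q) = e j p * (l 0 * l j)" and p: "p \<noteq> 0"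
    for j k q p b p' \<kappa> r n
  proof -
    let ?s = "if z = 0 \<or> z = j then 1 else - 1 :: complex"
    have d: "distinct [0, j, k, q]" using sklyanin_index_distinct[OF S] .
    \<comment> \<open>\<open>z\<close> lies in exactly one of the pairs {0, j} and {k, q}. The pair
      containing it commutes and the other anticommutes, hence the opposite signs in
      \<open>ji\<close> and \<open>qk\<close>.\<close>
    have z_cases: "z = 0 \<or> z = j \<or> z = k \<or> z = q"
      using S exhaust_mod_4[of z] by (auto elim: sklyanin_index_cases)
    have ji: "m j ** m 0 = mat_scale ?s (m 0 ** m j)"
      using comm[of 0 j] d by auto
    have qk: "m q ** m k = mat_scale (- ?s * \<kappa>) (m 0 ** m j)"
      using comm[of k q] d z_cases \<kappa>(1) by auto
    have relS: "quad 0 j k q 1 p p \<in> relation_ideal (sklyanin_relations \<alpha> \<beta> \<gamma>)"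
      "quad 0 j k q (-1) 1 (-1) \<in> relation_ideal (sklyanin_relations \<alpha> \<beta> \<gamma>)"
      using S by (auto simp: sklyanin_relations_eq quads_def intro!: relations_in_ideal)
    have relO: "quad 0 j k q 1 (p' * b) (- p' * b) \<in> relation_ideal (odesskii_relations \<alpha>' \<beta>' \<gamma>')"
      "quad 0 j k q (-1) b b \<in> relation_ideal (odesskii_relations \<alpha>' \<beta>' \<gamma>')"
      using O by (auto simp: odesskii_relations_index intro!: relations_in_ideal)
    note tw = \<psi>_quad[OF ji \<kappa>(1) qk bl] and un = untwist_quad[OF ji \<kappa>(1) qk bl \<kappa>(2) b e_nz[OF p]]
    show ?thesis
      using tw[of 1 p' "- p'"] tw[of "-1" 1 1] un[of 1 p p n] un[of "-1" 1 "-1" n] relS relO p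
      by (cases "z = 0 \<or> z = j") (auto simp: p' twisted_parameter_def e_def)
  qed
  have bl: "1 * \<kappa>1 * (l 2 * l 3) = e 1 \<alpha> * (l 0 * l 1)" "1 * \<kappa>2 * (l 3 * l 1) = e 2 \<beta> * (l 0 * l 2)"
    "-1 * \<kappa>3 * (l 1 * l 2) = e 3 \<gamma> * (l 0 * l 3)"
    unfolding l using \<kappa>_nz by simp_all
  note triples = triple[OF _ _ \<kappa>1 \<alpha>'_def _ bl(1) nz(1)] triple[OF _ _ \<kappa>2 \<beta>'_def _ bl(2) nz(2)]
    triple[OF _ _ \<kappa>3 \<gamma>'_def _ bl(3) nz(3)]
  have "matrix_twist_relations (sklyanin_relations \<alpha> \<beta> \<gamma>) (odesskii_relations \<alpha>' \<beta>' \<gamma>') m l"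
  proof unfold_locales
    fix r assume "r \<in> odesskii_relations \<alpha>' \<beta>' \<gamma>'"
    then show "\<psi> r \<in> TI"
      unfolding odesskii_relations_index odesskii_index_def using triples[of r] by (auto simp: odesskii_index_def)
  next
    fix r n assume "r \<in> sklyanin_relations \<alpha> \<beta> \<gamma>"
    then show "untwist n r \<in> relation_ideal (odesskii_relations \<alpha>' \<beta>' \<gamma>')"
      unfolding sklyanin_relations_eq quads_def using triples[of r n] by (auto simp: odesskii_index_def)
  qed
  then show ?thesis
    using that twisted_parameters[OF par, of z] unfolding \<alpha>'_def \<beta>'_def \<gamma>'_def by blast
qed

section \<open>From the two generators to the whole Klein four-group\<close>

lemma mat2_endo_id: "(\<And>n. h n = n) \<Longrightarrow> mat2_endo h"
  by (simp add: mat2_endo_def)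

context matrix_twist
begin

lemma compatible_id:
  assumes "F \<in> calgebra_iso A A" "\<And>a. a \<in> carrier A \<Longrightarrow> F a = a" "\<And>n. h n = n"
  shows "compatible (\<lambda>_. 1) F h"
  using assms by (simp add: compatible_def mat2_endo_id)

lemma compatible_comp:
  assumes c1: "compatible \<epsilon>1 F1 h1" and c2: "compatible \<epsilon>2 F2 h2" and iso: "F \<in> calgebra_iso A A"
    and F: "\<And>a. a \<in> carrier A \<Longrightarrow> F a = F1 (F2 a)" and h: "\<And>n. h n = h1 (h2 n)"
  shows "compatible (\<lambda>i. \<epsilon>1 i * \<epsilon>2 i) F h"
  unfolding compatible_def
proof (intro conjI allI)
  show "F \<in> calgebra_iso A A" by (rule iso)
  show "mat2_endo h"
    using compatible_endo[OF c1] compatible_endo[OF c2] by (simp add: mat2_endo_def h)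
  fix i
  have sq: "\<epsilon>1 i * \<epsilon>1 i = 1" "\<epsilon>2 i * \<epsilon>2 i = 1"
    using c1 c2 by (auto simp: compatible_def)
  have "\<epsilon>1 i * \<epsilon>2 i * (\<epsilon>1 i * \<epsilon>2 i) = (\<epsilon>1 i * \<epsilon>1 i) * (\<epsilon>2 i * \<epsilon>2 i)"
    by (simp add: mult_ac)
  then show "\<epsilon>1 i * \<epsilon>2 i * (\<epsilon>1 i * \<epsilon>2 i) = 1" using sq by simp
  show "h (m i) = mat_scale (\<epsilon>1 i * \<epsilon>2 i) (m i)"
    using c1 c2 compatible_endo[OF c1] by (simp add: h compatible_def mult.commute)
  have "F (pcls rA (word [i])) = F1 (\<epsilon>2 i \<odot>\<^bsub>A\<^esub> pcls rA (word [i]))"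
    using c2 by (simp add: F compatible_def)
  also have "\<dots> = \<epsilon>2 i \<odot>\<^bsub>A\<^esub> F1 (pcls rA (word [i]))"
    by (rule compatible_hom(4)[OF c1]) simp
  finally show "F (pcls rA (word [i])) = pcls rA (Poly_Mapping.single [i] (\<epsilon>1 i * \<epsilon>2 i))"
    using c1 by (simp add: compatible_def mult.commute)
qed

text \<open>The matching signs are known only for the two generators. They multiply under
  composition, and every element is its own inverse, so induction over the generated subgroup
  reaches all of G.\<close>

lemma compatible_group:
  fixes G :: "'g monoid"
  assumes "klein_four_group G" and G: "g \<in> carrier G" "generate G {g1, g2} = carrier G" "g1 \<in> carrier G" "g2 \<in> carrier G"
    and \<rho>: "group_action G (carrier A) \<rho>" and iso: "\<And>g. g \<in> carrier G \<Longrightarrow> \<rho> g \<in> calgebra_iso A A"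
    and \<eta>: "group_action G UNIV \<eta>"
    and c1: "compatible \<epsilon>1 (\<rho> g1) (\<eta> g1)" and c2: "compatible \<epsilon>2 (\<rho> g2) (\<eta> g2)"
  shows "\<exists>\<epsilon>. compatible \<epsilon> (\<rho> g) (\<eta> g)"
proof -
  interpret G: group G using assms(1) by (simp add: klein_four_group_def)
  have self_inverse: "inv\<^bsub>G\<^esub> g = g" if "g \<in> carrier G" for g
    using assms(1) that by (intro G.inv_equality) (auto simp: klein_four_group_def)
  have "g \<in> generate G {g1, g2}" using G by simp
  then show ?thesis
  proof (induction rule: generate.induct)
    case one
    have "\<rho> \<one>\<^bsub>G\<^esub> a = a" if "a \<in> carrier A" for a
      using group_action.id_eq_one[OF \<rho>] that by (metis restrict_apply')
    moreover have "\<eta> \<one>\<^bsub>G\<^esub> n = n" for n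
      using group_action.id_eq_one[OF \<eta>] by (metis UNIV_I restrict_apply')
    ultimately show ?case
      using compatible_id[OF iso[OF G.one_closed]] by blast
  next
    case (incl h)
    then show ?case using c1 c2 by auto
  next
    case (inv h)
    then have "inv\<^bsub>G\<^esub> h = h" using G self_inverse by auto
    then show ?case using inv c1 c2 by auto
  next
    case (eng h1 h2)
    then obtain e1 e2 where e: "compatible e1 (\<rho> h1) (\<eta> h1)" "compatible e2 (\<rho> h2) (\<eta> h2)" by blast
    have h: "h1 \<in> carrier G" "h2 \<in> carrier G" using eng G by auto
    show ?case
      using compatible_comp[OF e iso[OF G.m_closed[OF h]]] group_action.composition_rule[OF \<rho> _ h]
        group_action.composition_rule[OF \<eta> _ h] by blast
  qed
qed

end

theorem proposition4p1p17:
  fixes \<alpha> \<beta> \<gamma> :: complex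
    and A :: "4 presented calgebra"
    and \<sigma> :: "(complex ^ 4) set \<Rightarrow> (complex ^ 4) set"
    and L :: "(complex ^ 4) set monoid"
    and \<tau> :: "(complex ^ 4) set"
    and G :: "'g monoid"
    and g\<^sub>1 g\<^sub>2 :: 'g
    and \<rho> :: "'g \<Rightarrow> 4 presented \<Rightarrow> 4 presented"
    and \<eta> :: "'g \<Rightarrow> complex ^ 2 ^ 2 \<Rightarrow> complex ^ 2 ^ 2"
    and x :: "4 \<Rightarrow> 4 presented"
  assumes "sklyanin_parameters \<alpha> \<beta> \<gamma>"
    and "A = sklyanin \<alpha> \<beta> \<gamma>"
    and "associated_automorphism \<alpha> \<beta> \<gamma> \<sigma>"
    and "elliptic_group_law (sklyanin_curve \<alpha> \<beta> \<gamma>) L"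
    and "\<tau> \<in> sklyanin_curve \<alpha> \<beta> \<gamma>"
    and "\<forall>p\<in>sklyanin_curve \<alpha> \<beta> \<gamma>. \<sigma> p = p \<otimes>\<^bsub>L\<^esub> \<tau>"
    and "\<forall>n::nat. n > 0 \<longrightarrow> \<tau> [^]\<^bsub>L\<^esub> n \<noteq> \<one>\<^bsub>L\<^esub>"
    and "klein_four_group G"
    and "g\<^sub>1 \<in> carrier G" and "g\<^sub>2 \<in> carrier G"
    and "generate G {g\<^sub>1, g\<^sub>2} = carrier G"
    and "group_action G (carrier A) \<rho>"
    and "\<forall>g\<in>carrier G. graded_automorphism A (sklyanin_degree \<alpha> \<beta> \<gamma>) (\<rho> g)"
    and "\<forall>i. x i \<in> sklyanin_degree \<alpha> \<beta> \<gamma> 1"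
    and "generates_calgebra A (range x)"
    and "\<forall>i. \<rho> g\<^sub>1 (x i) = x (i + 2)"
    and "\<forall>i::nat. \<rho> g\<^sub>2 (x (of_nat i)) = (-1) ^ i \<odot>\<^bsub>A\<^esub> x (of_nat i)"
    and "group_action G (carrier mat2_calgebra) \<eta>"
    and "\<eta> g\<^sub>1 = conjugation (vector [vector [-1, 0], vector [0, 1]])"
    and "\<eta> g\<^sub>2 = conjugation (vector [vector [0, 1], vector [1, 0]])"
  shows "\<exists>\<alpha>' \<beta>' \<gamma>'. sklyanin_parameters \<alpha>' \<beta>' \<gamma>' \<and>
    calgebra_isomorphic
      (invariant_calgebra G (\<lambda>g. tensor_map A mat2_calgebra (\<rho> g) (\<eta> g)) (tensor_calgebra A mat2_calgebra))
      (presented_calgebra (odesskii_relations \<alpha>' \<beta>' \<gamma>'))"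
proof -
  note par = assms(1)
  let ?rS = "sklyanin_relations \<alpha> \<beta> \<gamma>"
  have A: "A = presented_calgebra ?rS"
    using assms(2) by (simp add: sklyanin_def)
  have graded: "graded_automorphism (presented_calgebra ?rS) (presented_degree ?rS) (\<rho> g)" if "g \<in> carrier G" for g
    using assms(13) that by (simp add: A sklyanin_degree_def[abs_def])
  have iso: "\<rho> g \<in> calgebra_iso (presented_calgebra ?rS) (presented_calgebra ?rS)" if "g \<in> carrier G" for g
    using graded[OF that] by (simp add: graded_automorphism_def)
  have involution: "\<rho> g (\<rho> g a) = a" if g: "g \<in> carrier G" and a: "a \<in> carrier (presented_calgebra ?rS)" for g a
  proof -
    have "\<rho> g (\<rho> g a) = \<rho> (g \<otimes>\<^bsub>G\<^esub> g) a"
      using group_action.composition_rule[OF assms(12), of a g g] g a A by simp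
    also have "\<dots> = \<rho> \<one>\<^bsub>G\<^esub> a"
      using assms(8) g by (simp add: klein_four_group_def)
    also have "\<dots> = a"
      using group_action.id_eq_one[OF assms(12)] a A by (metis restrict_apply')
    finally show ?thesis .
  qed
  obtain \<epsilon>1 where \<epsilon>1: "\<And>i. \<rho> g\<^sub>1 (pcls ?rS (Poly_Mapping.single [i] 1)) = pcls ?rS (Poly_Mapping.single [i] (\<epsilon>1 i))"
    "\<And>i. \<epsilon>1 i * \<epsilon>1 i = 1"
    "\<And>i j k l p. (i, j, k, l, p) \<in> sklyanin_index \<alpha> \<beta> \<gamma> \<Longrightarrow> \<epsilon>1 i * \<epsilon>1 j = \<epsilon>1 k * \<epsilon>1 l"
    using graded_involution_signs[OF par graded[OF assms(9)] involution[OF assms(9)]] by blast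
  obtain \<epsilon>2 where \<epsilon>2: "\<And>i. \<rho> g\<^sub>2 (pcls ?rS (Poly_Mapping.single [i] 1)) = pcls ?rS (Poly_Mapping.single [i] (\<epsilon>2 i))"
    "\<And>i. \<epsilon>2 i * \<epsilon>2 i = 1"
    "\<And>i j k l p. (i, j, k, l, p) \<in> sklyanin_index \<alpha> \<beta> \<gamma> \<Longrightarrow> \<epsilon>2 i * \<epsilon>2 j = \<epsilon>2 k * \<epsilon>2 l"
    using graded_involution_signs[OF par graded[OF assms(10)] involution[OF assms(10)]] by blast
  have inj: "inj (\<lambda>i. (\<epsilon>1 i, \<epsilon>2 i))"
    using assms(14-17)
    by (intro signs_inj[OF par iso[OF assms(9)] iso[OF assms(10)] \<epsilon>1(1) \<epsilon>2(1) \<epsilon>2(2), of x])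
      (simp_all add: A sklyanin_degree_def)
  let ?m = "\<lambda>i. klein_matrix (\<epsilon>1 i) (\<epsilon>2 i)"
  obtain \<alpha>' \<beta>' \<gamma>' l where par': "sklyanin_parameters \<alpha>' \<beta>' \<gamma>'"
    and twist: "matrix_twist_relations ?rS (odesskii_relations \<alpha>' \<beta>' \<gamma>') ?m l"
    by (rule odesskii_twist[OF par \<epsilon>1(2) \<epsilon>2(2) inj])
      (erule \<epsilon>1(3) | erule \<epsilon>2(3) | rule that, assumption+)+
  interpret matrix_twist_relations ?rS "odesskii_relations \<alpha>' \<beta>' \<gamma>'" ?m l
    by (rule twist)
  have c1: "compatible \<epsilon>1 (\<rho> g\<^sub>1) (conjugation dm)"
    using iso[OF assms(9)] \<epsilon>1 \<epsilon>2 by (simp add: compatible_def mat2_endo_dm klein_matrix_properties)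
  have c2: "compatible \<epsilon>2 (\<rho> g\<^sub>2) (conjugation pm)"
    using iso[OF assms(10)] \<epsilon>1 \<epsilon>2 by (simp add: compatible_def mat2_endo_pm klein_matrix_properties)
  have all: "\<exists>\<epsilon>. compatible \<epsilon> (\<rho> g) (\<eta> g)" if "g \<in> carrier G" for g
    by (rule compatible_group[OF assms(8) that assms(11,9,10)])
      (use assms(12,18-20) iso c1 c2 A in simp_all)
  let ?Inv = "{X \<in> carrier T.Q. \<forall>g\<in>carrier G. tensor_map A mat2_calgebra (\<rho> g) (\<eta> g) X = X}"
  \<comment> \<open>Averaging over the two generators gives one inclusion; for the other, every
    group element has to fix the image of \<open>\<psi>\<close>.\<close>
  have "?Inv = range (\<lambda>f. T.cls (\<psi> f))"
  proof
    show "?Inv \<subseteq> range (\<lambda>f. T.cls (\<psi> f))"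
    proof
      fix X assume "X \<in> ?Inv"
      then show "X \<in> range (\<lambda>f. T.cls (\<psi> f))"
        using assms(9,10,19,20) by (intro invariants_subset_range[OF c1 c2]) (auto simp: A)
    qed
    show "range (\<lambda>f. T.cls (\<psi> f)) \<subseteq> ?Inv"
      using all tensor_map_fixes_\<psi> T.cls_closed[OF \<psi>_supported] unfolding A by blast
  qed
  from twist_isomorphic[OF this]
  have "calgebra_isomorphic
      (invariant_calgebra G (\<lambda>g. tensor_map A mat2_calgebra (\<rho> g) (\<eta> g)) (tensor_calgebra A mat2_calgebra))
      (presented_calgebra (odesskii_relations \<alpha>' \<beta>' \<gamma>'))"
    unfolding invariant_calgebra_def A tensor_calgebra_eq .
  with par' show ?thesis by blast
qed

end
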